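(* Let $f(z)=z+z^2+z^3+o(z^3)$ be a prenormalized parabolic germ of diffeomorphism of $(\mathbb{C},0)$ formally conjugated to $f_0(z)=\frac{z}{1-z}$, with attracting petal $V_+$ and repelling petal $V_-$, and let $H^f$ on $V_+$ and $H^{f^{\circ-1}}$ on $V_-$ be the principal parts of areas for $f$ and $f^{\circ -1}$. The functions $H^f-i\pi^2$ on $V_+$ and $\pi\cdot\mathrm{Id}-H^{f^{\circ -1}}$ on $V_-$ glue to a global analytic function on a neighborhood of $z=0$ if and only if $f$ is of the form $$f(z)=\varphi^{-1}\big(e^z\cdot\varphi(z)\big)$$ for some analytic germ $\varphi(z)\in z+z^2\mathbb{C}\{z\}$. The principal parts are then given by $$H^f(z)=-\pi\log\varphi(z)+i\pi^2-\frac{\pi}{4},\quad z\in V_+,$$ $$H^{f^{\circ -1}}(z)=\pi z+\pi\log\varphi(z)+\frac{\pi}{4},\quad z\in V_-,$$ where the branches of the complex logarithm are determined by the petals.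
   Context: Formal changes of variables are tangent to the identity. The germ $f$ has one attracting petal $V_+$ (a domain accumulating at $0$, $f$-invariant, bisected by the negative real direction and tangent at $0$ to the positive real direction, on which forward orbits of $f$ converge to $0$) and one repelling petal $V_-$ (similarly for $f^{\circ -1}$, bisected by the positive real direction and tangent at $0$ to the negative real direction). Directed area: for $z\in V_+$ let $S^f(z)=\{f^{\circ n}(z): n\ge 0\}$ be the orbit, $S^f(z)_\varepsilon$ its $\varepsilon$-neighborhood (the union of the discs of radius $\varepsilon$ centered at points of the orbit), $A(S^f(z)_\varepsilon)$ its area and $t_{S^f(z)_\varepsilon}\in\mathbb{C}$ its center of mass; $A^{\mathbb{C}}(z,\varepsilon)=A(S^f(z)_\varepsilon)\cdot t_{S^f(z)_\varepsilon}$. For fixed $z\in V_+$ it is known that, as $\varepsilon\to0$, $$A^{\mathbb{C}}(z,\varepsilon)=q_1\varepsilon^2\log\varepsilon+H^{f}(z)\varepsilon^2+q_2\varepsilon^{5/2}\log\varepsilon+R(z,\varepsilon),\quad R(z,\varepsilon)=O(\varepsilon^{5/2}),$$ with $q_1,q_2\in\mathbb{C}$ independent of $z$. The principal part of area for $f$ is the function $z\mapsto H^f(z)$, $z\in V_+$. The principal part $z\mapsto H^{f^{\circ -1}}(z)$, $z\in V_-$, for $f^{\circ -1}$ is defined in the same way from the orbits of $f^{\circ -1}$. Branches: $\log$ is the branch with $\arg\in(0,2\pi)$ on $V_+$ and the principal branch ($\arg\in(-\pi,\pi)$) on $V_-$. "Glue to a global analytic function on a neighborhood of $0$" is understood after removing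 the logarithmic term: there is a function $G$ analytic on a neighborhood of $0$ such that (near $0$) $H^f(z)-i\pi^2+\pi\log z=G(z)$ on $V_+$, where $\log$ is the branch with $\arg z\in(0,2\pi)$, and $\pi z-H^{f^{\circ -1}}(z)+\pi\log z=G(z)$ on $V_-$, where $\log$ is the principal branch with $\arg z\in(-\pi,\pi)$. *)

theory Defs
  imports "HOL-Complex_Analysis.Complex_Analysis" "HOL-Library.Landau_Symbols"
begin

text \<open>Germs at \<open>0\<close> are represented by total functions; only their behaviour near \<open>0\<close> matters.\<close>

definition prenormalized :: "(complex \<Rightarrow> complex) \<Rightarrow> bool" where
  "prenormalized f \<longleftrightarrow> f analytic_on {0} \<and> f 0 = 0 \<and>
     (\<lambda>z. f z - (z + z ^ 2 + z ^ 3)) \<in> o[at 0](\<lambda>z. z ^ 3)"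

definition formally_conjugate :: "(complex \<Rightarrow> complex) \<Rightarrow> (complex \<Rightarrow> complex) \<Rightarrow> bool" where
  "formally_conjugate f f0 \<longleftrightarrow>
     (\<exists>\<Phi> :: complex fps. fps_nth \<Phi> 0 = 0 \<and> fps_nth \<Phi> 1 = 1 \<and>
        fps_compose \<Phi> (fps_expansion f 0) = fps_compose (fps_expansion f0 0) \<Phi>)"

definition inverse_germ :: "(complex \<Rightarrow> complex) \<Rightarrow> (complex \<Rightarrow> complex) \<Rightarrow> bool" where
  "inverse_germ f g \<longleftrightarrow> g analytic_on {0} \<and> g 0 = 0 \<and>
     (\<forall>\<^sub>F z in nhds 0. g (f z) = z \<and> f (g z) = z)"

text \<open>
  A petal of \<open>h\<close> bisected by the direction \<open>d\<close> (a unit complex number) whose boundary is tangent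
  at \<open>0\<close> to the direction \<open>-d\<close>: it contains, near \<open>0\<close>, every sector bisected by \<open>d\<close> of opening
  less than \<open>2\<pi>\<close>. It omits the closed ray in direction \<open>-d\<close>, which contains \<open>0\<close> and serves as
  the cut of the logarithm on the petal.
\<close>
definition petal :: "(complex \<Rightarrow> complex) \<Rightarrow> complex \<Rightarrow> complex set \<Rightarrow> bool" where
  "petal h d V \<longleftrightarrow> open V \<and> connected V \<and> h ` V \<subseteq> V \<and>
     (\<forall>z\<in>V. (\<lambda>n. (h ^^ n) z) \<longlonglongrightarrow> 0) \<and>
     (\<forall>\<alpha>. 0 < \<alpha> \<and> \<alpha> < pi \<longrightarrow>
        (\<exists>\<rho>>0. \<forall>z. 0 < norm z \<and> norm z < \<rho> \<and> \<bar>Arg (z / d)\<bar> < \<alpha> \<longrightarrow> z \<in> V)) \<and>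
     (\<forall>t\<ge>0. - complex_of_real t * d \<notin> V)"

text \<open>For \<open>f z = z + z^2 + \<dots>\<close> with inverse germ \<open>g\<close>.\<close>
definition attracting_petal :: "(complex \<Rightarrow> complex) \<Rightarrow> complex set \<Rightarrow> bool" where
  "attracting_petal f V \<longleftrightarrow> petal f (-1) V"

definition repelling_petal :: "(complex \<Rightarrow> complex) \<Rightarrow> complex set \<Rightarrow> bool" where
  "repelling_petal g V \<longleftrightarrow> petal g 1 V"

definition forward_orbit :: "(complex \<Rightarrow> complex) \<Rightarrow> complex \<Rightarrow> complex set" where
  "forward_orbit h z = range (\<lambda>n. (h ^^ n) z)"

definition eps_neighborhood :: "complex set \<Rightarrow> real \<Rightarrow> complex set" where
  "eps_neighborhood S \<epsilon> = (\<Union>x\<in>S. ball x \<epsilon>)"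

definition area :: "complex set \<Rightarrow> real" where
  "area A = measure lborel A"

definition center_of_mass :: "complex set \<Rightarrow> complex" where
  "center_of_mass A = (LINT w:A|lborel. w) / complex_of_real (area A)"

definition directed_area :: "(complex \<Rightarrow> complex) \<Rightarrow> complex \<Rightarrow> real \<Rightarrow> complex" where
  "directed_area h z \<epsilon> =
     (let N = eps_neighborhood (forward_orbit h z) \<epsilon>
      in complex_of_real (area N) * center_of_mass N)"

text \<open>
  \<open>H\<close> is the principal part of area for \<open>h\<close> on \<open>V\<close>. The expansion determines the values of \<open>H\<close>
  on \<open>V\<close>; \<open>q1\<close> and \<open>q2\<close> do not depend on the point, whereas the bound on the remainder may.
\<close>
definition principal_part ::
    "(complex \<Rightarrow> complex) \<Rightarrow> complex set \<Rightarrow> (complex \<Rightarrow> complex) \<Rightarrow> bool" where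
  "principal_part h V H \<longleftrightarrow> (\<exists>q1 q2 :: complex. \<forall>z\<in>V.
     (\<lambda>\<epsilon>. directed_area h z \<epsilon> -
        (q1 * of_real (\<epsilon> ^ 2 * ln \<epsilon>) + H z * of_real (\<epsilon> ^ 2) +
         q2 * of_real (\<epsilon> powr (5 / 2) * ln \<epsilon>)))
     \<in> O[at_right 0](\<lambda>\<epsilon>. of_real (\<epsilon> powr (5 / 2))))"

text \<open>The logarithm with argument in \<open>(0, 2\<pi>)\<close> off the nonnegative real axis.\<close>
definition Ln2pi :: "complex \<Rightarrow> complex" where
  "Ln2pi z = of_real (ln (norm z)) + \<i> * of_real (Arg2pi z)"

text \<open>
  The functions \<open>P\<close> on \<open>Vp\<close> and \<open>M\<close> on \<open>Vm\<close> glue, near \<open>0\<close>, to one analytic germ once their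
  common logarithmic term \<open>- \<pi> log z\<close> has been removed, with the branch of \<open>log\<close> belonging to each
  petal.
\<close>
definition glue_mod_log ::
    "complex set \<Rightarrow> (complex \<Rightarrow> complex) \<Rightarrow> complex set \<Rightarrow> (complex \<Rightarrow> complex) \<Rightarrow> bool" where
  "glue_mod_log Vp P Vm M \<longleftrightarrow> (\<exists>G. G analytic_on {0} \<and>
     (\<forall>\<^sub>F z in at 0 within Vp. P z + of_real pi * Ln2pi z = G z) \<and>
     (\<forall>\<^sub>F z in at 0 within Vm. M z + of_real pi * Ln z = G z))"

text \<open>The germ of \<open>f\<close> is \<open>\<phi>\<inverse>(e^z \<phi>(z))\<close> with \<open>\<phi>\<close> analytic and \<open>\<phi>(z) = z + O(z^2)\<close>.\<close>
definition exp_form :: "(complex \<Rightarrow> complex) \<Rightarrow> (complex \<Rightarrow> complex) \<Rightarrow> bool" where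
  "exp_form f \<phi> \<longleftrightarrow> \<phi> analytic_on {0} \<and> \<phi> 0 = 0 \<and> deriv \<phi> 0 = 1 \<and>
     (\<exists>\<psi>. inverse_germ \<phi> \<psi> \<and> (\<forall>\<^sub>F z in nhds 0. f z = \<psi> (exp z * \<phi> z)))"

end

theory Submission
  imports Defs
begin

text \<open>
  In the coordinate \<open>w = - 1 / z\<close> both \<open>f\<close> and the reflected inverse germ \<open>z \<mapsto> - g (- z)\<close> are
  \<open>w \<mapsto> w + 1 + O(1 / w\<^sup>2)\<close>. Hence an orbit is \<open>z\<^sub>n = - 1 / n + O(1 / n\<^sup>2)\<close>, and along \<open>\<epsilon> = 1 / (2 k\<^sup>2)\<close>
  the disc around \<open>z\<^sub>n\<close> adds to the earlier discs a full disc (\<open>n \<le> k\<close>) or the crescent that it leaves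
  outside its predecessor (\<open>n > k\<close>). Summing the moments gives \<open>H z = \<pi> c z - \<pi> / 4\<close> with
  \<open>c z = lim (z\<^sub>0 + \<dots> + z\<^sub>k + ln k)\<close>; the \<open>ln 2\<close> produced by the crescents, through \<open>\<integral>\<^sub>0\<^sup>1 arcsin u / u du\<close>,
  cancels the one in \<open>ln \<epsilon>\<close>. In particular \<open>H z - H (f z) = \<pi> z\<close>.

  If \<open>\<phi> (f z) = exp z * \<phi> z\<close>, the sum telescopes to \<open>c = \<i> \<pi> - log \<phi>\<close>. Conversely, if the principal parts
  glue to \<open>G\<close>, the last equation says that \<open>\<phi> z = z * exp (- (G z - G 0) / \<pi>)\<close> satisfies the functional
  equation. The radius \<open>r\<close> keeps orbits inside small balls from passing around \<open>0\<close>, so that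
  \<open>z\<close> and \<open>\<phi> z\<close> lie on the same side of the cut of the logarithm.
\<close>

section \<open>The integral of x cot x\<close>

text \<open>The expansion holds for all small radii, so one sequence of radii is enough to read off
  H. The radius \<open>1 / (2 * k^2)\<close> makes the diameter of a disc 1/k^2, the distance of
  consecutive model points near index k, so in the model the discs begin to overlap at the integer
  k. After division by the squared radius the crescents contribute minus a Riemann sum for half the
  integral over (0,1) of h u / u, where h u = 2 arcsin u + 2 u sqrt (1 - u^2) is the area of a unit
  crescent with centres 2 u apart. Its arcsine part gives pi/2 ln 2; its square root is the area of
  a quarter disc, which is the origin of the constant -pi/4. The obstacle is that a late disc meets
  many earlier discs, not only its predecessor. What it shares with any of them must lie in the disc
  of the predecessor, uniformly in both indices; this needs an angular estimate proportional to the
  distance of the centres, not just a small angle. The remaining errors are O(1/n^2) uniformly in k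
  and vanish by dominated summation.\<close>

definition xcot :: "real \<Rightarrow> real" where
  "xcot t = (if t = 0 then 1 else t * cot t)"

lemma continuous_on_xcot: "continuous_on {0..pi/2} xcot"
proof (rule continuous_on_eq_continuous_within[THEN iffD2], rule ballI)
  fix x :: real assume x: "x \<in> {0..pi/2}"
  show "continuous (at x within {0..pi/2}) xcot"
  proof (cases "x = 0")
    case True
    have "((\<lambda>t::real. sin t / t) \<longlongrightarrow> 1) (at 0)"
      using DERIV_sin[of "0::real"] by (simp add: has_field_derivative_iff)
    moreover have "((\<lambda>t::real. cos t) \<longlongrightarrow> 1) (at 0)"
      using isCont_cos[of "0::real"] by (simp add: isCont_def)
    ultimately have "((\<lambda>t::real. cos t / (sin t / t)) \<longlongrightarrow> 1 / 1) (at 0)"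
      by (intro tendsto_divide) auto
    moreover have "\<forall>\<^sub>F t in at 0. cos t / (sin t / t) = xcot t"
      by (auto simp: eventually_at_filter xcot_def cot_def)
    ultimately have "(xcot \<longlongrightarrow> 1) (at 0)"
      using Lim_transform_eventually by fastforce
    then have "isCont xcot 0" by (simp add: isCont_def xcot_def)
    with True show ?thesis using continuous_at_imp_continuous_at_within by blast
  next
    case False
    with x have "sin x \<noteq> 0" using sin_gt_zero[of x] pi_gt_zero by force
    then have "isCont (\<lambda>t. t * cot t) x" by (intro continuous_intros) auto
    moreover have "\<forall>\<^sub>F t in nhds x. t * cot t = xcot t"
      using False by (auto simp: xcot_def eventually_nhds intro!: exI[of _ "-{0}"])
    ultimately have "isCont xcot x" by (simp add: isCont_cong)
    then show ?thesis using continuous_at_imp_continuous_at_within by blast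
  qed
qed

text \<open>Under u = sin t the integral of arcsin u / u from 0 to v becomes the integral of t cot t
  from 0 to arcsin v; in this form the arcsine part of the crescent area is integrated.\<close>

definition xcot_int :: "real \<Rightarrow> real" where
  "xcot_int \<theta> = integral {0..\<theta>} xcot"

lemma xcot_int_0 [simp]: "xcot_int 0 = 0"
  by (simp add: xcot_int_def)

lemma continuous_on_xcot_int: "continuous_on {0..pi/2} xcot_int"
  unfolding xcot_int_def
  by (rule indefinite_integral_continuous_1) (auto intro: integrable_continuous_real continuous_on_xcot)

lemma has_real_derivative_xcot_int:
  assumes "0 < x" "x < pi/2"
  shows "(xcot_int has_real_derivative x * cot x) (at x)"
proof -
  have "(xcot_int has_real_derivative xcot x) (at x within {0..pi/2})"
    unfolding xcot_int_def by (rule integral_has_real_derivative) (use assms continuous_on_xcot in auto)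
  then show ?thesis using assms
    by (simp add: xcot_def at_within_Icc_at)
qed

lemma cot_double_half:
  assumes "sin x \<noteq> 0" "cos x \<noteq> (0::real)"
  shows "2 * cot (2 * x) = cot x - tan x"
  unfolding cot_def tan_def sin_double cos_double using assms
  by (simp add: divide_simps) (simp add: algebra_simps power2_eq_square)

text \<open>Euler's trick: the duplication formula gives a functional equation for the integral.\<close>
lemma xcot_int_pi_half: "xcot_int (pi/2) = pi / 2 * ln 2"
proof -
  define F where "F x = xcot_int (2*x) - 2 * xcot_int x + 2 * xcot_int (pi/2 - x) - pi * ln (cos x)" for x
  have "continuous_on {0..pi/4} F"
  proof -
    have c: "cos x \<noteq> 0" if "x \<in> {0..pi/4}" for x
      proof -
      have "- (pi/2) < x" "x < pi/2" using that pi_gt_zero unfolding atLeastAtMost_iff by linarith+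
      then show ?thesis using cos_gt_zero_pi[of x] by simp
    qed
    show ?thesis unfolding F_def
      by (intro continuous_intros continuous_on_compose2[OF continuous_on_xcot_int]) (use c in auto)
  qed
  moreover have "(F has_real_derivative 0) (at x)" if x: "0 < x" "x < pi/4" for x
  proof -
    have c: "cos x > 0" using x by (intro cos_gt_zero_pi) auto
    have s: "sin x > 0" using x by (intro sin_gt_zero) auto
    have d1: "((\<lambda>x. xcot_int (2 * x)) has_real_derivative (2*x) * cot (2*x) * 2) (at x)"
      by (rule DERIV_chain2[of xcot_int "(2*x) * cot (2*x)"])
        (use x in \<open>auto intro!: derivative_eq_intros has_real_derivative_xcot_int\<close>)
    have d2: "((\<lambda>x. xcot_int (pi/2 - x)) has_real_derivative ((pi/2 - x) * cot (pi/2-x)) * (-1)) (at x)"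
      by (rule DERIV_chain2[of xcot_int "(pi/2 - x) * cot (pi/2-x)"])
        (use x in \<open>auto intro!: derivative_eq_intros has_real_derivative_xcot_int\<close>)
    have d3: "(xcot_int has_real_derivative x * cot x) (at x)"
      using x by (intro has_real_derivative_xcot_int) auto
    have "(F has_real_derivative
        (2*x) * cot (2*x) * 2 - 2 * (x * cot x) + 2 * (((pi/2 - x) * cot (pi/2-x)) * (-1)) - pi * (-sin x / cos x)) (at x)"
      unfolding F_def using c d1 d2 d3
      by (auto intro!: derivative_eq_intros)
    moreover have "cot (pi/2 - x) = tan x"
      by (simp add: cot_def tan_def sin_diff cos_diff)
    moreover have "2 * cot (2*x) = cot x - tan x"
      using cot_double_half c s by simp
    then have "(2*x) * cot (2*x) * 2 = 2 * x * (cot x - tan x)" by (metis mult.assoc mult.commute)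
    ultimately show ?thesis by (simp add: tan_def algebra_simps)
  qed
  \<comment> \<open>At pi/4 the two terms with \<open>xcot_int (pi/4)\<close> cancel and leave
    \<open>xcot_int (pi/2) + pi/2 * ln 2\<close>; at 0 only \<open>2 * xcot_int (pi/2)\<close>
    survives.\<close>
  ultimately have "F (pi/4) = F 0"
    by (intro DERIV_isconst2[of 0 "pi/4" F "pi/4"]) auto
  moreover have "ln (cos (pi/4)) = - (ln 2) / 2"
    by (simp add: cos_45 ln_div ln_sqrt)
  ultimately show ?thesis by (simp add: F_def algebra_simps)
qed

section \<open>Crescents\<close>

lemma measurable_Complex:
  "(\<lambda>(x, y). Complex x y) \<in> borel_measurable (lborel \<Otimes>\<^sub>M lborel)"
proof -
  have "(\<lambda>p. Complex (fst p) (snd p)) \<in> borel_measurable borel"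
    unfolding Complex_eq by (intro borel_measurable_continuous_onI continuous_intros)
  then show ?thesis by (simp add: lborel_prod split_def)
qed

text \<open>Boxes determine Lebesgue measure, and \<open>Complex\<close> pulls a box back to a box
  with the same sides. This carries Fubini over from pairs of reals to complex numbers.\<close>

lemma lborel_complex_eq_distr:
  "(lborel :: complex measure) = distr (lborel \<Otimes>\<^sub>M lborel) borel (\<lambda>(x, y). Complex x y)"
proof (rule lborel_eqI)
  fix l u :: complex
  assume le: "\<And>b. b \<in> Basis \<Longrightarrow> l \<bullet> b \<le> u \<bullet> b"
  have meas: "(\<lambda>(x, y). Complex x y) \<in> borel_measurable (lborel \<Otimes>\<^sub>M lborel)"
    by (rule measurable_Complex)
  have "(\<lambda>(x, y). Complex x y) -` box l u \<inter> space (lborel \<Otimes>\<^sub>M lborel) =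
      box (Re l, Im l) (Re u, Im u)"
    by (auto simp: box_def space_pair_measure Basis_complex_def Basis_prod_def)
  then have "emeasure (distr (lborel \<Otimes>\<^sub>M lborel) borel (\<lambda>(x, y). Complex x y)) (box l u) =
      emeasure lborel (box (Re l, Im l) (Re u, Im u))"
    using meas by (subst emeasure_distr) (auto simp: lborel_prod)
  also have "\<dots> = ennreal (\<Prod>b\<in>Basis. ((Re u, Im u) - (Re l, Im l)) \<bullet> b)"
    using le[of 1] le[of \<i>]
    by (subst emeasure_lborel_box) (auto simp: Basis_complex_def Basis_prod_def)
  also have "(\<Prod>b\<in>Basis. ((Re u, Im u) - (Re l, Im l)) \<bullet> b) = (\<Prod>b\<in>Basis. (u - l) \<bullet> b)"
    by (subst prod.union_disjoint | simp add: Basis_complex_def Basis_prod_def | force)+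
  finally show "emeasure (distr (lborel \<Otimes>\<^sub>M lborel) borel (\<lambda>(x, y). Complex x y)) (box l u) =
      (\<Prod>b\<in>Basis. (u - l) \<bullet> b)" .
qed simp

lemma emeasure_lborel_complex_slices:
  assumes "S \<in> sets borel"
  shows "emeasure lborel S = (\<integral>\<^sup>+ y. emeasure lborel {x. Complex x y \<in> S} \<partial>lborel)"
proof -
  have meas: "(\<lambda>(x, y). Complex x y) \<in> borel_measurable (lborel \<Otimes>\<^sub>M lborel)"
    by (rule measurable_Complex)
  have "emeasure lborel S = emeasure (lborel \<Otimes>\<^sub>M lborel)
      ((\<lambda>(x, y). Complex x y) -` S \<inter> space (lborel \<Otimes>\<^sub>M lborel))"
    by (subst lborel_complex_eq_distr, subst emeasure_distr) (use meas assms in auto)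
  also have "\<dots> = (\<integral>\<^sup>+ y. emeasure lborel
      ((\<lambda>x. (x, y)) -` ((\<lambda>(x, y). Complex x y) -` S \<inter> space (lborel \<Otimes>\<^sub>M lborel))) \<partial>lborel)"
    by (rule lborel_pair.emeasure_pair_measure_alt2) (use meas assms in measurable)
  also have "\<dots> = (\<integral>\<^sup>+ y. emeasure lborel {x. Complex x y \<in> S} \<partial>lborel)"
    by (simp add: space_pair_measure vimage_def)
  finally show ?thesis .
qed

text \<open>\<open>v\<close> is the centre of the earlier disc relative to the new one. Along an
  orbit it is \<open>z n - z (Suc n)\<close>, close to a negative real number.\<close>

definition crescent :: "real \<Rightarrow> complex \<Rightarrow> real" where
  "crescent \<epsilon> v = measure lborel (ball 0 \<epsilon> - ball v \<epsilon>)"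

text \<open>The area of a unit disc minus the lens that it shares with a unit disc whose centre is 2
  u away: pi - (2 arccos u - 2 u sqrt (1 - u^2)), rewritten with arcsin.\<close>

definition chord_height :: "real \<Rightarrow> real" where
  "chord_height u = 2 * arcsin u + 2 * u * sqrt (1 - u ^ 2)"

lemma DERIV_half_disc:
  assumes "0 < \<epsilon>" "\<bar>y\<bar> < \<epsilon>"
  shows "((\<lambda>y. y * sqrt (\<epsilon>^2 - y^2) + \<epsilon>^2 * arcsin (y / \<epsilon>)) has_real_derivative 2 * sqrt (\<epsilon>^2 - y^2)) (at y)"
proof -
  have pos: "\<epsilon>^2 - y^2 > 0"
    using assms power_strict_mono[of "\<bar>y\<bar>" \<epsilon> 2] by simp
  have "sqrt (1 - (y/\<epsilon>)^2) = sqrt ((\<epsilon>^2 - y^2) / \<epsilon>^2)" using assms by (simp add: field_simps)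
  also have "\<dots> = sqrt (\<epsilon>^2 - y^2) / \<epsilon>" using assms by (simp add: real_sqrt_divide)
  finally have s: "sqrt (1 - (y/\<epsilon>)^2) = sqrt (\<epsilon>^2 - y^2) / \<epsilon>" .
  have r: "-1 < y/\<epsilon>" "y/\<epsilon> < 1" using assms by (auto simp: field_simps)
  have "((\<lambda>y. y * sqrt (\<epsilon>^2 - y^2) + \<epsilon>^2 * arcsin (y / \<epsilon>)) has_real_derivative
      (sqrt (\<epsilon>^2 - y^2) + y * (inverse (sqrt (\<epsilon>^2 - y^2)) / 2 * (- 2 * y)) + \<epsilon>^2 * (inverse (sqrt (1 - (y/\<epsilon>)^2)) * (1 / \<epsilon>)))) (at y)"
    using assms pos r
    by (auto intro!: derivative_eq_intros DERIV_chain2[OF DERIV_arcsin] DERIV_real_sqrt)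
  also have "(sqrt (\<epsilon>^2 - y^2) + y * (inverse (sqrt (\<epsilon>^2 - y^2)) / 2 * (- 2 * y)) + \<epsilon>^2 * (inverse (sqrt (1 - (y/\<epsilon>)^2)) * (1 / \<epsilon>)))
     = 2 * sqrt (\<epsilon>^2 - y^2)"
    unfolding s using pos assms by (simp add: divide_simps) (simp add: algebra_simps power2_eq_square)
  finally show ?thesis .
qed

text \<open>The integrand is the length of the slice at height y of a crescent whose two centres
  differ by the horizontal shift d.\<close>

lemma has_integral_chord:
  assumes e: "0 < \<epsilon>" and d: "0 < d" "d \<le> 2 * \<epsilon>"
  shows "((\<lambda>y. min (2 * sqrt (\<epsilon>^2 - y^2)) d) has_integral (\<epsilon>^2 * chord_height (d / (2*\<epsilon>)))) {-\<epsilon>..\<epsilon>}"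
proof -
  \<comment> \<open>At height Y the chord has length exactly d. Up to this height the minimum is d;
    beyond it the minimum is the chord itself, with primitive \<open>A\<close>.\<close>
  define Y where "Y = sqrt (\<epsilon>^2 - (d/2)^2)"
  define A where "A y = y * sqrt (\<epsilon>^2 - y^2) + \<epsilon>^2 * arcsin (y / \<epsilon>)" for y
  have d2: "(d/2)^2 \<le> \<epsilon>^2" using d e by (intro power_mono) auto
  have Y0: "0 \<le> Y" "Y \<le> \<epsilon>" "Y < \<epsilon>" and Y2: "Y^2 = \<epsilon>^2 - (d/2)^2"
    using d2 e d by (auto simp: Y_def intro!: real_le_lsqrt real_less_lsqrt)
  have contA: "continuous_on {-\<epsilon>..\<epsilon>} A" unfolding A_def
    using e by (intro continuous_intros) (auto simp: field_simps)
  have mid: "((\<lambda>y. min (2 * sqrt (\<epsilon>^2 - y^2)) d) has_integral (d * (Y - (-Y)))) {-Y..Y}"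
  proof (rule has_integral_eq[of _ "\<lambda>y. d"])
    fix y assume "y \<in> {-Y..Y}"
    then have "y^2 \<le> Y^2" by (simp add: abs_le_square_iff[symmetric]) (use Y0 in auto)
    then have "(d/2)^2 \<le> \<epsilon>^2 - y^2" using Y2 by simp
    then have "d/2 \<le> sqrt (\<epsilon>^2 - y^2)" using d by (intro real_le_rsqrt) auto
    then show "d = min (2 * sqrt (\<epsilon>^2 - y^2)) d" by simp
  qed (use has_integral_const_real[of d "-Y" Y] Y0 in \<open>simp add: mult.commute\<close>)
  have outer: "((\<lambda>y. min (2 * sqrt (\<epsilon>^2 - y^2)) d) has_integral (A b - A a)) {a..b}"
    if ab: "a \<le> b" "-\<epsilon> \<le> a" "b \<le> \<epsilon>" "Y \<le> a \<or> b \<le> -Y" for a b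
  proof (rule has_integral_eq[of _ "\<lambda>y. 2 * sqrt (\<epsilon>^2 - y^2)"])
    fix y assume y: "y \<in> {a..b}"
    with ab Y0 have "\<bar>Y\<bar> \<le> \<bar>y\<bar>" by auto
    then have "Y^2 \<le> y^2" by (simp add: abs_le_square_iff)
    then have "\<epsilon>^2 - y^2 \<le> (d/2)^2" using Y2 by simp
    then have "sqrt (\<epsilon>^2 - y^2) \<le> d/2" using d by (intro real_le_lsqrt) auto
    then show "2 * sqrt (\<epsilon>^2 - y^2) = min (2 * sqrt (\<epsilon>^2 - y^2)) d" by simp
  next
    show "((\<lambda>y. 2 * sqrt (\<epsilon>^2 - y^2)) has_integral (A b - A a)) {a..b}"
      using ab e unfolding A_def
      by (intro fundamental_theorem_of_calculus_interior continuous_on_subset[OF contA[unfolded A_def]])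
        (auto intro!: DERIV_half_disc simp flip: has_real_derivative_iff_has_vector_derivative)
  qed
  have "((\<lambda>y. min (2 * sqrt (\<epsilon>^2 - y^2)) d) has_integral
      (A (-Y) - A (-\<epsilon>) + d * (Y - (-Y)) + (A \<epsilon> - A Y))) {-\<epsilon>..\<epsilon>}"
    using Y0 e
    by (intro has_integral_combine[of "-\<epsilon>" Y \<epsilon>] has_integral_combine[of "-\<epsilon>" "-Y" Y] mid outer) auto
  moreover have "A (-Y) - A (-\<epsilon>) + d * (Y - (-Y)) + (A \<epsilon> - A Y) = \<epsilon>^2 * chord_height (d / (2*\<epsilon>))"
  proof -
    define u where "u = d / (2*\<epsilon>)"
    have u: "0 < u" "u \<le> 1" "d = 2 * \<epsilon> * u" using e d by (auto simp: u_def field_simps)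
    have "Y = sqrt (\<epsilon>^2 * (1 - u^2))" unfolding Y_def u(3) by (simp add: algebra_simps power2_eq_square)
    then have Yu: "Y = \<epsilon> * sqrt (1 - u^2)" using e by (simp add: real_sqrt_mult)
    have "arcsin (sqrt (1 - u^2)) = pi/2 - arcsin u"
    proof -
      have "sqrt (1 - u^2) = cos (arcsin u)" using u by (simp add: cos_arcsin)
      also have "\<dots> = sin (pi/2 - arcsin u)" by (simp add: sin_diff)
      finally show ?thesis using u arcsin_bounded[of u] arcsin_le_arcsin[of 0 u]
        by (simp add: arcsin_sin)
    qed
    then have as: "arcsin (Y / \<epsilon>) = pi/2 - arcsin u" using e by (simp add: Yu)
    have sY: "sqrt (\<epsilon>^2 - Y^2) = \<epsilon> * u"
      unfolding Y2 using u e by (simp add: power_mult_distrib real_sqrt_mult)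
    have AY: "A Y = Y * (\<epsilon> * u) + \<epsilon>^2 * (pi/2 - arcsin u)"
      unfolding A_def sY as ..
    have "Y / \<epsilon> \<le> 1" "- 1 \<le> Y / \<epsilon>" using Y0 e by (auto simp: field_simps)
    then have "A (-Y) = - A Y" by (simp add: A_def arcsin_minus)
    moreover have "A \<epsilon> = \<epsilon>^2 * (pi/2)" "A (-\<epsilon>) = - (\<epsilon>^2 * (pi/2))"
      using e by (auto simp: A_def)
    ultimately have "A (-Y) - A (-\<epsilon>) + d * (Y - (-Y)) + (A \<epsilon> - A Y) = \<epsilon>^2 * pi + 2 * d * Y - 2 * A Y"
      by simp
    also have "\<dots> = \<epsilon>^2 * chord_height u"
      unfolding AY unfolding chord_height_def Yu u(3) by (simp add: algebra_simps power2_eq_square)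
    finally show ?thesis unfolding u_def .
  qed
  ultimately show ?thesis by simp
qed


text \<open>The shift moves every chord along itself, so what is left of a chord is a piece of
  length d at one end, or the whole chord if that is shorter.\<close>

lemma slice_crescent:
  assumes e: "0 < \<epsilon>" and d: "0 < d"
  shows "emeasure lborel {x. Complex x y \<in> ball 0 \<epsilon> - ball (of_real (-d)) \<epsilon>} =
    ennreal (min (2 * sqrt (\<epsilon>^2 - y^2)) d) * indicator {-\<epsilon>..\<epsilon>} y"
proof (cases "\<bar>y\<bar> < \<epsilon>")
  case False
  have "\<epsilon> \<le> norm (Complex x y)" for x
    using False abs_Im_le_cmod[of "Complex x y"] by simp
  then have "{x. Complex x y \<in> ball 0 \<epsilon> - ball (of_real (-d)) \<epsilon>} = {}"
    by (auto simp: not_less dist_norm)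
  moreover have "ennreal (min (2 * sqrt (\<epsilon>^2 - y^2)) d) * indicator {-\<epsilon>..\<epsilon>} y = 0"
  proof (cases "\<bar>y\<bar> = \<epsilon>")
    case True
    then have "y^2 = \<epsilon>^2" by auto
    then show ?thesis using d by simp
  next
    case False
    with \<open>\<not> \<bar>y\<bar> < \<epsilon>\<close> show ?thesis by (auto simp: indicator_def)
  qed
  ultimately show ?thesis by (simp only: emeasure_empty)
next
  case True
  define s where "s = sqrt (\<epsilon>^2 - y^2)"
  have pos: "\<epsilon>^2 - y^2 > 0"
    using True power_strict_mono[of "\<bar>y\<bar>" \<epsilon> 2] by simp
  have s: "s > 0" "s^2 = \<epsilon>^2 - y^2" using pos by (auto simp: s_def)
  have norm_iff: "norm (Complex x y) < \<epsilon> \<longleftrightarrow> \<bar>x\<bar> < s" for x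
  proof -
    have "norm (Complex x y) < \<epsilon> \<longleftrightarrow> x^2 + y^2 < \<epsilon>^2"
      using e real_sqrt_less_iff[of "x^2+y^2" "\<epsilon>^2"] by (simp add: cmod_def del: real_sqrt_less_iff)
    also have "\<dots> \<longleftrightarrow> \<bar>x\<bar>^2 < s^2" using s by auto
    also have "\<dots> \<longleftrightarrow> \<bar>x\<bar> < s" using s(1)
      by (metis abs_ge_zero less_eq_real_def power2_less_imp_less power_strict_mono zero_less_numeral)
    finally show ?thesis .
  qed
  have "Complex x y \<in> ball 0 \<epsilon> - ball (of_real (-d)) \<epsilon> \<longleftrightarrow> \<bar>x\<bar> < s \<and> \<not> \<bar>x + d\<bar> < s" for x
  proof -
    have "of_real (-d) - Complex x y = - Complex (x + d) y" by (simp add: complex_eq_iff)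
    then have "dist (of_real (-d)) (Complex x y) = norm (Complex (x + d) y)"
      unfolding dist_norm by (simp only: norm_minus_cancel)
    then show ?thesis using norm_iff[of x] norm_iff[of "x+d"] by (auto simp: dist_norm)
  qed
  then have "{x. Complex x y \<in> ball 0 \<epsilon> - ball (of_real (-d)) \<epsilon>} = {x. \<bar>x\<bar> < s \<and> \<not> \<bar>x + d\<bar> < s}"
    by (simp only:)
  also have "\<dots> = (if d < 2 * s then {s - d..<s} else {-s<..<s})"
    using d s(1) by (auto simp: abs_if split: if_splits)
  also have "emeasure lborel \<dots> = ennreal (min (2 * s) d)"
    using d s(1) by auto
  finally show ?thesis
    using True by (simp only: s_def) (simp add: indicator_def abs_less_iff del: mem_ball Diff_iff)
qed

lemma crescent_real:
  assumes e: "0 < \<epsilon>" and d: "0 < d" "d \<le> 2 * \<epsilon>"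
  shows "crescent \<epsilon> (of_real (-d)) = \<epsilon>^2 * chord_height (d / (2*\<epsilon>))"
proof -
  have nonneg: "0 \<le> min (2 * sqrt (\<epsilon>^2 - y^2)) d" if "y \<in> {-\<epsilon>..\<epsilon>}" for y
  proof -
    have "\<bar>y\<bar> \<le> \<bar>\<epsilon>\<bar>" using that by auto
    then have "y^2 \<le> \<epsilon>^2" by (simp add: abs_le_square_iff)
    then show ?thesis using d by simp
  qed
  have I: "((\<lambda>y. min (2 * sqrt (\<epsilon>^2 - y^2)) d) has_integral (\<epsilon>^2 * chord_height (d / (2*\<epsilon>)))) {-\<epsilon>..\<epsilon>}"
    using has_integral_chord e d by blast
  have "emeasure lborel (ball 0 \<epsilon> - ball (complex_of_real (-d)) \<epsilon>) =
      (\<integral>\<^sup>+ y. ennreal (min (2 * sqrt (\<epsilon>^2 - y^2)) d) * indicator {-\<epsilon>..\<epsilon>} y \<partial>lborel)"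
    by (subst emeasure_lborel_complex_slices) (use slice_crescent[OF e d(1)] in auto)
  also have "\<dots> = ennreal (\<epsilon>^2 * chord_height (d / (2*\<epsilon>)))"
    by (rule nn_integral_has_integral_lebesgue'[OF nonneg I])
  finally show ?thesis unfolding crescent_def measure_def
    using has_integral_nonneg[OF I nonneg] by simp
qed

section \<open>Bounds for crescents\<close>

lemma measure_complex_ball: "0 \<le> r \<Longrightarrow> measure lborel (ball (c::complex) r) = pi * r^2"
  by (simp add: content_ball unit_ball_vol_2)

lemma fmeasurable_lborel_ball [simp]: "ball a r \<in> fmeasurable lborel"
  using emeasure_lborel_ball_finite by (auto intro!: fmeasurableI)

lemma fmeasurable_ball_diff [simp]: "ball (a::complex) r - ball b s \<in> fmeasurable lborel"
  by (intro fmeasurable_Diff) auto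

lemma crescent_translate:
  "measure lborel (ball a \<epsilon> - ball b \<epsilon>) = crescent \<epsilon> (b - a)"
proof -
  have *: "(+) a ` (ball 0 \<epsilon> - ball (b - a) \<epsilon>) = ball a \<epsilon> - ball b \<epsilon>"
    by (simp only: translation_diff ball_translation[symmetric]) simp
  have "measure lebesgue (ball a \<epsilon> - ball b \<epsilon>) = measure lebesgue (ball 0 \<epsilon> - ball (b - a) \<epsilon>)"
    by (rule measure_translation[of a "ball 0 \<epsilon> - ball (b - a) \<epsilon>", unfolded *])
  moreover have "measure lebesgue (ball c \<epsilon> - ball d \<epsilon>) = measure lborel (ball c \<epsilon> - ball d \<epsilon>)" for c d :: complex
    by (rule measure_completion) simp
  ultimately show ?thesis unfolding crescent_def by (simp only:)
qed

lemma crescent_far: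
  assumes "0 \<le> \<epsilon>" "2 * \<epsilon> \<le> norm v"
  shows "crescent \<epsilon> v = pi * \<epsilon>^2"
proof -
  have "ball 0 \<epsilon> - ball v \<epsilon> = ball 0 \<epsilon>"
    using disjoint_ballI[of \<epsilon> \<epsilon> 0 v] assms by (auto simp: dist_norm)
  then show ?thesis by (simp add: crescent_def measure_complex_ball assms)
qed

text \<open>For small \<open>v\<close> the crescent lies in the annulus around \<open>v\<close>
  between the radii \<open>\<epsilon>\<close> and \<open>\<epsilon> + norm v\<close>, of area pi (2
  \<epsilon> + |v|) |v|; with |v| \<le> \<epsilon> this gives the factor 3. For larger
  \<open>v\<close> the area of the whole disc is already small enough.\<close>

lemma crescent_le:
  assumes e: "0 < \<epsilon>"
  shows "crescent \<epsilon> v \<le> 3 * pi * \<epsilon> * norm v" "crescent \<epsilon> v \<le> pi * \<epsilon>^2"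
proof -
  show 1: "crescent \<epsilon> v \<le> pi * \<epsilon>^2"
  proof -
    have "crescent \<epsilon> v \<le> measure lborel (ball (0::complex) \<epsilon>)"
      unfolding crescent_def by (rule measure_mono_fmeasurable) (rule Diff_subset, simp, simp)
    then show ?thesis using e by (simp add: measure_complex_ball)
  qed
  show "crescent \<epsilon> v \<le> 3 * pi * \<epsilon> * norm v"
  proof (cases "norm v \<le> \<epsilon>")
    case True
    have "crescent \<epsilon> v \<le> measure lborel (ball v (\<epsilon> + norm v) - ball v \<epsilon>)"
      unfolding crescent_def
    proof (intro measure_mono_fmeasurable)
      show "ball 0 \<epsilon> - ball v \<epsilon> \<subseteq> ball v (\<epsilon> + norm v) - ball v \<epsilon>"
      proof
        fix x assume x: "x \<in> ball 0 \<epsilon> - ball v \<epsilon>"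
        have "dist v x \<le> norm x + norm v" using norm_triangle_ineq4[of v x] by (simp add: dist_norm)
        with x show "x \<in> ball v (\<epsilon> + norm v) - ball v \<epsilon>" by (simp add: dist_norm)
      qed
    qed auto
    also have "\<dots> = pi * (\<epsilon> + norm v)^2 - pi * \<epsilon>^2"
    proof (subst measure_Diff)
      show "emeasure lborel (ball v (\<epsilon> + norm v)) \<noteq> \<infinity>"
        using emeasure_lborel_ball_finite[of v "\<epsilon> + norm v"] by simp
      show "ball v \<epsilon> \<subseteq> ball v (\<epsilon> + norm v)" by (rule subset_ball) simp
    qed (use e in \<open>auto simp: measure_complex_ball\<close>)
    also have "\<dots> = pi * (2 * \<epsilon> + norm v) * norm v" by (simp add: algebra_simps power2_eq_square)
    also have "\<dots> \<le> pi * (3 * \<epsilon>) * norm v" using True e by (intro mult_right_mono mult_left_mono) simp_all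
    finally show ?thesis by (simp add: mult_ac)
  next
    case False
    note 1
    also have "pi * \<epsilon>^2 \<le> pi * (\<epsilon> * norm v)"
      using False e by (simp add: power2_eq_square)
    also have "\<dots> \<le> 3 * pi * \<epsilon> * norm v" using e by (simp add: mult_ac)
    finally show ?thesis .
  qed
qed

lemma crescent_nonneg: "0 \<le> crescent \<epsilon> v" by (simp add: crescent_def)

text \<open>What A has outside B is covered by what A has outside B' and what B' has outside B; the
  latter is a crescent for \<open>v - v'\<close>. This Lipschitz bound allows the true step of an
  orbit to be replaced by -1/n^2.\<close>

lemma crescent_diff_le:
  assumes e: "0 < \<epsilon>"
  shows "\<bar>crescent \<epsilon> v - crescent \<epsilon> v'\<bar> \<le> 3 * pi * \<epsilon> * norm (v - v')"
proof -
  have le: "crescent \<epsilon> v \<le> crescent \<epsilon> v' + 3 * pi * \<epsilon> * norm (v - v')" for v v'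
  proof -
    have "crescent \<epsilon> v \<le> measure lborel ((ball 0 \<epsilon> - ball v' \<epsilon>) \<union> (ball v' \<epsilon> - ball v \<epsilon>))"
      unfolding crescent_def by (intro measure_mono_fmeasurable) (auto intro: fmeasurable.Un)
    also have "\<dots> \<le> crescent \<epsilon> v' + measure lborel (ball v' \<epsilon> - ball v \<epsilon>)"
      unfolding crescent_def by (intro measure_Un_le) auto
    also have "measure lborel (ball v' \<epsilon> - ball v \<epsilon>) \<le> 3 * pi * \<epsilon> * norm (v - v')"
      unfolding crescent_translate by (rule crescent_le[OF e])
    finally show ?thesis by simp
  qed
  show ?thesis using le[of v v'] le[of v' v] by (simp add: norm_minus_commute abs_le_iff)
qed

section \<open>The Riemann sum of the crescents\<close>

lemma chord_height_mono:
  assumes "0 < u" "u \<le> v" "v \<le> 1"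
  shows "chord_height u \<le> chord_height v"
proof -
  \<comment> \<open>The slice formula for radius 1 shows monotonicity under the integral sign,
    without differentiating \<open>chord_height\<close>.\<close>
  have "((\<lambda>y. min (2 * sqrt (1 - y^2)) (2 * w)) has_integral chord_height w) {-1..1}"
    if "0 < w" "w \<le> 1" for w
    using has_integral_chord[of 1 "2 * w"] that by simp
  from this[of u] this[of v] show ?thesis
    by (rule has_integral_le) (use assms in auto)
qed

lemma chord_height_nonneg:
  assumes "0 \<le> u" "u \<le> 1"
  shows "0 \<le> chord_height u"
proof -
  have "0 \<le> arcsin u" using assms arcsin_le_arcsin[of 0 u] by simp
  moreover have "u^2 \<le> 1" using assms by (rule power_le_one)
  then have "0 \<le> 2 * u * sqrt (1 - u^2)" using assms by (intro mult_nonneg_nonneg) simp_all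
  ultimately show ?thesis unfolding chord_height_def by (intro add_nonneg_nonneg) simp_all
qed

text \<open>A primitive of \<open>chord_height u / (2 * u)\<close>, that is, of arcsin u / u + sqrt
  (1 - u^2). The first summand is integrated by u = sin t, the second is the area under a circular
  arc.\<close>

definition tail_primitive :: "real \<Rightarrow> real" where
  "tail_primitive u = xcot_int (arcsin u) + (arcsin u + u * sqrt (1 - u^2)) / 2"

lemma tail_primitive_0 [simp]: "tail_primitive 0 = 0"
  by (simp add: tail_primitive_def)

lemma tail_primitive_1: "tail_primitive 1 = pi / 2 * ln 2 + pi / 4"
  by (simp add: tail_primitive_def xcot_int_pi_half)

lemma continuous_on_tail_primitive: "continuous_on {0..1} tail_primitive"
proof -
  have "arcsin u \<in> {0..pi/2}" if "u \<in> {0..1}" for u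
    using that arcsin_bounded[of u] arcsin_le_arcsin[of 0 u] by auto
  then show ?thesis unfolding tail_primitive_def
    by (intro continuous_intros continuous_on_compose2[OF continuous_on_xcot_int]) auto
qed

lemma has_real_derivative_tail_primitive:
  assumes "0 < u" "u < 1"
  shows "(tail_primitive has_real_derivative chord_height u / (2 * u)) (at u)"
proof -
  define s where "s = sqrt (1 - u^2)"
  have u2: "1 - u^2 > 0" using assms power_strict_mono[of u 1 2] by simp
  then have s: "s > 0" "s * s = 1 - u^2" by (auto simp: s_def)
  have as: "0 < arcsin u" "arcsin u < pi/2"
    using assms arcsin_less_arcsin[of 0 u] arcsin_lt_bounded[of u] by auto
  have d1: "((\<lambda>u. xcot_int (arcsin u)) has_real_derivative (arcsin u * cot (arcsin u)) * inverse s) (at u)"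
    unfolding s_def using assms as
    by (intro DERIV_chain2[of xcot_int] has_real_derivative_xcot_int DERIV_arcsin) auto
  have d2: "(arcsin has_real_derivative inverse s) (at u)"
    unfolding s_def using assms by (intro DERIV_arcsin) auto
  have d3: "((\<lambda>u. sqrt (1 - u^2)) has_real_derivative (inverse s / 2 * (- 2 * u))) (at u)"
    unfolding s_def using u2 by (auto intro!: derivative_eq_intros DERIV_real_sqrt)
  have "cot (arcsin u) = s / u" using assms by (simp add: cot_def cos_arcsin s_def)
  then have "(tail_primitive has_real_derivative
     (arcsin u * (s / u)) * inverse s + (inverse s + (s + u * (inverse s / 2 * (- 2 * u)))) / 2) (at u)"
    using DERIV_add[OF d1 DERIV_cdivide[OF DERIV_add[OF d2 DERIV_mult[OF DERIV_ident d3]], of 2]]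
    by (simp add: tail_primitive_def[abs_def] s_def mult.commute)
  also have "(arcsin u * (s / u)) * inverse s + (inverse s + (s + u * (inverse s / 2 * (- 2 * u)))) / 2
     = arcsin u / u + s"
  proof -
    have "inverse s + (s + u * (inverse s / 2 * (- 2 * u))) = (1 - u^2) / s + s"
      using s(1) by (simp add: divide_simps power2_eq_square)
    also have "\<dots> = 2 * s" using s by (simp add: s(2)[symmetric])
    finally have A: "inverse s + (s + u * (inverse s / 2 * (- 2 * u))) = 2 * s" .
    have B: "arcsin u * (s / u) * inverse s = arcsin u / u" using s(1) by simp
    have C: "2 * s / 2 = s" by (rule nonzero_mult_div_cancel_left) simp
    show ?thesis unfolding A B C ..
  qed
  also have "\<dots> = chord_height u / (2 * u)"
    using assms by (simp add: chord_height_def s_def[symmetric] add_divide_distrib)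
  finally show ?thesis .
qed

text \<open>With u = (k/x)^2 one has du / (2 u) = - dx / x, so the left-hand side is the integral of
  \<open>chord_height ((k/x)^2) / x\<close> over [a, b]; the mean value theorem turns it into one
  value. The assumption k \<le> a keeps u in the range [0, 1].\<close>

lemma chord_height_mean_value:
  assumes k: "0 < k" "k \<le> a" "a < b"
  shows "\<exists>\<xi>>a. \<xi> < b \<and> tail_primitive ((k/a)^2) - tail_primitive ((k/b)^2) = (b - a) * (chord_height ((k/\<xi>)^2) / \<xi>)"
proof -
  define Q where "Q x = tail_primitive ((k/x)^2)" for x
  have rng: "0 \<le> (k/x)^2" "(k/x)^2 \<le> 1" if "x \<ge> a" for x
    using k that by (auto intro!: power_le_one)
  have "\<exists>l z. a < z \<and> z < b \<and> (Q has_real_derivative l) (at z) \<and> Q b - Q a = (b - a) * l"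
  proof (rule MVT)
    show "continuous_on {a..b} Q" unfolding Q_def
      by (intro continuous_on_compose2[OF continuous_on_tail_primitive] continuous_intros) (use k rng in auto)
  next
    fix x assume x: "a < x" "x < b"
    then have "0 < (k/x)^2" "(k/x)^2 < 1" using k by (auto intro!: power_Suc_less_one simp: power_less_one_iff)
    then have "(Q has_real_derivative chord_height ((k/x)^2) / (2 * (k/x)^2) * (2 * (k/x) * (-k/x^2))) (at x)"
      unfolding Q_def using x k
      by (intro DERIV_chain2[of tail_primitive] has_real_derivative_tail_primitive)
        (auto intro!: derivative_eq_intros simp: power2_eq_square)
    then show "Q differentiable (at x)" using real_differentiable_def by blast
  qed (use k in auto)
  then obtain l z where z: "a < z" "z < b" "(Q has_real_derivative l) (at z)" "Q b - Q a = (b - a) * l" by blast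
  then have "0 < (k/z)^2" "(k/z)^2 < 1" using k by (auto simp: power_less_one_iff)
  then have "(Q has_real_derivative chord_height ((k/z)^2) / (2 * (k/z)^2) * (2 * (k/z) * (-k/z^2))) (at z)"
    unfolding Q_def using z k
    by (intro DERIV_chain2[of tail_primitive] has_real_derivative_tail_primitive)
      (auto intro!: derivative_eq_intros simp: power2_eq_square)
  then have "l = chord_height ((k/z)^2) / (2 * (k/z)^2) * (2 * (k/z) * (-k/z^2))"
    using z(3) DERIV_unique by blast
  also have "\<dots> = - (chord_height ((k/z)^2) / z)"
    using k z by (simp add: divide_simps power2_eq_square)
  finally show ?thesis using z unfolding Q_def by (intro exI[of _ z]) (auto simp: algebra_simps)
qed

lemma chord_height_ratio_mono:
  assumes "0 < k" "k \<le> x" "x \<le> y"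
  shows "chord_height ((k/y)^2) / y \<le> chord_height ((k/x)^2) / x"
proof -
  have "(k/y)^2 \<le> (k/x)^2" using assms by (intro power_mono divide_left_mono) auto
  moreover have "(k/x)^2 \<le> 1" using assms by (intro power_le_one) auto
  ultimately have c: "chord_height ((k/y)^2) \<le> chord_height ((k/x)^2)"
    using assms by (intro chord_height_mono) auto
  have "0 \<le> chord_height ((k/x)^2)"
    using \<open>(k/x)^2 \<le> 1\<close> by (intro chord_height_nonneg) simp_all
  with c show ?thesis using assms by (intro frac_le) auto
qed

text \<open>The integral test: the summand decreases in the index, so each term lies between the
  drops of the primitive over the unit intervals to its right and to its left, and both series of
  drops telescope. The index \<open>k + 1 + j\<close> starts at the first overlapping disc.\<close>

lemma chord_height_tail:
  assumes k: "0 < (k::nat)"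
  defines "t \<equiv> (\<lambda>j. chord_height ((real k / real (k + 1 + j))^2) / real (k + 1 + j))"
  shows "summable t" "tail_primitive ((real k / real (k+1))^2) \<le> suminf t" "suminf t \<le> tail_primitive 1"
proof -
  define Q where "Q n = tail_primitive ((real k / real n)^2)" for n :: nat
  have "(\<lambda>n. (real k / real n)^2) \<longlonglongrightarrow> 0^2" by (intro tendsto_power lim_const_over_n)
  moreover have "\<forall>\<^sub>F n in sequentially. (real k / real n)^2 \<in> {0..1}"
    using eventually_ge_at_top[of k] by eventually_elim (use k in \<open>auto intro!: power_le_one\<close>)
  ultimately have Q0: "Q \<longlonglongrightarrow> 0"
    using continuous_on_tendsto_compose[OF continuous_on_tail_primitive, of "\<lambda>n. (real k / real n)^2" 0 sequentially]
    unfolding Q_def by simp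
  have sums: "(\<lambda>j. Q (m + j) - Q (m + Suc j)) sums Q m" for m
  proof -
    have "(\<lambda>j. - Q (m + j)) \<longlonglongrightarrow> 0"
      using tendsto_minus[OF LIMSEQ_ignore_initial_segment[OF Q0, of m]] by (simp add: add.commute)
    from telescope_sums[OF this] show ?thesis by simp
  qed
  have up: "t j \<le> Q (k + j) - Q (k + Suc j)" for j
  proof -
    obtain \<xi> where "\<xi> > real (k+j)" "\<xi> < real (k + Suc j)"
      and *: "Q (k + j) - Q (k + Suc j) = (real (k + Suc j) - real (k + j)) * (chord_height ((k/\<xi>)^2) / \<xi>)"
      using chord_height_mean_value[of "real k" "real (k+j)" "real (k + Suc j)"] k unfolding Q_def by auto
    then show ?thesis unfolding * t_def
      using chord_height_ratio_mono[of k \<xi> "real (k + 1 + j)"] k by auto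
  qed
  have lo: "Q (k + 1 + j) - Q (k + 1 + Suc j) \<le> t j" for j
  proof -
    obtain \<xi> where "\<xi> > real (k+1+j)" "\<xi> < real (k + 1 + Suc j)"
      and *: "Q (k + 1 + j) - Q (k + 1 + Suc j) = (real (k + 1 + Suc j) - real (k + 1 + j)) * (chord_height ((k/\<xi>)^2) / \<xi>)"
      using chord_height_mean_value[of "real k" "real (k+1+j)" "real (k + 1 + Suc j)"] k unfolding Q_def by auto
    then show ?thesis unfolding * t_def
      using chord_height_ratio_mono[of k "real (k + 1 + j)" \<xi>] k by auto
  qed
  have nonneg: "0 \<le> t j" for j
  proof -
    have "(real k / real (k+1+j))^2 \<le> 1" by (intro power_le_one) simp_all
    then show ?thesis unfolding t_def by (intro divide_nonneg_nonneg chord_height_nonneg) simp_all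
  qed
  show s: "summable t"
    by (rule summable_comparison_test'[OF sums_summable[OF sums[of k]], of 0]) (use up nonneg in auto)
  show "suminf t \<le> tail_primitive 1"
    using suminf_le[OF up s sums_summable[OF sums[of k]]] sums_unique[OF sums[of k]] k by (simp add: Q_def)
  show "tail_primitive ((real k / real (k+1))^2) \<le> suminf t"
    using suminf_le[OF lo sums_summable[OF sums[of "k+1"]] s] sums_unique[OF sums[of "k+1"]] by (simp add: Q_def add.commute)
qed

lemma chord_height_tail_limit:
  "(\<lambda>k. \<Sum>j. chord_height ((real k / real (k + 1 + j))^2) / real (k + 1 + j))
    \<longlonglongrightarrow> pi / 2 * ln 2 + pi / 4"
proof (rule tendsto_sandwich)
  have "(\<lambda>k. real k / (real k + 1)) \<longlonglongrightarrow> 1"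
    using LIMSEQ_n_over_Suc_n[where 'a = real] by (simp add: add.commute)
  then have "(\<lambda>k. (real k / (real k + 1))^2) \<longlonglongrightarrow> 1^2" by (intro tendsto_power)
  moreover have "\<forall>\<^sub>F k in sequentially. (real k / (real k + 1))^2 \<in> {0..1}"
    by (auto intro!: always_eventually power_le_one)
  ultimately show "(\<lambda>k. tail_primitive ((real k / (real k + 1))^2)) \<longlonglongrightarrow> pi / 2 * ln 2 + pi / 4"
    using continuous_on_tendsto_compose[OF continuous_on_tail_primitive, of "\<lambda>k. (real k / (real k + 1))^2" 1 sequentially]
    by (simp add: tail_primitive_1)
  show "\<forall>\<^sub>F k in sequentially. tail_primitive ((real k / (real k + 1))^2) \<le>
      (\<Sum>j. chord_height ((real k / real (k + 1 + j))^2) / real (k + 1 + j))"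
    using eventually_gt_at_top[of 0] by eventually_elim (use chord_height_tail(2) in \<open>simp add: add.commute\<close>)
  show "\<forall>\<^sub>F k in sequentially. (\<Sum>j. chord_height ((real k / real (k + 1 + j))^2) / real (k + 1 + j))
      \<le> tail_primitive 1"
    using eventually_gt_at_top[of 0] by eventually_elim (use chord_height_tail(3) in simp)
qed (simp add: tail_primitive_1)

section \<open>Orbits of an almost-translation\<close>

lemma norm_diff_less_imp_inner:
  fixes \<xi> \<beta> :: complex
  assumes "norm (\<xi> - \<beta>) < norm \<xi>"
  shows "(norm \<beta>)^2 < 2 * Re (\<xi> * cnj \<beta>)"
proof -
  have "(norm (\<xi> - \<beta>))^2 < (norm \<xi>)^2" using assms by (intro power_strict_mono) auto
  then show ?thesis unfolding cmod_power2 by (simp add: power2_eq_square algebra_simps)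
qed

text \<open>If the directions from \<open>0\<close> to \<open>\<alpha>\<close> and to \<open>\<beta>\<close> are almost opposite, with an angular defect
  controlled by the distances, then a small disc cannot be bypassed: \<open>\<xi>\<close> outside \<open>ball 0 \<epsilon>\<close> would lie
  beyond the bisectors of both \<open>0, \<alpha>\<close> and \<open>0, \<beta>\<close>.\<close>
lemma no_bypass:
  fixes \<alpha> \<beta> \<xi> \<kappa> :: complex
  assumes eq: "\<alpha> = - \<kappa> * \<beta>" and re: "0 < Re \<kappa>" and im: "\<bar>Im \<kappa>\<bar> \<le> K * Re \<kappa> * norm \<beta>"
    and eps: "0 < \<epsilon>" "6 * \<epsilon> * K \<le> 1" and \<alpha>: "norm (\<xi> - \<alpha>) < \<epsilon>" and \<beta>: "norm (\<xi> - \<beta>) < \<epsilon>"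
  shows "norm \<xi> < \<epsilon>"
proof (rule ccontr)
  assume "\<not> norm \<xi> < \<epsilon>"
  with \<alpha> \<beta> have A: "(norm \<alpha>)^2 < 2 * Re (\<xi> * cnj \<alpha>)" and B: "(norm \<beta>)^2 < 2 * Re (\<xi> * cnj \<beta>)"
    using norm_diff_less_imp_inner[of \<xi> \<alpha>] norm_diff_less_imp_inner[of \<xi> \<beta>] by linarith+
  define \<eta> where "\<eta> = \<xi> * cnj \<beta>"
  have "\<xi> * cnj \<alpha> = - (cnj \<kappa> * \<eta>)" unfolding eq \<eta>_def by simp
  then have R: "Re (\<xi> * cnj \<alpha>) = - (Re \<kappa> * Re \<eta> + Im \<kappa> * Im \<eta>)" by simp
  \<comment> \<open>Because \<open>Re \<kappa>\<close> is positive, \<open>\<alpha>\<close> is no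
    longer than the segment from \<open>\<alpha>\<close> to \<open>\<beta>\<close>, which is shorter
    than 2 \<epsilon>. Hence |\<xi>| \<le> 3 \<epsilon>, and doubling this constant gives the 6 in
    the hypothesis.\<close>
  have "norm \<kappa> \<le> norm (\<kappa> + 1)"
    unfolding cmod_def using re by (intro real_sqrt_le_mono) (auto simp: power2_eq_square algebra_simps)
  then have "norm \<alpha> \<le> norm (\<kappa> + 1) * norm \<beta>" unfolding eq by (simp add: norm_mult mult_right_mono)
  also have "\<dots> = norm (\<beta> - \<alpha>)" unfolding eq by (simp add: norm_mult[symmetric] algebra_simps)
  also have "\<dots> \<le> norm (\<xi> - \<alpha>) + norm (\<xi> - \<beta>)"
    using norm_triangle_ineq4[of "\<xi> - \<alpha>" "\<xi> - \<beta>"] by simp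
  finally have "norm \<alpha> \<le> 2 * \<epsilon>" using \<alpha> \<beta> by simp
  moreover have "norm \<xi> \<le> norm (\<xi> - \<alpha>) + norm \<alpha>" using norm_triangle_ineq[of "\<xi> - \<alpha>" \<alpha>] by simp
  ultimately have \<xi>: "norm \<xi> \<le> 3 * \<epsilon>" using \<alpha> by simp
  have "\<bar>Im \<kappa> * Im \<eta>\<bar> \<le> (K * Re \<kappa> * norm \<beta>) * (3 * \<epsilon> * norm \<beta>)"
    unfolding abs_mult
  proof (rule mult_mono)
    have "\<bar>Im \<eta>\<bar> \<le> norm \<xi> * norm \<beta>" using abs_Im_le_cmod[of \<eta>] by (simp add: \<eta>_def norm_mult)
    also have "\<dots> \<le> 3 * \<epsilon> * norm \<beta>" using \<xi> by (intro mult_right_mono) auto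
    finally show "\<bar>Im \<eta>\<bar> \<le> 3 * \<epsilon> * norm \<beta>" .
  qed (use im in \<open>auto intro: order_trans[OF abs_ge_zero]\<close>)
  also have "\<dots> = (6 * \<epsilon> * K) * (Re \<kappa> * (norm \<beta>)^2 / 2)" by (simp add: power2_eq_square)
  also have "\<dots> \<le> 1 * (Re \<kappa> * (norm \<beta>)^2 / 2)" using eps re by (intro mult_right_mono) auto
  finally have I: "\<bar>Im \<kappa> * Im \<eta>\<bar> \<le> Re \<kappa> * (norm \<beta>)^2 / 2" by simp
  have "Re \<kappa> * (norm \<beta>)^2 < Re \<kappa> * (2 * Re \<eta>)" using B re unfolding \<eta>_def by (intro mult_strict_left_mono) auto
  then have X: "Re \<kappa> * (norm \<beta>)^2 < 2 * (Re \<kappa> * Re \<eta>)" by simp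
  \<comment> \<open>Adding the first bisector inequality, scaled by \<open>Re \<kappa>\<close>, to
    the second makes the main term X cancel; Y is too small to compensate for b, which leaves a <
    0.\<close>
  have "False" if "b < 2 * X" "a < 2 * - (X + Y)" "\<bar>Y\<bar> \<le> b / 2" "0 \<le> a" for a b X Y :: real
  proof -
    have "- Y \<le> b / 2" using that(3) by (simp only: abs_le_iff)
    moreover have "a < - (2 * X) - 2 * Y" using that(2) by (simp add: algebra_simps)
    ultimately show False using that(1,4) by argo
  qed
  from this[OF X A[unfolded R] I zero_le_power2] show False .
qed

text \<open>Quotients of numbers close to 1 are handled as products with a conjugate: the two differ
  by a positive factor, so the ratio of imaginary to real part is unchanged.\<close>

lemma near_one_mult_cnj:
  fixes a b :: complex
  assumes "norm (a - 1) \<le> 1/8" "norm (b - 1) \<le> 1/8"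
  shows "1/2 \<le> Re (a * cnj b)" "norm (a * cnj b) \<le> 2"
    "\<bar>Im (a * cnj b)\<bar> \<le> 2 * (norm (a - 1) + norm (b - 1))"
proof -
  define x y where "x = norm (a - 1)" and "y = norm (b - 1)"
  have "a * cnj b - 1 = (a - 1) + cnj (b - 1) + (a - 1) * cnj (b - 1)" by (simp add: algebra_simps)
  also have "norm \<dots> \<le> x + y + x * y" unfolding x_def y_def
    by (intro norm_triangle_le add_mono norm_triangle_le) (simp_all add: norm_mult del: complex_cnj_diff)
  finally have n: "norm (a * cnj b - 1) \<le> x + y + x * y" .
  have xy: "0 \<le> x" "0 \<le> y" "x \<le> 1/8" "y \<le> 1/8" using assms by (auto simp: x_def y_def)
  have "x * y \<le> x * 1" using xy by (intro mult_left_mono) auto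
  then have n2: "norm (a * cnj b - 1) \<le> 2 * (x + y)" using n xy by simp
  then have n3: "norm (a * cnj b - 1) \<le> 1/2" using xy by simp
  show "1/2 \<le> Re (a * cnj b)" using n3 abs_Re_le_cmod[of "a * cnj b - 1"] by simp
  show "norm (a * cnj b) \<le> 2" using n3 norm_triangle_ineq[of "a * cnj b - 1" 1] by simp
  show "\<bar>Im (a * cnj b)\<bar> \<le> 2 * (norm (a - 1) + norm (b - 1))"
    using n2 abs_Im_le_cmod[of "a * cnj b - 1"] unfolding x_def y_def by simp
qed

text \<open>The constant \<open>C\<close> can absorb any finite initial stretch, so the step bound
  is required from n = 1 on and not merely eventually. Injectivity makes any given disc disjoint
  from the earlier ones for small radii.\<close>

locale parabolic_sequence =
  fixes z :: "nat \<Rightarrow> complex" and C :: real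
  assumes inj: "inj z" and nonzero: "z n \<noteq> 0"
    and step: "1 \<le> n \<Longrightarrow> norm (- 1 / z (Suc n) - (- 1 / z n) - 1) \<le> C / real n ^ 2"
begin

definition w :: "nat \<Rightarrow> complex" where "w n = - 1 / z n"

lemma w_nonzero: "w n \<noteq> 0" and z_eq: "z n = - 1 / w n"
  using nonzero by (auto simp: w_def)

lemma z_diff: "z a - z b = (w a - w b) / (w a * w b)"
proof -
  have "- 1 / x - - 1 / y = (x - y) / (x * y)" if "x \<noteq> 0" "y \<noteq> 0" for x y :: complex
    using that by (simp add: field_simps)
  from this[OF w_nonzero[of a] w_nonzero[of b]] show ?thesis by (simp only: z_eq)
qed

lemma C_nonneg: "0 \<le> C"
  using order_trans[OF norm_ge_zero step[of 1]] by simp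

lemma w_step: "1 \<le> n \<Longrightarrow> norm (w (Suc n) - w n - 1) \<le> C / real n ^ 2"
  using step unfolding w_def .

text \<open>Each step error C / i^2 is at most 2 C (1/i - 1/(i+1)), so the errors telescope. The
  resulting factor (j - m) / (m j) has the size of |z m - z j|, which is what the angular estimate
  needs.\<close>

lemma w_diff:
  assumes m: "1 \<le> m" "m \<le> j"
  shows "norm (w j - w m - of_nat (j - m)) \<le> 2 * C * (real (j - m) / (real m * real j))"
proof -
  have "norm (w j - w m - of_nat (j - m)) \<le> 2 * C * (1 / real m - 1 / real j)"
    using m(2)
  proof (induction j rule: dec_induct)
    case (step j)
    have j: "1 \<le> j" using step m by simp
    have "w (Suc j) - w m - of_nat (Suc j - m) = (w j - w m - of_nat (j - m)) + (w (Suc j) - w j - 1)"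
      using step by (simp add: Suc_diff_le)
    also have "norm \<dots> \<le> 2 * C * (1 / real m - 1 / real j) + C / real j ^ 2"
      by (rule norm_triangle_le[OF add_mono[OF step.IH w_step[OF j]]])
    also have "C / real j ^ 2 \<le> 2 * C * (1 / real j - 1 / real (Suc j))"
    proof -
      have "1 / real j ^ 2 \<le> 2 / (real j * (real j + 1))"
        using j by (simp add: divide_simps power2_eq_square mult_le_cancel_left)
      also have "\<dots> = 2 * (1 / real j - 1 / real (Suc j))" using j by (simp add: divide_simps)
      finally have "C * (1 / real j ^ 2) \<le> C * (2 * (1 / real j - 1 / real (Suc j)))"
        using C_nonneg by (rule mult_left_mono)
      then show ?thesis by (simp only: times_divide_eq_right mult_1_right mult.left_commute mult.assoc)
    qed
    finally show ?case by (simp add: algebra_simps)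
  qed simp
  also have "1 / real m - 1 / real j = real (j - m) / (real m * real j)"
    using m by (simp add: divide_simps of_nat_diff)
  finally show ?thesis .
qed

definition B :: real where "B = norm (w 1 - 1) + 2 * C"

lemma B_nonneg: "0 \<le> B" using C_nonneg by (simp add: B_def)

lemma w_near: assumes "1 \<le> n" shows "norm (w n - of_nat n) \<le> B"
proof -
  have "w n - of_nat n = (w 1 - 1) + (w n - w 1 - of_nat (n - 1))" using assms by (simp add: of_nat_diff)
  also have "norm \<dots> \<le> norm (w 1 - 1) + 2 * C * (real (n - 1) / (real 1 * real n))"
    using norm_triangle_mono[OF order_refl[of "norm (w 1 - 1)"] w_diff[of 1 n]] assms by (simp del: of_nat_diff)
  also have "2 * C * (real (n - 1) / (real 1 * real n)) \<le> 2 * C * 1"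
    using C_nonneg assms by (intro mult_left_mono) auto
  finally show ?thesis by (simp add: B_def)
qed

lemma w_ratio_near:
  assumes "1 \<le> n" "8 * B \<le> n"
  shows "norm (w n / of_nat n - 1) \<le> 1/8"
proof -
  have "w n / of_nat n - 1 = (w n - of_nat n) / of_nat n" using assms by (simp add: field_simps)
  then have "norm (w n / of_nat n - 1) = norm (w n - of_nat n) / n" by (simp add: norm_divide)
  also have "\<dots> \<le> B / n" using w_near[OF assms(1)] by (intro divide_right_mono) auto
  also have "\<dots> \<le> 1/8" using assms by (simp add: field_simps)
  finally show ?thesis .
qed

lemma norm_near_one: "norm (a - 1) \<le> 1/8 \<Longrightarrow> 7/8 \<le> norm a" "norm (a - 1) \<le> 1/8 \<Longrightarrow> norm a \<le> 9/8" for a :: complex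
  using norm_triangle_ineq3[of a 1] by auto

lemma w_bounds:
  assumes "1 \<le> n" "8 * B \<le> n"
  shows "n / 2 \<le> norm (w n)" "norm (w n) \<le> 2 * n"
  using norm_near_one[OF w_ratio_near[OF assms]] assms(1) by (auto simp: norm_divide field_simps)

lemma z_tendsto_0: "z \<longlonglongrightarrow> 0"
proof (rule Lim_null_comparison)
  obtain N :: nat where N: "max 1 (8 * B) \<le> N" using real_arch_simple by blast
  show "\<forall>\<^sub>F n in sequentially. norm (z n) \<le> 2 / real n"
    using eventually_ge_at_top[of N]
  proof eventually_elim
    case (elim n)
    with N have n: "1 \<le> n" "8 * B \<le> n" by auto
    have "norm (z n) = 1 / norm (w n)" by (simp add: z_eq norm_divide)
    also have "\<dots> \<le> 1 / (real n / 2)" using w_bounds(1)[OF n] n by (intro frac_le) auto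
    finally show ?case by simp
  qed
qed (rule lim_const_over_n)

text \<open>From \<open>M\<close> on, the quotients \<open>w n / of_nat n\<close> as well as single
  and averaged steps are within 1/8 of 1, the range assumed by
  \<open>near_one_mult_cnj\<close>.\<close>

definition M :: nat where "M = nat \<lceil>8 * B + 16 * C\<rceil> + 1"

lemma M: assumes "M \<le> m"
  shows "1 \<le> m" "8 * B \<le> m" "16 * C \<le> m"
proof -
  have "8 * B + 16 * C \<le> real M" unfolding M_def by linarith
  moreover have "real M \<le> real m" using assms by simp
  ultimately show "8 * B \<le> m" "16 * C \<le> m"
    using B_nonneg C_nonneg by linarith+
  show "1 \<le> m" using assms by (simp add: M_def)
qed

text \<open>The bracket is the coefficient of d / (m n) in the bound for the imaginary part in
  \<open>almost_opposite\<close>. The factor 32 is 16, from the lower bound 1/16 of the real part,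
  times 2, from d / (m n) \<le> 2 |z m - z n|.\<close>

definition K :: real where "K = 32 * (28 * C + 8 * B)"

lemma K_nonneg: "0 \<le> K" using B_nonneg C_nonneg by (simp add: K_def)

text \<open>With d = n - m, \<open>\<kappa>\<close> is P w_m / (d Q w_(n+1)), where P is the step
  after n and Q the mean step from m to n. P and Q contribute O(1/(m n)) to its argument. For w_m /
  w_(n+1) the crude bound O(1/m) would be too weak when m and n are close; the bound O(d/(m n)) is
  proportional to |z m - z n|.\<close>

lemma almost_opposite:
  assumes m: "M \<le> m" and mn: "m < n"
  obtains \<kappa> where "z (Suc n) - z n = - \<kappa> * (z m - z n)" "0 < Re \<kappa>"
    "\<bar>Im \<kappa>\<bar> \<le> K * Re \<kappa> * norm (z m - z n)"
proof -
  define d where "d = real (n - m)"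
  have d: "d \<ge> 1" "real n = real m + d" using mn by (auto simp: d_def)
  note Mm = M[OF m]
  have Mn: "1 \<le> n" "8 * B \<le> n" "16 * C \<le> n" using M[of n] m mn by auto
  have Mn1: "1 \<le> Suc n" "8 * B \<le> Suc n" using M[of "Suc n"] m mn by auto
  have m0: "real m > 0" "real m \<ge> 1" and n0: "real n > 0" "real n \<ge> 1" using Mm Mn by auto
  define P where "P = w (Suc n) - w n"
  define Q where "Q = (w n - w m) / of_real d"
  define Wm where "Wm = w m / of_nat m"
  define Wn where "Wn = w n / of_nat n"
  define Wn1 where "Wn1 = w (Suc n) / of_nat (Suc n)"
  have nW: "norm (Wm - 1) \<le> 1/8" "norm (Wn - 1) \<le> 1/8" "norm (Wn1 - 1) \<le> 1/8"
    unfolding Wm_def Wn_def Wn1_def by (intro w_ratio_near Mm Mn Mn1)+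
  have CP: "norm (P - 1) \<le> C / (real m * real n)"
  proof -
    have "norm (P - 1) \<le> C / real n ^ 2" unfolding P_def by (rule w_step[OF Mn(1)])
    also have "\<dots> \<le> C / (real m * real n)" using C_nonneg m0 n0 mn
      by (intro divide_left_mono) (auto simp: power2_eq_square)
    finally show ?thesis .
  qed
  have CQ: "norm (Q - 1) \<le> 2 * C / (real m * real n)"
  proof -
    have "Q - 1 = (w n - w m - of_nat (n - m)) / of_real d"
      using d unfolding Q_def by (simp add: d_def field_simps)
    then have "norm (Q - 1) = norm (w n - w m - of_nat (n - m)) / d" using d by (simp add: norm_divide)
    also have "\<dots> \<le> 2 * C * (d / (real m * real n)) / d"
      by (rule divide_right_mono[OF w_diff[OF Mm(1) less_imp_le[OF mn], folded d_def]]) (use d in simp)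
    also have "\<dots> = 2 * C / (real m * real n)" using d by simp
    finally show ?thesis .
  qed
  have small: "2 * C / (real m * real n) \<le> 1/8"
  proof -
    have "real m * 1 \<le> real m * real n" using m0 n0 by (intro mult_left_mono) auto
    then have "16 * C \<le> real m * real n" using Mm(3) by linarith
    then show ?thesis using m0 n0 by (simp add: field_simps)
  qed
  have nP: "norm (P - 1) \<le> 1/8" and nQ: "norm (Q - 1) \<le> 1/8"
  proof -
    have "C / (real m * real n) \<le> 2 * C / (real m * real n)" using C_nonneg m0 n0 by (intro divide_right_mono) auto
    then show "norm (P - 1) \<le> 1/8" using CP small by simp
  qed (use CQ small in simp)
  define G where "G = P * cnj Q"
  define H where "H = Wm * cnj Wn1"
  note G = near_one_mult_cnj[OF nP nQ, folded G_def]
  note H = near_one_mult_cnj[OF nW(1,3), folded H_def]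
  have ImG: "\<bar>Im G\<bar> \<le> 6 * C / (real m * real n)"
    using G(3) CP CQ by (simp add: add_divide_distrib[symmetric])
  have ImH: "\<bar>Im H\<bar> \<le> (2 * B + 4 * C) * (2 * d / (real m * real n))"
  proof -
    define s where "s = w (Suc n) - w m"
    have d1: "real (Suc n - m) = d + 1" using mn by (simp add: d_def)
    have ns: "norm (s - of_real (d + 1)) \<le> 2 * C * ((d + 1) / (real m * real (Suc n)))"
      using w_diff[of m "Suc n"] Mm mn unfolding s_def d1[symmetric] by (simp add: less_imp_le)
    have ims: "\<bar>Im s\<bar> \<le> 2 * C * ((d + 1) / (real m * real (Suc n)))"
      using abs_Im_le_cmod[of "s - of_real (d + 1)"] ns by simp
    have "2 * C * ((d + 1) / (real m * real (Suc n))) \<le> (d + 1) / 8"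
    proof -
      have "2 * C / (real m * real (Suc n)) \<le> 2 * C / (real m * real n)"
        using C_nonneg m0 n0 by (intro divide_left_mono) auto
      then have "2 * C / (real m * real (Suc n)) * (d + 1) \<le> 1/8 * (d + 1)"
        using small d by (intro mult_right_mono) auto
      then show ?thesis by simp
    qed
    then have res: "\<bar>Re s\<bar> \<le> 2 * (d + 1)"
      using abs_Re_le_cmod[of "s - of_real (d + 1)"] ns d by simp
    \<comment> \<open>The first summand is real, so the imaginary part comes from the displacement
      \<open>s\<close> alone and is of order d.\<close>
    have "w m * cnj (w (Suc n)) = w m * cnj (w m) + w m * cnj s" by (simp add: s_def algebra_simps)
    then have "Im (w m * cnj (w (Suc n))) = Im (w m) * Re s - Re (w m) * Im s" by simp
    then have "\<bar>Im (w m * cnj (w (Suc n)))\<bar> \<le> \<bar>Im (w m)\<bar> * \<bar>Re s\<bar> + \<bar>Re (w m)\<bar> * \<bar>Im s\<bar>"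
      unfolding abs_mult[symmetric] by linarith
    also have "\<dots> \<le> B * (2 * (d + 1)) + (2 * real m) * (2 * C * ((d + 1) / (real m * real (Suc n))))"
    proof (intro add_mono mult_mono ims res)
      show "\<bar>Im (w m)\<bar> \<le> B" using abs_Im_le_cmod[of "w m - of_nat m"] w_near[OF Mm(1)] by simp
      show "\<bar>Re (w m)\<bar> \<le> 2 * real m" using abs_Re_le_cmod[of "w m"] w_bounds(2)[OF Mm(1,2)] by simp
    qed (use B_nonneg in auto)
    also have "(2 * real m) * (2 * C * ((d + 1) / (real m * real (Suc n)))) = 4 * C * (d + 1) / real (Suc n)"
      using m0 by (simp add: divide_simps)
    also have "\<dots> \<le> 4 * C * (d + 1) / 1"
      using C_nonneg d by (intro divide_left_mono mult_nonneg_nonneg) auto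
    finally have 1: "\<bar>Im (w m * cnj (w (Suc n)))\<bar> \<le> (2 * B + 4 * C) * (d + 1)" by (simp add: algebra_simps)
    have "H = w m * cnj (w (Suc n)) / of_real (real m * real (Suc n))"
      unfolding H_def Wm_def Wn1_def by simp
    then have "\<bar>Im H\<bar> = \<bar>Im (w m * cnj (w (Suc n)))\<bar> / (real m * real (Suc n))"
      by (simp only: Im_divide_of_real abs_divide) (simp add: abs_mult)
    also have "\<dots> \<le> (2 * B + 4 * C) * (d + 1) / (real m * real (Suc n))"
      by (rule divide_right_mono[OF 1]) simp
    also have "\<dots> = (2 * B + 4 * C) / real m * ((d + 1) / real (Suc n))" by simp
    also have "\<dots> \<le> (2 * B + 4 * C) / real m * (2 * d / real n)"
    proof (rule mult_left_mono)
      have "(d + 1) * real n \<le> 2 * d * real (Suc n)"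
      proof -
        have "(d + 1) * real n \<le> (2 * d) * real (Suc n)" using d by (intro mult_mono) auto
        then show ?thesis by simp
      qed
      then show "(d + 1) / real (Suc n) \<le> 2 * d / real n" using n0 by (simp add: field_simps)
    qed (use B_nonneg C_nonneg in simp)
    finally show ?thesis by simp
  qed
  have ImH': "\<bar>Im H\<bar> \<le> 1/2" using H(3) nW by simp
  \<comment> \<open>The sharper constant for P gives |Im G| \<le> 3/8, so that the real part of
    \<open>G * H\<close> stays above 1/4 - 3/16 = 1/16.\<close>
  have "norm (P - 1) \<le> 1/16" using CP small by simp
  then have ImG': "\<bar>Im G\<bar> \<le> 3/8" using G(3) nQ by simp
  have "Re (G * H) = Re G * Re H - Im G * Im H" by simp
  moreover have "1/2 * (1/2) \<le> Re G * Re H" using G(1) H(1) by (intro mult_mono) auto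
  moreover have "\<bar>Im G * Im H\<bar> \<le> 3/8 * (1/2)" unfolding abs_mult using ImG' ImH' by (intro mult_mono) auto
  ultimately have ReGH: "1/16 \<le> Re (G * H)" by linarith
  have "\<bar>Im (G * H)\<bar> \<le> \<bar>Re G\<bar> * \<bar>Im H\<bar> + \<bar>Im G\<bar> * \<bar>Re H\<bar>"
    unfolding abs_mult[symmetric] times_complex.simps by (rule abs_triangle_ineq)
  also have "\<dots> \<le> 2 * ((2 * B + 4 * C) * (2 * d / (real m * real n))) + 6 * C / (real m * real n) * 2"
    using ImG ImH G(2) H(2) abs_Re_le_cmod[of G] abs_Re_le_cmod[of H]
    by (intro add_mono mult_mono) auto
  also have "\<dots> \<le> (28 * C + 8 * B) * (d / (real m * real n))"
  proof -
    have "12 * C * (1 / (real m * real n)) \<le> 12 * C * (d / (real m * real n))"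
      using C_nonneg d m0 n0 by (intro mult_left_mono divide_right_mono) auto
    moreover have "2 * ((2 * B + 4 * C) * (2 * d / (real m * real n))) =
        (8 * B + 16 * C) * (d / (real m * real n))" by (simp add: algebra_simps)
    moreover have "(28 * C + 8 * B) * t = (8 * B + 16 * C) * t + 12 * C * t" for t :: real
      by (simp add: algebra_simps)
    from this[of "d / (real m * real n)"]
    have "(28 * C + 8 * B) * (d / (real m * real n)) =
        (8 * B + 16 * C) * (d / (real m * real n)) + 12 * C * (d / (real m * real n))" .
    moreover have "6 * C / (real m * real n) * 2 = 12 * C * (1 / (real m * real n))" by simp
    ultimately show ?thesis by linarith
  qed
  finally have ImGH: "\<bar>Im (G * H)\<bar> \<le> (28 * C + 8 * B) * (d / (real m * real n))" .

  define \<kappa> where "\<kappa> = P * w m / (of_real d * Q * w (Suc n))"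
  define r where "r = real m / (d * real (Suc n) * (norm Q)^2 * (norm Wn1)^2)"
  have nz: "Q \<noteq> 0" "Wn1 \<noteq> 0" using norm_near_one(1)[OF nQ] norm_near_one(1)[OF nW(3)] by auto
  have r: "r > 0" using nz d m0 unfolding r_def by (intro divide_pos_pos mult_pos_pos) auto
  have dQ: "of_real d * Q = w n - w m" using d by (simp add: Q_def)
  have \<beta>: "z m - z n = - (of_real d * Q) / (w m * w n)"
    unfolding dQ z_diff by simp
  have \<alpha>: "z (Suc n) - z n = P / (w n * w (Suc n))"
    unfolding z_diff P_def by (simp only: mult.commute)
  have "p / (x * y) = - (p * m / (D * y)) * (- D / (m * x))" if "D \<noteq> 0" "m \<noteq> 0" for p x y m D :: complex
    using that by simp
  from this[of "of_real d * Q" "w m" P "w n" "w (Suc n)"]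
  have eq: "z (Suc n) - z n = - \<kappa> * (z m - z n)"
    unfolding \<alpha> \<beta> \<kappa>_def using w_nonzero nz d by simp
  have \<kappa>: "\<kappa> = G * H * of_real r"
  proof -
    have r1: "of_real r = (of_nat m / (of_real d * of_nat (Suc n) * (Q * cnj Q) * (Wn1 * cnj Wn1)) :: complex)"
      unfolding r_def complex_norm_square[symmetric] by simp
    have w1: "w m = of_nat m * Wm" "w (Suc n) = of_nat (Suc n) * Wn1"
      unfolding Wm_def Wn1_def using m0 by (simp_all del: of_nat_Suc)
    have key: "P * (m * W) / (d * Q * (n * V)) = (P * Q') * (W * V') * (m / (d * n * (Q * Q') * (V * V')))"
      if "Q' \<noteq> 0" "V' \<noteq> 0" for m W d n V Q Q' V' :: complex
      using that by (simp add: mult_ac)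
    show ?thesis unfolding \<kappa>_def G_def H_def r1 w1 by (rule key) (use nz in simp_all)
  qed
  have \<beta>_ge: "d / (real m * real n) \<le> 2 * norm (z m - z n)"
  proof -
    have wm: "norm (w m) = real m * norm Wm" "norm (w n) = real n * norm Wn"
      unfolding Wm_def Wn_def using m0 n0 by (simp_all add: norm_divide)
    have "norm Wm * norm Wn \<le> 9/8 * (9/8)"
      using norm_near_one(2)[OF nW(1)] norm_near_one(2)[OF nW(2)] by (intro mult_mono) auto
    then have "norm Wm * norm Wn \<le> 2 * norm Q" using norm_near_one(1)[OF nQ] by simp
    then have "d / (real m * real n) * (norm Wm * norm Wn) \<le> d / (real m * real n) * (2 * norm Q)"
      using d m0 n0 by (intro mult_left_mono) auto
    moreover have "norm Wm > 0" "norm Wn > 0" using norm_near_one(1)[OF nW(1)] norm_near_one(1)[OF nW(2)] by linarith+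
    ultimately have "d / (real m * real n) \<le> d / (real m * real n) * (2 * norm Q) / (norm Wm * norm Wn)"
      by (simp only: pos_le_divide_eq mult_pos_pos)
    also have "\<dots> = 2 * norm (z m - z n)"
      unfolding \<beta> using d m0 n0 by (simp add: norm_divide norm_mult wm mult_ac del: d(2))
    finally show ?thesis .
  qed
  show ?thesis
  proof (rule that[OF eq])
    have Re: "Re \<kappa> = Re (G * H) * r" and Im: "Im \<kappa> = Im (G * H) * r" unfolding \<kappa> by simp_all
    show "0 < Re \<kappa>" unfolding Re using ReGH r by (intro mult_pos_pos) auto
    have "\<bar>Im (G * H)\<bar> \<le> (28 * C + 8 * B) * (2 * norm (z m - z n))"
      using ImGH mult_left_mono[OF \<beta>_ge, of "28 * C + 8 * B"] B_nonneg C_nonneg by simp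
    also have "\<dots> = K * (1/16) * norm (z m - z n)" by (simp add: K_def)
    also have "\<dots> \<le> K * Re (G * H) * norm (z m - z n)"
      using ReGH K_nonneg by (intro mult_right_mono mult_left_mono) auto
    finally have "\<bar>Im (G * H)\<bar> * r \<le> K * Re (G * H) * norm (z m - z n) * r"
      using r by (intro mult_right_mono) auto
    then show "\<bar>Im \<kappa>\<bar> \<le> K * Re \<kappa> * norm (z m - z n)"
      unfolding Re Im abs_mult using r by (simp add: mult_ac)
  qed
qed

text \<open>For m \<ge> \<open>M\<close> the angular estimate meets the hypotheses of
  \<open>no_bypass\<close>. The finitely many earlier points stay at distance at least 2 \<delta>
  from 0 while z_(n+1) is within \<delta> of 0, so their discs do not meet its disc at all.\<close>

lemma balls_no_bypass:
  obtains \<epsilon>\<^sub>1 N where "\<epsilon>\<^sub>1 > 0" "1 \<le> N"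
    "\<And>\<epsilon> m n. 0 < \<epsilon> \<Longrightarrow> \<epsilon> < \<epsilon>\<^sub>1 \<Longrightarrow> N \<le> n \<Longrightarrow> m < n \<Longrightarrow> ball (z m) \<epsilon> \<inter> ball (z (Suc n)) \<epsilon> \<subseteq> ball (z n) \<epsilon>"
proof -
  define \<delta> where "\<delta> = Min ((\<lambda>m. norm (z m)) ` {..M}) / 2"
  have \<delta>: "\<delta> > 0" unfolding \<delta>_def using nonzero by (simp add: Min_gr_iff)
  have \<delta>_le: "2 * \<delta> \<le> norm (z m)" if "m < M" for m unfolding \<delta>_def using that by (simp add: Min_le)
  have "\<forall>\<^sub>F n in sequentially. norm (z n) < \<delta>"
    using z_tendsto_0 \<delta> by (simp add: tendsto_iff)
  then obtain N where N: "\<And>n. N \<le> n \<Longrightarrow> norm (z n) < \<delta>" unfolding eventually_sequentially by blast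
  define \<epsilon>\<^sub>1 where "\<epsilon>\<^sub>1 = min (\<delta> / 2) (1 / (6 * (K + 1)))"
  show ?thesis
  proof (rule that[of \<epsilon>\<^sub>1 "max 1 N"])
    show "\<epsilon>\<^sub>1 > 0" using \<delta> K_nonneg by (simp add: \<epsilon>\<^sub>1_def)
  next
    fix \<epsilon> m n assume e: "0 < \<epsilon>" "\<epsilon> < \<epsilon>\<^sub>1" and n: "max 1 N \<le> n" "m < n"
    show "ball (z m) \<epsilon> \<inter> ball (z (Suc n)) \<epsilon> \<subseteq> ball (z n) \<epsilon>"
    proof (cases "m < M")
      case True
      have "norm (z (Suc n)) < \<delta>" using N[of "Suc n"] n by simp
      then have "\<delta> \<le> dist (z m) (z (Suc n))"
        using \<delta>_le[OF True] norm_triangle_ineq2[of "z m" "z (Suc n)"] by (simp add: dist_norm)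
      then have "\<epsilon> + \<epsilon> \<le> dist (z m) (z (Suc n))" using e unfolding \<epsilon>\<^sub>1_def by linarith
      then show ?thesis using disjoint_ballI by blast
    next
      case False
      then obtain \<kappa> where \<kappa>: "z (Suc n) - z n = - \<kappa> * (z m - z n)" "0 < Re \<kappa>"
          "\<bar>Im \<kappa>\<bar> \<le> K * Re \<kappa> * norm (z m - z n)"
        using almost_opposite[of m n] n by (metis not_less)
      have "6 * \<epsilon> * K \<le> 6 * \<epsilon> * (K + 1)" using e by simp
      also have "\<dots> = \<epsilon> * (6 * (K + 1))" by simp
      also have "\<dots> \<le> 1 / (6 * (K + 1)) * (6 * (K + 1))"
        using e K_nonneg unfolding \<epsilon>\<^sub>1_def by (intro mult_right_mono) simp_all
      also have "\<dots> = 1" using K_nonneg by simp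
      finally have eK: "6 * \<epsilon> * K \<le> 1" .
      show ?thesis
      proof
        fix x assume x: "x \<in> ball (z m) \<epsilon> \<inter> ball (z (Suc n)) \<epsilon>"
        have "norm (x - z n) < \<epsilon>"
          by (rule no_bypass[OF \<kappa> e(1) eK]) (use x in \<open>auto simp: dist_norm norm_minus_commute\<close>)
        then show "x \<in> ball (z n) \<epsilon>" by (simp add: dist_norm norm_minus_commute)
      qed
    qed
  qed simp
qed

end

section \<open>The moment of the neighbourhood of an orbit\<close>

lemma set_integrable_id_bounded:
  fixes S :: "complex set"
  assumes "S \<in> sets borel" "bounded S"
  shows "set_integrable lborel S (\<lambda>x. x)"
proof -
  obtain R where "\<And>x. x \<in> S \<Longrightarrow> norm x \<le> R" using assms(2) bounded_iff by blast
  moreover have "emeasure lborel S < \<infinity>" using assms(2) by (rule emeasure_bounded_finite)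
  ultimately show ?thesis unfolding set_integrable_def
    using assms(1) by (intro integrableI_bounded_set_indicator[where B = R]) auto
qed

lemma norm_set_integral_diff_le:
  fixes S :: "complex set"
  assumes S: "S \<in> sets borel" "S \<subseteq> ball a r" and r: "0 \<le> r"
  shows "norm ((LINT x:S|lborel. x) - a * of_real (measure lborel S)) \<le> r * measure lborel S"
proof -
  have bdd: "bounded S" using S(2) bounded_subset bounded_ball by blast
  have fin: "emeasure lborel S < \<infinity>" using bdd by (rule emeasure_bounded_finite)
  have i1: "set_integrable lborel S (\<lambda>x. x)" by (rule set_integrable_id_bounded[OF S(1) bdd])
  have i2: "set_integrable lborel S (\<lambda>x. a)" unfolding set_integrable_def
    using fin S(1) by (intro integrable_scaleR_left integrable_real_indicator) auto
  have i3: "set_integrable lborel S (\<lambda>x. x - a)" using i1 i2 by (rule set_integral_diff)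
  have i4: "set_integrable lborel S (\<lambda>x. r)" unfolding set_integrable_def
    using fin S(1) by (intro integrable_scaleR_left integrable_real_indicator) auto
  have "(LINT x:S|lborel. a) = a * of_real (measure lborel S)"
    using set_integral_const[of S lborel a] S(1) fin by (simp add: scaleR_conv_of_real mult.commute)
  then have "(LINT x:S|lborel. x) - a * of_real (measure lborel S) = (LINT x:S|lborel. x - a)"
    using set_integral_diff(2)[OF i1 i2] by simp
  also have "norm \<dots> \<le> (LINT x:S|lborel. norm (x - a))"
    by (rule set_integral_norm_bound[OF i3])
  also have "\<dots> \<le> (LINT x:S|lborel. r)"
    using set_integrable_norm[OF i3] i4
    by (rule set_integral_mono) (use S(2) in \<open>force simp: dist_norm norm_minus_commute\<close>)
  also have "\<dots> = r * measure lborel S"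
    using set_integral_const[of S lborel r] S(1) fin by simp
  finally show ?thesis .
qed

lemma bounded_UN_ball:
  fixes z :: "'i \<Rightarrow> 'a :: real_normed_vector"
  assumes "bounded (range z)"
  shows "bounded (\<Union>n. ball (z n) \<epsilon>)"
proof -
  obtain R where R: "\<And>n. norm (z n) \<le> R" using assms by (auto simp: bounded_iff)
  have "(\<Union>n. ball (z n) \<epsilon>) \<subseteq> ball 0 (R + \<epsilon>)"
  proof
    fix x assume "x \<in> (\<Union>n. ball (z n) \<epsilon>)"
    then obtain n where "norm (x - z n) < \<epsilon>" by (auto simp: dist_norm norm_minus_commute)
    then show "x \<in> ball 0 (R + \<epsilon>)" using R[of n] norm_triangle_ineq[of "x - z n" "z n"] by simp
  qed
  then show ?thesis using bounded_subset bounded_ball by blast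
qed

text \<open>This is area times centre of mass: the division by the area cancels, and the result is
  additive over disjoint pieces.\<close>

definition moment :: "(nat \<Rightarrow> complex) \<Rightarrow> real \<Rightarrow> complex" where
  "moment z \<epsilon> = (LINT x:(\<Union>n. ball (z n) \<epsilon>)|lborel. x)"

definition fresh_part :: "(nat \<Rightarrow> complex) \<Rightarrow> real \<Rightarrow> nat \<Rightarrow> complex set" where
  "fresh_part z \<epsilon> = disjointed (\<lambda>n. ball (z n) \<epsilon>)"

lemma fresh_part_borel [measurable]: "fresh_part z \<epsilon> n \<in> sets borel"
  unfolding fresh_part_def disjointed_def by (intro sets.Diff sets.finite_UN) auto

lemma fresh_part_subset: "fresh_part z \<epsilon> n \<subseteq> ball (z n) \<epsilon>"
  unfolding fresh_part_def by (rule disjointed_subset)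

lemma moment_eq_suminf:
  assumes "bounded (range z)"
  shows "moment z \<epsilon> = (\<Sum>n. LINT x:fresh_part z \<epsilon> n|lborel. x)"
proof -
  have U: "(\<Union>n. fresh_part z \<epsilon> n) = (\<Union>n. ball (z n) \<epsilon>)"
    unfolding fresh_part_def by (rule UN_disjointed_eq)
  have "set_integrable lborel (\<Union>n. ball (z n) \<epsilon>) (\<lambda>x. x)"
    by (intro set_integrable_id_bounded bounded_UN_ball assms borel_open open_UN) simp
  then show ?thesis unfolding moment_def U[symmetric]
    using disjoint_family_disjointed[of "\<lambda>n. ball (z n) \<epsilon>"]
    by (intro lebesgue_integral_countable_add) (auto simp: disjoint_family_on_def fresh_part_def[symmetric])
qed

context parabolic_sequence
begin

lemma bounded_z: "bounded (range z)"
  using z_tendsto_0 convergent_imp_bounded by blast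

lemma eventually_fresh_part_eq_ball:
  "\<exists>\<epsilon>\<^sub>0>0. \<forall>\<epsilon>. \<epsilon> < \<epsilon>\<^sub>0 \<longrightarrow> fresh_part z \<epsilon> n = ball (z n) \<epsilon>"
proof -
  have "\<exists>e>0. \<forall>m\<in>{0..<n}. e \<le> dist (z m) (z n)"
  proof (cases "n = 0")
    case False
    define e where "e = Min ((\<lambda>m. dist (z m) (z n)) ` {0..<n})"
    have "e > 0" unfolding e_def using False inj by (auto simp: Min_gr_iff inj_eq)
    moreover have "\<forall>m\<in>{0..<n}. e \<le> dist (z m) (z n)" unfolding e_def by auto
    ultimately show ?thesis by blast
  qed (auto intro: exI[of _ 1])
  then obtain e where e: "e > 0" "\<And>m. m \<in> {0..<n} \<Longrightarrow> e \<le> dist (z m) (z n)" by blast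
  have "fresh_part z \<epsilon> n = ball (z n) \<epsilon>" if "\<epsilon> < e / 2" for \<epsilon>
  proof -
    have "ball (z m) \<epsilon> \<inter> ball (z n) \<epsilon> = {}" if "m \<in> {0..<n}" for m
      using e(2)[OF that] \<open>\<epsilon> < e / 2\<close> by (intro disjoint_ballI) linarith
    then show ?thesis unfolding fresh_part_def disjointed_def by blast
  qed
  then show ?thesis using e(1) by (intro exI[of _ "e/2"]) simp
qed

lemma measure_fresh_part_Suc_eq:
  obtains \<epsilon>\<^sub>1 N where "\<epsilon>\<^sub>1 > 0" "1 \<le> N"
    "\<And>\<epsilon> n. 0 < \<epsilon> \<Longrightarrow> \<epsilon> < \<epsilon>\<^sub>1 \<Longrightarrow> N \<le> n \<Longrightarrow>
       measure lborel (fresh_part z \<epsilon> (Suc n)) = crescent \<epsilon> (z n - z (Suc n))"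
proof -
  obtain \<epsilon>\<^sub>1 N where *: "\<epsilon>\<^sub>1 > 0" "1 \<le> N"
    "\<And>\<epsilon> m n. 0 < \<epsilon> \<Longrightarrow> \<epsilon> < \<epsilon>\<^sub>1 \<Longrightarrow> N \<le> n \<Longrightarrow> m < n \<Longrightarrow> ball (z m) \<epsilon> \<inter> ball (z (Suc n)) \<epsilon> \<subseteq> ball (z n) \<epsilon>"
    by (rule balls_no_bypass) blast
  have "fresh_part z \<epsilon> (Suc n) = ball (z (Suc n)) \<epsilon> - ball (z n) \<epsilon>"
    if "0 < \<epsilon>" "\<epsilon> < \<epsilon>\<^sub>1" "N \<le> n" for \<epsilon> n
  proof -
    have "(\<Union>m\<in>{0..<Suc n}. ball (z m) \<epsilon>) = (\<Union>m<n. ball (z m) \<epsilon>) \<union> ball (z n) \<epsilon>"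
      by (auto simp: less_Suc_eq)
    then show ?thesis unfolding fresh_part_def disjointed_def using *(3)[OF that] by blast
  qed
  then have "measure lborel (fresh_part z \<epsilon> (Suc n)) = crescent \<epsilon> (z n - z (Suc n))"
    if "0 < \<epsilon>" "\<epsilon> < \<epsilon>\<^sub>1" "N \<le> n" for \<epsilon> n
    using that by (simp only: crescent_translate)
  then show ?thesis using *(1,2) that by blast
qed

section \<open>Asymptotics of the points and of their differences\<close>

lemma z_asymp:
  assumes "1 \<le> n" "8 * B \<le> n"
  shows "norm (z n + 1 / of_nat n) \<le> 2 * B / real n ^ 2" "norm (z n) \<le> 2 / n"
proof -
  note w = w_bounds(1)[OF assms]
  have n: "real n > 0" using assms by simp
  have "norm (z n) = 1 / norm (w n)" by (simp add: z_eq norm_divide)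
  also have "\<dots> \<le> 1 / (real n / 2)" using w n by (intro frac_le) auto
  finally show "norm (z n) \<le> 2 / n" by simp
  have "- 1 / x + 1 / m = (x - m) / (m * x)" if "x \<noteq> 0" "m \<noteq> 0" for x m :: complex
    using that by (simp add: field_simps)
  moreover have "of_nat n \<noteq> (0 :: complex)" using n by simp
  ultimately have "- 1 / w n + 1 / of_nat n = (w n - of_nat n) / (of_nat n * w n)"
    using w_nonzero[of n] by blast
  then have "z n + 1 / of_nat n = (w n - of_nat n) / (of_nat n * w n)" by (simp only: z_eq)
  then have "norm (z n + 1 / of_nat n) = norm (w n - of_nat n) / (n * norm (w n))"
    by (simp add: norm_divide norm_mult)
  also have "\<dots> \<le> B / (n * (n / 2))"
    using w_near[OF assms(1)] w n B_nonneg by (intro frac_le mult_mono mult_pos_pos) auto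
  also have "\<dots> = 2 * B / real n ^ 2" by (simp add: power2_eq_square)
  finally show "norm (z n + 1 / of_nat n) \<le> 2 * B / real n ^ 2" .
qed

definition V :: real where "V = 8 * ((2 * B + 1 + B * (B + 1)) + 4 * C)"

lemma V_nonneg: "0 \<le> V" using B_nonneg C_nonneg by (simp add: V_def)

lemma z_step_asymp:
  assumes n: "1 \<le> n" "8 * B \<le> n"
  shows "norm (z n - z (Suc n) + 1 / of_nat (Suc n) ^ 2) \<le> V / real (Suc n) ^ 3"
proof -
  define N where "N = Suc n"
  define p where "p = w (Suc n) - w n"
  define b b' where "b = w (Suc n) - of_nat N" and "b' = w n - of_nat N"
  have N: "real N > 0" "real N \<ge> 1" "real N \<le> 2 * n" using n by (auto simp: N_def)
  have b: "norm b \<le> B" using w_near[of "Suc n"] by (simp add: b_def N_def)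
  have "b' = (w n - of_nat n) - 1" by (simp add: b'_def N_def)
  then have b': "norm b' \<le> B + 1" using w_near[OF n(1)] norm_triangle_ineq4[of "w n - of_nat n" 1] by simp
  have wlow: "N / 4 \<le> norm (w n)" "N / 2 \<le> norm (w (Suc n))"
    using w_bounds(1)[OF n] w_bounds(1)[of "Suc n"] n N by (auto simp: N_def)
  have p1: "norm ((p - 1) * of_nat N ^ 2) \<le> 4 * C"
  proof -
    have "norm ((p - 1) * of_nat N ^ 2) = norm (p - 1) * real N ^ 2" by (simp add: norm_mult norm_power)
    also have "\<dots> \<le> (C / real n ^ 2) * (2 * real n) ^ 2"
      using w_step[OF n(1)] N C_nonneg unfolding p_def by (intro mult_mono power_mono) auto
    also have "\<dots> = 4 * C" using n by (simp add: power2_eq_square)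
    finally show ?thesis .
  qed
  have prod: "norm (w n * w (Suc n) - of_nat N ^ 2) \<le> (2 * B + 1 + B * (B + 1)) * N"
  proof -
    have "w n * w (Suc n) - of_nat N ^ 2 = of_nat N * b + of_nat N * b' + b * b'"
      by (simp add: b_def b'_def algebra_simps power2_eq_square)
    also have "norm \<dots> \<le> real N * B + real N * (B + 1) + B * (B + 1)"
      using b b' B_nonneg by (intro norm_triangle_le add_mono) (simp_all add: norm_mult mult_mono)
    also have "B * (B + 1) \<le> B * (B + 1) * N" using B_nonneg N mult_left_mono[of 1 "real N" "B * (B + 1)"] by simp
    finally show ?thesis by (simp add: algebra_simps)
  qed
  have "z n - z (Suc n) + 1 / of_nat (Suc n) ^ 2 =
      (w n * w (Suc n) - of_nat N ^ 2 - (p - 1) * of_nat N ^ 2) / (of_nat N ^ 2 * (w n * w (Suc n)))"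
  proof -
    have "(x - y) / (x * y) + 1 / m ^ 2 = (x * y - m ^ 2 - (y - x - 1) * m ^ 2) / (m ^ 2 * (x * y))"
      if "x \<noteq> 0" "y \<noteq> 0" "m \<noteq> 0" for x y m :: complex
    proof -
      have "(x - y) / (x * y) = ((x - y) * m ^ 2) / (m ^ 2 * (x * y))"
        and "1 / m ^ 2 = (x * y) / (m ^ 2 * (x * y))" using that by simp_all
      then have "(x - y) / (x * y) + 1 / m ^ 2 = ((x - y) * m ^ 2 + x * y) / (m ^ 2 * (x * y))"
        by (simp only: add_divide_distrib)
      also have "(x - y) * m ^ 2 + x * y = x * y - m ^ 2 - (y - x - 1) * m ^ 2" by (simp add: algebra_simps)
      finally show ?thesis .
    qed
    from this[OF w_nonzero w_nonzero, of "of_nat N" n "Suc n"] N show ?thesis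
      unfolding z_diff p_def N_def by (simp del: of_nat_Suc)
  qed
  then have "norm (z n - z (Suc n) + 1 / of_nat (Suc n) ^ 2) =
      norm (w n * w (Suc n) - of_nat N ^ 2 - (p - 1) * of_nat N ^ 2) / (real N ^ 2 * (norm (w n) * norm (w (Suc n))))"
    by (simp only: norm_divide norm_mult norm_power norm_of_nat)
  also have "\<dots> \<le> ((2 * B + 1 + B * (B + 1)) * N + 4 * C * N) / (real N ^ 2 * (N / 4 * (N / 2)))"
  proof (rule frac_le)
    have "4 * C \<le> 4 * C * N" using N C_nonneg mult_left_mono[of 1 "real N" C] by simp
    then show "norm (w n * w (Suc n) - of_nat N ^ 2 - (p - 1) * of_nat N ^ 2) \<le> (2 * B + 1 + B * (B + 1)) * N + 4 * C * N"
      using prod p1 norm_triangle_ineq4[of "w n * w (Suc n) - of_nat N ^ 2" "(p - 1) * of_nat N ^ 2"] by linarith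
    show "real N ^ 2 * (N / 4 * (N / 2)) \<le> real N ^ 2 * (norm (w n) * norm (w (Suc n)))"
      using wlow N by (intro mult_left_mono mult_mono) auto
  qed (use N B_nonneg C_nonneg in auto)
  also have "\<dots> = V / real N ^ 3"
  proof -
    have "(a * x + c * x) / (x ^ 2 * (x / 4 * (x / 2))) = 8 * (a + c) / x ^ 3" if "x \<noteq> 0" for a c x :: real
      using that by (simp add: field_simps power2_eq_square power3_eq_cube)
    moreover have "real N \<noteq> 0" using N by simp
    ultimately show ?thesis unfolding V_def by blast
  qed
  finally show ?thesis by (simp add: N_def)
qed

text \<open>The contribution of the n-th disc, divided by the squared radius. Up to k the exact
  \<open>z n\<close> is kept, because its partial sums carry the constant c. Beyond k the orbit is
  replaced by -1/n with steps 1/n^2, and 1/n^2 divided by twice the diameter of a disc...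
  equivalently by 1/k^2, is (k/n)^2.\<close>

definition model :: "nat \<Rightarrow> nat \<Rightarrow> complex" where
  "model k n = (if n \<le> k then of_real pi * z n else - of_real (chord_height ((real k / real n)^2) / real n))"

definition eps :: "nat \<Rightarrow> real" where "eps k = 1 / (2 * real k ^ 2)"

definition scaled :: "nat \<Rightarrow> nat \<Rightarrow> complex" where
  "scaled k n = (LINT x:fresh_part z (eps k) n|lborel. x) / of_real (eps k ^ 2)"

lemma eps_pos: "k \<ge> 1 \<Longrightarrow> eps k > 0" by (simp add: eps_def)

lemma eps_tendsto_0: "eps \<longlonglongrightarrow> 0"
proof -
  have "(\<lambda>k. (1 / 2) * (1 / real k) ^ 2) \<longlonglongrightarrow> (1 / 2) * 0 ^ 2"
    by (intro tendsto_intros lim_const_over_n)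
  then show ?thesis by (simp add: eps_def[abs_def] power_divide)
qed

lemma scaled_near:
  assumes k: "k \<ge> 1"
  shows "norm (scaled k n - z n * of_real (measure lborel (fresh_part z (eps k) n) / eps k ^ 2))
    \<le> measure lborel (fresh_part z (eps k) n) / eps k"
proof -
  let ?D = "fresh_part z (eps k) n"
  have e: "eps k > 0" by (rule eps_pos[OF k])
  have "scaled k n - z n * of_real (measure lborel ?D / eps k ^ 2) =
      ((LINT x:?D|lborel. x) - z n * of_real (measure lborel ?D)) / of_real (eps k ^ 2)"
    unfolding scaled_def by (simp add: diff_divide_distrib)
  then have "norm (scaled k n - z n * of_real (measure lborel ?D / eps k ^ 2)) =
      norm ((LINT x:?D|lborel. x) - z n * of_real (measure lborel ?D)) / eps k ^ 2"
    by (simp add: norm_divide norm_power)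
  also have "\<dots> \<le> eps k * measure lborel ?D / eps k ^ 2"
    by (intro divide_right_mono norm_set_integral_diff_le fresh_part_borel fresh_part_subset) (use e in auto)
  also have "\<dots> = measure lborel ?D / eps k" using e by (simp add: power2_eq_square)
  finally show ?thesis .
qed

text \<open>For fixed n the index k eventually exceeds n and the disc is free of all earlier ones;
  only the error of replacing its moment by centre times area is left.\<close>

lemma scaled_minus_model_tendsto_0: "(\<lambda>k. scaled k n - model k n) \<longlonglongrightarrow> 0"
proof (rule Lim_null_comparison)
  obtain \<epsilon>\<^sub>0 where e0: "\<epsilon>\<^sub>0 > 0" "\<And>\<epsilon>. \<epsilon> < \<epsilon>\<^sub>0 \<Longrightarrow> fresh_part z \<epsilon> n = ball (z n) \<epsilon>"
    using eventually_fresh_part_eq_ball by blast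
  show "\<forall>\<^sub>F k in sequentially. norm (scaled k n - model k n) \<le> pi * eps k"
    using eventually_ge_at_top[of "max 1 n"] order_tendstoD(2)[OF eps_tendsto_0 e0(1)]
  proof eventually_elim
    case (elim k)
    then have e: "eps k > 0" by (intro eps_pos) auto
    have "measure lborel (fresh_part z (eps k) n) = pi * eps k ^ 2"
      using e0(2)[OF elim(2)] e by (simp add: measure_complex_ball)
    then have "norm (scaled k n - z n * of_real (pi * eps k ^ 2 / eps k ^ 2)) \<le> pi * eps k ^ 2 / eps k"
      using scaled_near[of k n] elim(1) by simp
    moreover have "pi * eps k ^ 2 / eps k ^ 2 = pi" "pi * eps k ^ 2 / eps k = pi * eps k"
      using e by (simp_all add: power2_eq_square)
    ultimately show ?case using elim(1) unfolding model_def by (simp only:) (simp add: mult.commute)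
  qed
  show "(\<lambda>k. pi * eps k) \<longlonglongrightarrow> 0" using tendsto_mult_right_zero[OF eps_tendsto_0] .
qed

lemma chord_height_model:
  assumes "1 \<le> k" "k \<le> n"
  shows "chord_height ((real k / real n)^2) = crescent (eps k) (- 1 / of_nat n ^ 2) / eps k ^ 2"
proof -
  define d where "d = 1 / real n ^ 2"
  have "real k ^ 2 \<le> real n ^ 2" using assms by (intro power_mono) auto
  then have d: "0 < d" "d \<le> 2 * eps k" using assms by (auto simp: d_def eps_def field_simps)
  have "d / (2 * eps k) = (real k / real n)^2" using assms by (simp add: d_def eps_def field_simps)
  then have "crescent (eps k) (of_real (-d)) = eps k ^ 2 * chord_height ((real k / real n)^2)"
    using crescent_real[OF eps_pos[OF assms(1)] d] by simp
  moreover have "of_real (-d) = (- 1 / of_nat n ^ 2 :: complex)" by (simp add: d_def)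
  ultimately show ?thesis using eps_pos[OF assms(1)] by simp
qed

text \<open>The domination for Tannery's theorem: the bound must not depend on k, although the
  regimes of the n-th disc do. For 2 n \<le> k the true discs are apart, for n \<le> k < 2 n only
  the model discs are known to be, and for n > k the model uses a crescent.\<close>

lemma scaled_minus_model_bound:
  obtains c k0 n0 where "\<And>k n. k0 \<le> k \<Longrightarrow> n0 \<le> n \<Longrightarrow> norm (scaled k n - model k n) \<le> c * (1 / real n ^ 2)"
proof -
  obtain \<epsilon>\<^sub>1 N where eN: "\<epsilon>\<^sub>1 > 0" "1 \<le> N"
    "\<And>\<epsilon> n. 0 < \<epsilon> \<Longrightarrow> \<epsilon> < \<epsilon>\<^sub>1 \<Longrightarrow> N \<le> n \<Longrightarrow>
       measure lborel (fresh_part z \<epsilon> (Suc n)) = crescent \<epsilon> (z n - z (Suc n))"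
    by (rule measure_fresh_part_Suc_eq) blast
  have "\<forall>\<^sub>F k in sequentially. eps k < \<epsilon>\<^sub>1" by (rule order_tendstoD(2)[OF eps_tendsto_0 eN(1)])
  then obtain k1 where k1: "\<And>k. k1 \<le> k \<Longrightarrow> eps k < \<epsilon>\<^sub>1" unfolding eventually_sequentially by blast
  obtain N2 :: nat where N2: "max (8 * B) (2 * V) \<le> N2" using real_arch_simple by blast
  \<comment> \<open>The summands pay for replacing a moment by centre times area, the true step by
    -1/n^2, and the centre by -1/n.\<close>
  define c where "c = 3 * pi * (1 + V) + 48 * pi * V + pi * (2 * B)"
  have "norm (scaled k n - model k n) \<le> c * (1 / real n ^ 2)"
    if k: "max 1 k1 \<le> k" and n: "Suc (max N N2) \<le> n" for k n
  proof -
    obtain j where j: "n = Suc j" "N \<le> j" "N2 \<le> j" using n by (cases n) auto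
    have j1: "1 \<le> j" "8 * B \<le> j" "8 * B \<le> real n" "2 * V \<le> real n" "1 \<le> n" using j eN(2) N2 by auto
    have n0: "real n > 0" using j by simp
    define v where "v = z j - z n"
    define \<epsilon> where "\<epsilon> = eps k"
    have e: "\<epsilon> > 0" "\<epsilon> < \<epsilon>\<^sub>1" using k k1 eps_pos[of k] by (auto simp: \<epsilon>_def)
    have inv_e: "1 / \<epsilon> = 2 * real k ^ 2" by (simp add: \<epsilon>_def eps_def)
    have ms: "measure lborel (fresh_part z (eps k) n) = crescent \<epsilon> v"
      using eN(3)[OF e, of j] j by (simp add: \<epsilon>_def v_def)
    have v_step: "norm (v - (- 1 / of_nat n ^ 2)) \<le> V / real n ^ 3"
      using z_step_asymp[OF j1(1,2)] unfolding v_def j(1) by simp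
    have v3: "V / real n ^ 3 \<le> V / real n ^ 2"
      using V_nonneg n0 j1(5) by (intro divide_left_mono power_increasing) auto
    have nv: "norm (- 1 / of_nat n ^ 2 :: complex) = 1 / real n ^ 2" by (simp add: norm_divide norm_power)
    have v_le: "norm v \<le> (1 + V) * (1 / real n ^ 2)"
    proof -
      have "norm v \<le> norm (v - (- 1 / of_nat n ^ 2)) + norm (- 1 / of_nat n ^ 2 :: complex)"
        using norm_triangle_ineq[of "v - (- 1 / of_nat n ^ 2)" "- 1 / of_nat n ^ 2"] by simp
      also have "\<dots> \<le> V / real n ^ 2 + 1 / real n ^ 2" unfolding nv using v_step v3 by simp
      finally show ?thesis by (simp add: algebra_simps add_divide_distrib)
    qed
    define T where "T = z n * of_real (crescent \<epsilon> v / \<epsilon> ^ 2)"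
    have 1: "norm (scaled k n - T) \<le> 3 * pi * (1 + V) * (1 / real n ^ 2)"
    proof -
      have "norm (scaled k n - T) \<le> crescent \<epsilon> v / \<epsilon>"
        using scaled_near[of k n] k unfolding ms T_def \<epsilon>_def by simp
      also have "\<dots> \<le> (3 * pi * \<epsilon> * norm v) / \<epsilon>" using e by (intro divide_right_mono crescent_le) auto
      also have "\<dots> = 3 * pi * norm v" using e by simp
      also have "\<dots> \<le> 3 * pi * ((1 + V) * (1 / real n ^ 2))" using v_le by (intro mult_left_mono) auto
      finally show ?thesis by (simp only: mult.assoc)
    qed
    \<comment> \<open>After division by the squared radius the Lipschitz bound for crescents is of
      order k^2/n^4, which is O(1/n^2) only while k < 2 n. For larger k the discs are already
      separated, and \<open>T\<close> equals the model exactly.\<close>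
    have 2: "norm (T - model k n) \<le> (48 * pi * V + pi * (2 * B)) * (1 / real n ^ 2)"
    proof (cases "2 * n \<le> k")
      case True
      have "(2 * real n) ^ 2 \<le> real k ^ 2" using True by (intro power_mono) (simp_all flip: of_nat_mult)
      then have "4 * real n ^ 2 \<le> 1 / \<epsilon> / 2" unfolding inv_e by (simp add: power_mult_distrib)
      then have "2 * \<epsilon> \<le> 1 / (2 * real n ^ 2) * (1/2)" using e n0 by (simp add: field_simps)
      then have "2 * \<epsilon> \<le> 1 / (2 * real n ^ 2)" using n0 by (simp add: field_simps)
      also have "\<dots> \<le> 1 / real n ^ 2 - V / real n ^ 3"
      proof -
        have "V / real n ^ 3 = (V / real n) * (1 / real n ^ 2)" by (simp add: power2_eq_square power3_eq_cube)
        also have "\<dots> \<le> 1 / 2 * (1 / real n ^ 2)" using j1(4) n0 by (intro mult_right_mono) (auto simp: field_simps)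
        finally have "V / real n ^ 3 \<le> 1 / 2 * (1 / real n ^ 2)" .
        moreover have "1 / (2 * real n ^ 2) = 1 / 2 * (1 / real n ^ 2)" by simp
        ultimately show ?thesis by linarith
      qed
      also have "\<dots> \<le> norm v"
        using v_step norm_triangle_ineq2[of "- 1 / of_nat n ^ 2" v] unfolding nv by (simp add: norm_minus_commute)
      finally have "crescent \<epsilon> v = pi * \<epsilon> ^ 2" using e by (intro crescent_far) auto
      then have "T = model k n" using True e unfolding T_def model_def by simp
      then show ?thesis using V_nonneg B_nonneg by simp
    next
      case False
      define T' where "T' = z n * of_real (crescent \<epsilon> (- 1 / of_nat n ^ 2) / \<epsilon> ^ 2)"
      have zn: "norm (z n) \<le> 2 / n" "norm (z n + 1 / of_nat n) \<le> 2 * B / real n ^ 2"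
        using z_asymp j1 by auto
      have "T - T' = z n * of_real ((crescent \<epsilon> v - crescent \<epsilon> (- 1 / of_nat n ^ 2)) / \<epsilon> ^ 2)"
        unfolding T_def T'_def by (simp add: algebra_simps diff_divide_distrib)
      then have "norm (T - T') = norm (z n) * (\<bar>crescent \<epsilon> v - crescent \<epsilon> (- 1 / of_nat n ^ 2)\<bar> / \<epsilon> ^ 2)"
        by (simp only: norm_mult norm_of_real abs_divide abs_power2)
      also have "\<dots> \<le> (2 / n) * ((3 * pi * \<epsilon> * (V / real n ^ 3)) / \<epsilon> ^ 2)"
      proof (intro mult_mono divide_right_mono)
        have "\<bar>crescent \<epsilon> v - crescent \<epsilon> (- 1 / of_nat n ^ 2)\<bar> \<le> 3 * pi * \<epsilon> * norm (v - (- 1 / of_nat n ^ 2))"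
          by (rule crescent_diff_le[OF e(1)])
        also have "\<dots> \<le> 3 * pi * \<epsilon> * (V / real n ^ 3)" using e v_step by (intro mult_left_mono) auto
        finally show "\<bar>crescent \<epsilon> v - crescent \<epsilon> (- 1 / of_nat n ^ 2)\<bar> \<le> 3 * pi * \<epsilon> * (V / real n ^ 3)" .
      qed (use zn in auto)
      also have "\<dots> = 6 * pi * V * (1 / \<epsilon>) * (1 / real n ^ 4)"
        using e n0 by (simp add: power2_eq_square power3_eq_cube power4_eq_xxxx mult_ac)
      also have "\<dots> \<le> 6 * pi * V * (8 * real n ^ 2) * (1 / real n ^ 4)"
      proof (intro mult_right_mono mult_left_mono)
        have "real k ^ 2 \<le> (2 * real n) ^ 2" using False by (intro power_mono) (simp_all flip: of_nat_mult)
        then show "1 / \<epsilon> \<le> 8 * real n ^ 2" unfolding inv_e by (simp add: power_mult_distrib)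
      qed (use V_nonneg in auto)
      also have "\<dots> = 48 * pi * V * (1 / real n ^ 2)"
        using n0 by (simp add: power2_eq_square power4_eq_xxxx)
      finally have A: "norm (T - T') \<le> 48 * pi * V * (1 / real n ^ 2)" .
      have B: "norm (T' - model k n) \<le> pi * (2 * B) * (1 / real n ^ 2)"
      proof (cases "n \<le> k")
        case True
        have "real n ^ 2 \<le> real k ^ 2" using True by (intro power_mono) auto
        then have "2 * \<epsilon> \<le> 1 / real n ^ 2" using n0 k by (simp add: \<epsilon>_def eps_def frac_le)
        then have "crescent \<epsilon> (- 1 / of_nat n ^ 2) = pi * \<epsilon> ^ 2"
          by (intro crescent_far less_imp_le[OF e(1)]) (simp only: nv)
        then have "T' = model k n" using True e unfolding T'_def model_def by simp
        then show ?thesis using B_nonneg by simp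
      next
        case False
        define h where "h = crescent \<epsilon> (- 1 / of_nat n ^ 2) / \<epsilon> ^ 2"
        have h: "0 \<le> h" "h \<le> pi" using crescent_nonneg crescent_le(2)[OF e(1)] e by (auto simp: h_def field_simps)
        have "chord_height ((real k / real n)^2) = h"
          using chord_height_model[of k n] k False unfolding h_def \<epsilon>_def by simp
        then have "T' - model k n = (z n + 1 / of_nat n) * of_real h"
          using False unfolding T'_def model_def h_def[symmetric] by (simp add: algebra_simps)
        then have "norm (T' - model k n) = norm (z n + 1 / of_nat n) * h" using h by (simp add: norm_mult)
        also have "\<dots> \<le> (2 * B / real n ^ 2) * pi" using zn(2) h B_nonneg by (intro mult_mono) auto
        finally show ?thesis by (simp add: mult_ac)
      qed
      have "norm (T - model k n) \<le> norm (T - T') + norm (T' - model k n)"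
        using norm_triangle_ineq[of "T - T'" "T' - model k n"] by simp
      also have "\<dots> \<le> 48 * pi * V * (1 / real n ^ 2) + pi * (2 * B) * (1 / real n ^ 2)" using A B by (rule add_mono)
      finally show ?thesis by (simp only: distrib_right)
    qed
    have "norm (scaled k n - model k n) \<le> norm (scaled k n - T) + norm (T - model k n)"
      using norm_triangle_ineq[of "scaled k n - T" "T - model k n"] by simp
    also have "\<dots> \<le> 3 * pi * (1 + V) * (1 / real n ^ 2) + (48 * pi * V + pi * (2 * B)) * (1 / real n ^ 2)"
      using 1 2 by (rule add_mono)
    also have "\<dots> = c * (1 / real n ^ 2)" unfolding c_def distrib_right[symmetric] by simp
    finally show ?thesis .
  qed
  then show ?thesis using that by blast
qed

lemma model_sums:
  assumes k: "0 < k"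
  shows "model k sums (of_real pi * (\<Sum>n\<le>k. z n) -
    of_real (\<Sum>j. chord_height ((real k / real (k + 1 + j))^2) / real (k + 1 + j)))"
proof -
  let ?t = "\<lambda>j. chord_height ((real k / real (k + 1 + j))^2) / real (k + 1 + j)"
  have "(\<lambda>j. - of_real (?t j) :: complex) sums (- of_real (suminf ?t))"
    by (intro sums_minus sums_of_real summable_sums chord_height_tail(1) k)
  moreover have "model k (j + Suc k) = - of_real (?t j)" for j by (simp add: model_def add.commute add.left_commute)
  ultimately have "(\<lambda>j. model k (j + Suc k)) sums (- of_real (suminf ?t))" by simp
  then have "model k sums (- of_real (suminf ?t) + (\<Sum>n<Suc k. model k n))" by (simp only: sums_iff_shift)
  moreover have "(\<Sum>n<Suc k. model k n) = of_real pi * (\<Sum>n\<le>k. z n)"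
    unfolding lessThan_Suc_atMost sum_distrib_left by (intro sum.cong) (auto simp: model_def)
  ultimately show ?thesis by (simp add: add.commute)
qed

text \<open>The discrepancy between true and model contributions tends to 0 termwise under a
  summable bound, so its sum vanishes in the limit. What remains is the exact sum of the model, a
  partial sum of the orbit minus the Riemann sum of the crescents.\<close>

lemma moment_limit:
  assumes c: "(\<lambda>k. (\<Sum>n\<le>k. z n) + of_real (ln (real k))) \<longlonglongrightarrow> c"
  shows "(\<lambda>k. moment z (eps k) / of_real (eps k ^ 2) + of_real (pi * ln (real k)))
    \<longlonglongrightarrow> of_real pi * c - of_real (pi / 2 * ln 2 + pi / 4)"
proof -
  obtain b k0 n0 where b: "\<And>k n. k0 \<le> k \<Longrightarrow> n0 \<le> n \<Longrightarrow> norm (scaled k n - model k n) \<le> b * (1 / real n ^ 2)"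
    using scaled_minus_model_bound by metis
  have "eventually (\<lambda>(n, k). norm (scaled k n - model k n) \<le> b * (1 / real n ^ 2)) (at_top \<times>\<^sub>F sequentially)"
    unfolding eventually_prod_filter
    by (intro exI[of _ "\<lambda>n. n0 \<le> n"] exI[of _ "\<lambda>k. k0 \<le> k"]) (use b eventually_ge_at_top in auto)
  then have T: "\<forall>\<^sub>F k in sequentially. summable (\<lambda>n. norm (scaled k n - model k n))"
      "(\<lambda>k. \<Sum>n. scaled k n - model k n) \<longlonglongrightarrow> (\<Sum>n. 0)"
    using tannerys_theorem[of "\<lambda>n k. scaled k n - model k n" "\<lambda>_. 0" sequentially "\<lambda>n. b * (1 / real n ^ 2)"]
      scaled_minus_model_tendsto_0 summable_mult[OF inverse_power_summable[of 2, where 'a = real]]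
    by (auto simp: inverse_eq_divide)
  define t where "t k = (\<Sum>j. chord_height ((real k / real (k + 1 + j))^2) / real (k + 1 + j))" for k
  have "(\<lambda>k. (\<Sum>n. scaled k n - model k n) + (of_real pi * ((\<Sum>n\<le>k. z n) + of_real (ln (real k))) - of_real (t k)))
      \<longlonglongrightarrow> 0 + (of_real pi * c - of_real (pi / 2 * ln 2 + pi / 4))"
    using T(2) c chord_height_tail_limit unfolding t_def by (intro tendsto_intros) simp_all
  moreover have "\<forall>\<^sub>F k in sequentially. (\<Sum>n. scaled k n - model k n) +
      (of_real pi * ((\<Sum>n\<le>k. z n) + of_real (ln (real k))) - of_real (t k)) =
      moment z (eps k) / of_real (eps k ^ 2) + of_real (pi * ln (real k))"
    using T(1) eventually_gt_at_top[of 0]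
  proof eventually_elim
    case (elim k)
    have m: "model k sums (of_real pi * (\<Sum>n\<le>k. z n) - of_real (t k))"
      using model_sums[OF elim(2)] unfolding t_def .
    have "(\<lambda>n. (scaled k n - model k n) + model k n) sums
        ((\<Sum>n. scaled k n - model k n) + (of_real pi * (\<Sum>n\<le>k. z n) - of_real (t k)))"
      by (rule sums_add[OF summable_sums[OF summable_norm_cancel[OF elim(1)]] m])
    then have s: "scaled k sums ((\<Sum>n. scaled k n - model k n) + (of_real pi * (\<Sum>n\<le>k. z n) - of_real (t k)))"
      by simp
    have e: "eps k ^ 2 \<noteq> 0" using eps_pos[of k] elim by simp
    have "(\<lambda>n. scaled k n * of_real (eps k ^ 2)) sums
       (((\<Sum>n. scaled k n - model k n) + (of_real pi * (\<Sum>n\<le>k. z n) - of_real (t k))) * of_real (eps k ^ 2))"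
      using s by (rule sums_mult2)
    moreover have "scaled k n * of_real (eps k ^ 2) = (LINT x:fresh_part z (eps k) n|lborel. x)" for n
      using e by (simp add: scaled_def)
    ultimately have "moment z (eps k) =
       ((\<Sum>n. scaled k n - model k n) + (of_real pi * (\<Sum>n\<le>k. z n) - of_real (t k))) * of_real (eps k ^ 2)"
      unfolding moment_eq_suminf[OF bounded_z] by (simp add: sums_iff)
    then have "moment z (eps k) / of_real (eps k ^ 2) =
       (\<Sum>n. scaled k n - model k n) + (of_real pi * (\<Sum>n\<le>k. z n) - of_real (t k))"
      using e by simp
    then show ?case by (simp only:) (simp add: algebra_simps)
  qed
  ultimately show ?thesis using Lim_transform_eventually by fastforce
qed

lemma sum_plus_ln_convergent: "\<exists>c. (\<lambda>k. (\<Sum>n\<le>k. z n) + of_real (ln (real k))) \<longlonglongrightarrow> c"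
proof -
  obtain N :: nat where N: "max 1 (8 * B) \<le> N" using real_arch_simple by blast
  have "norm (z n + 1 / of_nat n) \<le> 2 * B * (1 / real n ^ 2)" if "N \<le> n" for n
    using z_asymp(1)[of n] that N by simp
  moreover have "summable (\<lambda>n. 2 * B * (1 / real n ^ 2))"
    using summable_mult[OF inverse_power_summable[of 2, where 'a = real]] by (simp add: inverse_eq_divide)
  ultimately have "summable (\<lambda>n. z n + 1 / of_nat n)" by (rule summable_comparison_test'[rotated])
  then obtain s where "(\<lambda>k. \<Sum>n\<le>k. z n + 1 / of_nat n) \<longlonglongrightarrow> s"
    using summable_LIMSEQ' by blast
  then have "(\<lambda>k. (\<Sum>n\<le>k. z n + 1 / of_nat n) - of_real (harm k - ln (real k))) \<longlonglongrightarrow> s - of_real euler_mascheroni"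
    using euler_mascheroni_LIMSEQ by (intro tendsto_intros) auto
  moreover have eq: "(\<Sum>n\<le>k. z n + 1 / of_nat n) - of_real (harm k - ln (real k)) = (\<Sum>n\<le>k. z n) + of_real (ln (real k))" for k
  proof -
    \<comment> \<open>The summand at n = 0 may be dropped because 1 / 0 = 0.\<close>
    have "(\<Sum>n\<le>k. 1 / of_nat n :: complex) = (\<Sum>n=1..k. 1 / of_nat n)"
      by (rule sum.mono_neutral_right) auto
    also have "\<dots> = of_real (harm k)" by (simp add: harm_def divide_inverse)
    finally show ?thesis by (simp add: sum.distrib)
  qed
  ultimately show ?thesis unfolding eq by blast
qed

end

section \<open>Principal parts on a petal\<close>

text \<open>In the coordinate \<open>-1/z\<close> the germ is \<open>w \<mapsto> w + 1 + O(1/w\<^sup>2)\<close>.\<close>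
definition near_translation :: "(complex \<Rightarrow> complex) \<Rightarrow> bool" where
  "near_translation h \<longleftrightarrow> (\<exists>C. \<forall>\<^sub>F z in at 0. norm (- 1 / h z - (- 1 / z) - 1) \<le> C * norm z ^ 2)"

text \<open>A petal omits 0, the endpoint t = 0 of its excluded ray. A repeated value would make the
  orbit periodic from there on, and a periodic orbit converging to 0 would contain 0.\<close>

lemma petal_orbit:
  assumes "petal h d V" "z \<in> V"
  shows "(h ^^ n) z \<in> V" "(h ^^ n) z \<noteq> 0" "inj (\<lambda>n. (h ^^ n) z)"
proof -
  have inv: "h ` V \<subseteq> V" and lim: "\<And>z. z \<in> V \<Longrightarrow> (\<lambda>n. (h ^^ n) z) \<longlonglongrightarrow> 0"
    and ray: "\<And>t. t \<ge> 0 \<Longrightarrow> - complex_of_real t * d \<notin> V" using assms(1) by (auto simp: petal_def)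
  have zero: "0 \<notin> V" using ray[of 0] by simp
  show mem: "(h ^^ n) z \<in> V" for n using assms(2) inv by (induction n) auto
  then show "(h ^^ n) z \<noteq> 0" using zero by metis
  show "inj (\<lambda>n. (h ^^ n) z)"
  proof (rule linorder_injI)
    fix m n :: nat assume "m < n"
    define p where "p = n - m"
    define y where "y = (h ^^ m) z"
    have n: "n = p + m" "p > 0" using \<open>m < n\<close> by (auto simp: p_def)
    show "(h ^^ m) z \<noteq> (h ^^ n) z"
    proof
      assume "(h ^^ m) z = (h ^^ n) z"
      then have "(h ^^ p) y = y" unfolding n(1) funpow_add y_def by simp
      then have "(h ^^ (k * p)) y = y" for k by (induction k) (simp_all add: funpow_add)
      moreover have "(\<lambda>k. (h ^^ (k * p)) y) \<longlonglongrightarrow> 0"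
        by (rule LIMSEQ_subseq_LIMSEQ[OF lim, unfolded o_def])
          (use mem n(2) in \<open>auto simp: y_def strict_mono_def\<close>)
      ultimately have "y = 0" by (simp add: LIMSEQ_const_iff)
      then show False using mem[of m] zero by (simp add: y_def)
    qed
  qed
qed

text \<open>Convergence to 0 alone gives no rate. Once the steps of -1/z are within 1/2 of 1, its
  real part grows by at least 1/2 each time, so the orbit is at most 4/n in norm; this turns an
  error O(|z|^2) into O(1/n^2).\<close>

lemma petal_orbit_parabolic_sequence:
  assumes h: "near_translation h" and V: "petal h d V" "z \<in> V"
  shows "\<exists>C. parabolic_sequence (\<lambda>n. (h ^^ n) z) C"
proof -
  define x where "x n = (h ^^ n) z" for n
  define \<omega> where "\<omega> n = - 1 / x n" for n
  have x: "x n \<noteq> 0" "inj x" "x (Suc n) = h (x n)" for n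
    using petal_orbit[OF V] by (auto simp: x_def[abs_def])
  have lim: "x \<longlonglongrightarrow> 0" using V unfolding petal_def x_def by blast
  obtain C where "\<forall>\<^sub>F z in at 0. norm (- 1 / h z - (- 1 / z) - 1) \<le> C * norm z ^ 2"
    using h unfolding near_translation_def by blast
  moreover have "filterlim x (at 0) sequentially" using lim x by (simp add: filterlim_at)
  ultimately have "\<forall>\<^sub>F n in sequentially. norm (- 1 / h (x n) - (- 1 / x n) - 1) \<le> C * norm (x n) ^ 2"
    by (rule eventually_compose_filterlim)
  moreover have "(\<lambda>n. C * norm (x n) ^ 2) \<longlonglongrightarrow> C * norm (0::complex) ^ 2" using lim by (intro tendsto_intros)
  then have "\<forall>\<^sub>F n in sequentially. C * norm (x n) ^ 2 < 1/2"
    by (rule order_tendstoD) simp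
  ultimately have "\<forall>\<^sub>F n in sequentially. norm (\<omega> (Suc n) - \<omega> n - 1) \<le> C * norm (x n) ^ 2 \<and> C * norm (x n) ^ 2 < 1/2"
    unfolding \<omega>_def x(3) by (rule eventually_conj)
  then obtain N where N: "\<And>n. N \<le> n \<Longrightarrow> norm (\<omega> (Suc n) - \<omega> n - 1) \<le> C * norm (x n) ^ 2"
      "\<And>n. N \<le> n \<Longrightarrow> C * norm (x n) ^ 2 < 1/2" unfolding eventually_sequentially by blast
  have grow: "Re (\<omega> N) + (real n - real N) / 2 \<le> Re (\<omega> n)" if "N \<le> n" for n
    using that
  proof (induction n rule: dec_induct)
    case (step n)
    have "\<bar>Re (\<omega> (Suc n) - \<omega> n - 1)\<bar> \<le> 1/2"
      using abs_Re_le_cmod[of "\<omega> (Suc n) - \<omega> n - 1"] N[of n] step by linarith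
    then have "Re (\<omega> n) + 1/2 \<le> Re (\<omega> (Suc n))" unfolding minus_complex.sel one_complex.sel by linarith
    then show ?case using step.IH by (simp add: field_simps)
  qed simp
  obtain N' :: nat where N': "max (real N + 1) (4 * (\<bar>Re (\<omega> N)\<bar> + real N / 2)) \<le> N'"
    using real_arch_simple by blast
  have small: "norm (x n) \<le> 4 / n" if "N' \<le> n" for n
  proof -
    have n: "real N' \<le> real n" "n > 0" using that N' by auto
    then have "N \<le> n" "4 * (\<bar>Re (\<omega> N)\<bar> + real N / 2) \<le> n" using N' by linarith+
    then have "n / 4 \<le> Re (\<omega> n)" using grow[OF \<open>N \<le> n\<close>] by argo
    also have "\<dots> \<le> norm (\<omega> n)" by (rule complex_Re_le_cmod)
    finally have "n / 4 \<le> norm (\<omega> n)" .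
    moreover have "norm (x n) = 1 / norm (\<omega> n)" using x(1)[of n] by (simp add: \<omega>_def norm_divide)
    moreover have "1 / norm (\<omega> n) \<le> 1 / (n / 4)" using calculation n by (intro frac_le) auto
    ultimately show ?thesis by simp
  qed
  define s where "s n = norm (\<omega> (Suc n) - \<omega> n - 1) * real n ^ 2" for n
  \<comment> \<open>The finite sum absorbs the steps before the estimates take hold; 16 is the
    square of the 4 in 4/n.\<close>
  define D where "D = 16 * \<bar>C\<bar> + (\<Sum>n<N'. s n)"
  have s: "0 \<le> s n" for n by (simp add: s_def)
  have le: "s n \<le> D" for n
  proof (cases "n < N'")
    case True
    then have "s n \<le> (\<Sum>n<N'. s n)" using s by (intro member_le_sum) auto
    then show ?thesis by (simp add: D_def)
  next
    case False
    then have n: "N' \<le> n" "N \<le> n" "n > 0" using N' by linarith+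
    have "s n \<le> (\<bar>C\<bar> * norm (x n) ^ 2) * real n ^ 2"
      unfolding s_def
      using order_trans[OF N(1)[OF n(2)] mult_right_mono[OF abs_ge_self[of C] zero_le_power2]]
      by (rule mult_right_mono) simp
    also have "\<dots> \<le> (\<bar>C\<bar> * (4 / n) ^ 2) * real n ^ 2"
      using small[OF n(1)] by (intro mult_right_mono mult_left_mono power_mono) auto
    also have "\<dots> = 16 * \<bar>C\<bar>" using n by (simp add: power_divide)
    also have "\<dots> \<le> D" using s by (simp add: D_def sum_nonneg)
    finally show ?thesis .
  qed
  have "parabolic_sequence x D"
  proof
    fix n :: nat assume "1 \<le> n"
    then show "norm (- 1 / x (Suc n) - (- 1 / x n) - 1) \<le> D / real n ^ 2"
      using le[of n] by (simp only: s_def \<omega>_def pos_le_divide_eq zero_less_power of_nat_0_less_iff)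
  qed (use x in auto)
  then show ?thesis unfolding x_def by blast
qed

lemma eps_neighborhood_orbit:
  "eps_neighborhood (forward_orbit h z) \<epsilon> = (\<Union>n. ball ((h ^^ n) z) \<epsilon>)"
  by (simp add: eps_neighborhood_def forward_orbit_def)

lemma directed_area_eq_moment:
  assumes "parabolic_sequence (\<lambda>n. (h ^^ n) z) C" "0 < \<epsilon>"
  shows "directed_area h z \<epsilon> = moment (\<lambda>n. (h ^^ n) z) \<epsilon>"
proof -
  interpret parabolic_sequence "\<lambda>n. (h ^^ n) z" C by fact
  let ?N = "\<Union>n. ball ((h ^^ n) z) \<epsilon>"
  have b: "bounded ?N" by (rule bounded_UN_ball[OF bounded_z])
  then have "?N \<in> fmeasurable lborel"
    using emeasure_bounded_finite[OF b] by (intro fmeasurableI) (auto intro!: borel_open)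
  moreover have "ball ((h ^^ 0) z) \<epsilon> \<subseteq> ?N" by (rule UN_upper) simp
  ultimately have "measure lborel (ball z \<epsilon>) \<le> measure lborel ?N"
    by (intro measure_mono_fmeasurable) simp_all
  then have "measure lborel ?N > 0" using assms(2) by (simp add: measure_complex_ball less_le_trans[rotated])
  then show ?thesis
    unfolding directed_area_def Let_def eps_neighborhood_orbit center_of_mass_def area_def moment_def by simp
qed

section \<open>Extraction of the coefficient of the squared radius\<close>

lemma tendsto_const_mult_ln_imp_zero:
  fixes a L :: complex
  assumes "(\<lambda>k. a * of_real (ln (real k))) \<longlonglongrightarrow> L"
  shows "a = 0"
proof (rule ccontr)
  assume "a \<noteq> 0"
  have "filterlim (\<lambda>k. norm (ln (real k))) at_top sequentially"
    using filterlim_compose[OF ln_at_top filterlim_real_sequentially]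
    by (rule filterlim_at_top_mono) (auto intro: always_eventually)
  then have "filterlim (\<lambda>k. norm a * norm (ln (real k))) at_top sequentially"
    using \<open>a \<noteq> 0\<close> by (intro filterlim_tendsto_pos_mult_at_top[OF tendsto_const]) auto
  then have "filterlim (\<lambda>k. norm (a * of_real (ln (real k)))) at_top sequentially"
    by (simp add: norm_mult)
  moreover have "(\<lambda>k. norm (a * of_real (ln (real k)))) \<longlonglongrightarrow> norm L" using assms by (rule tendsto_norm)
  ultimately show False using not_tendsto_and_filterlim_at_infinity[of sequentially]
    by (metis filterlim_at_top_imp_at_infinity sequentially_bot)
qed

lemma tendsto_plus_ln_shift:
  fixes X :: "nat \<Rightarrow> complex"
  assumes "(\<lambda>k. X k + of_real (ln (real k))) \<longlonglongrightarrow> l"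
  shows "(\<lambda>k. X (Suc k) + of_real (ln (real k))) \<longlonglongrightarrow> l"
proof -
  have "(\<lambda>k. ln (1 + 1 / real k)) \<longlonglongrightarrow> ln (1 + 0)" by (intro tendsto_intros lim_const_over_n) simp
  then have "(\<lambda>k. of_real (ln (1 + 1 / real k)) :: complex) \<longlonglongrightarrow> of_real (ln (1 + 0))" by (rule tendsto_of_real)
  from tendsto_diff[OF LIMSEQ_Suc[OF assms] this]
  have 1: "(\<lambda>k. X (Suc k) + of_real (ln (real (Suc k))) - of_real (ln (1 + 1 / real k))) \<longlonglongrightarrow> l" by simp
  have "\<forall>\<^sub>F k in sequentially. X (Suc k) + of_real (ln (real (Suc k))) - of_real (ln (1 + 1 / real k)) = X (Suc k) + of_real (ln (real k))"
    using eventually_gt_at_top[of 0]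
  proof eventually_elim
    case (elim k)
    have "1 + 1 / real k = real (Suc k) / real k" using elim by (simp add: field_simps)
    then have "ln (1 + 1 / real k) = ln (real (Suc k)) - ln (real k)" using elim by (simp add: ln_div)
    then show ?case by simp
  qed
  from Lim_transform_eventually[OF 1 this] show ?thesis .
qed

text \<open>The coefficient \<open>q1\<close> is not given but forced: ln \<epsilon> = - ln 2 - 2 ln
  k, and a multiple of ln k converges only if the factor \<open>pi - 2 * q1\<close> is 0. The term
  q1 ln 2 then cancels the pi/2 ln 2 coming from the crescents.\<close>

lemma principal_part_value:
  assumes h: "near_translation h" and V: "petal h d V" "z \<in> V" and H: "principal_part h V H"
    and c: "(\<lambda>k. (\<Sum>n\<le>k. (h ^^ n) z) + of_real (ln (real k))) \<longlonglongrightarrow> c"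
  shows "H z = of_real pi * c - of_real (pi / 4)"
proof -
  obtain C where "parabolic_sequence (\<lambda>n. (h ^^ n) z) C"
    using petal_orbit_parabolic_sequence[OF h V] by blast
  then interpret parabolic_sequence "\<lambda>n. (h ^^ n) z" C .
  define A where "A \<epsilon> = directed_area h z \<epsilon>" for \<epsilon>
  obtain q1 q2 where q: "(\<lambda>\<epsilon>. A \<epsilon> - (q1 * of_real (\<epsilon> ^ 2 * ln \<epsilon>) + H z * of_real (\<epsilon> ^ 2) +
         q2 * of_real (\<epsilon> powr (5 / 2) * ln \<epsilon>))) \<in> O[at_right 0](\<lambda>\<epsilon>. of_real (\<epsilon> powr (5 / 2)))"
    using H V(2) unfolding principal_part_def A_def by blast
  have "\<forall>\<^sub>F k in sequentially. 0 < eps k"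
    using eventually_ge_at_top[of 1] by eventually_elim (rule eps_pos)
  then have fl: "filterlim eps (at_right 0) sequentially"
    by (rule tendsto_imp_filterlim_at_right[OF eps_tendsto_0])
  from landau_o.big.compose[OF q fl] obtain b where b: "b > 0"
    "\<forall>\<^sub>F k in sequentially. norm (A (eps k) - (q1 * of_real (eps k ^ 2 * ln (eps k)) + H z * of_real (eps k ^ 2) +
         q2 * of_real (eps k powr (5 / 2) * ln (eps k)))) \<le> b * norm (complex_of_real (eps k powr (5 / 2)))"
    by (elim landau_o.bigE)
  \<comment> \<open>Divided by the squared radius, the \<open>q2\<close> term and the remainder
    carry a factor sqrt \<epsilon> \<le> 1/k, so they are O(ln k / k).\<close>
  define rem where "rem k = A (eps k) / of_real (eps k ^ 2) - q1 * of_real (ln (eps k)) - H z" for k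
  have powr: "eps k powr (5/2) = eps k ^ 2 * sqrt (eps k)" if "k \<ge> 1" for k
  proof -
    have "eps k powr (5/2) = eps k powr (2 + 1/2)" by simp
    also have "\<dots> = eps k powr 2 * eps k powr (1/2)" by (rule powr_add)
    finally show ?thesis using eps_pos[OF that] by (simp add: powr_half_sqrt)
  qed
  have ln_eps: "ln (eps k) = - ln 2 - 2 * ln (real k)" if "k \<ge> 1" for k
    using that by (simp add: eps_def ln_div ln_mult ln_realpow)
  have sq: "sqrt (eps k) \<le> 1 / real k" if "k \<ge> 1" for k
  proof (rule real_le_lsqrt)
    show "eps k \<le> (1 / real k) ^ 2" using that by (simp add: eps_def field_simps)
  qed (use that in auto)
  have "rem \<longlonglongrightarrow> 0"
  proof (rule Lim_null_comparison)
    show "\<forall>\<^sub>F k in sequentially. norm (rem k) \<le> (b + norm q2 * (ln 2 + 2 * ln (real k))) * (1 / real k)"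
      using b(2) eventually_ge_at_top[of 1]
    proof eventually_elim
      case (elim k)
      have e: "eps k > 0" using eps_pos elim by blast
      define e2 where "e2 = eps k ^ 2"
      have e2: "e2 > 0" using e by (simp add: e2_def)
      define E where "E = A (eps k) - (q1 * of_real (eps k ^ 2 * ln (eps k)) + H z * of_real (eps k ^ 2) +
         q2 * of_real (eps k powr (5 / 2) * ln (eps k)))"
      have "E / of_real e2 = rem k - q2 * of_real (sqrt (eps k) * ln (eps k))"
        unfolding E_def powr[OF elim(2)] rem_def e2_def[symmetric] using e2
        by (simp add: diff_divide_distrib add_divide_distrib)
      then have "rem k = E / of_real e2 + q2 * of_real (sqrt (eps k) * ln (eps k))" by simp
      then have "norm (rem k) \<le> norm E / e2 + norm q2 * (sqrt (eps k) * \<bar>ln (eps k)\<bar>)"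
        using norm_triangle_ineq[of "E / of_real e2" "q2 * of_real (sqrt (eps k) * ln (eps k))"] e2 e by (simp add: norm_mult norm_divide abs_mult)
      also have "norm E / e2 \<le> b * sqrt (eps k)"
      proof -
        have "norm E \<le> b * (e2 * sqrt (eps k))"
          using elim(1)[folded E_def] e2 e unfolding powr[OF elim(2)] e2_def[symmetric] by (simp add: norm_mult)
        then show ?thesis using e2 by (simp add: pos_divide_le_eq mult_ac)
      qed
      also have "b * sqrt (eps k) \<le> b * (1 / real k)" using sq[OF elim(2)] b(1) by (intro mult_left_mono) auto
      also have "norm q2 * (sqrt (eps k) * \<bar>ln (eps k)\<bar>) \<le> norm q2 * ((1 / real k) * (ln 2 + 2 * ln (real k)))"
      proof (intro mult_left_mono mult_mono)
        have "0 \<le> ln (real k)" using elim by simp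
        moreover have "0 \<le> ln (2::real)" by simp
        ultimately show "\<bar>ln (eps k)\<bar> \<le> ln 2 + 2 * ln (real k)"
          unfolding ln_eps[OF elim(2)] abs_le_iff by linarith
      qed (use sq[OF elim(2)] elim in auto)
      finally show ?case by (simp add: algebra_simps)
    qed
    have "(\<lambda>k. (b + norm q2 * ln 2) * (1 / real k) + 2 * norm q2 * (ln (real k) / real k)) \<longlonglongrightarrow> (b + norm q2 * ln 2) * 0 + 2 * norm q2 * 0"
      by (intro tendsto_intros lim_const_over_n lim_ln_over_n)
    then show "(\<lambda>k. (b + norm q2 * (ln 2 + 2 * ln (real k))) * (1 / real k)) \<longlonglongrightarrow> 0"
      by (simp add: algebra_simps add_divide_distrib)
  qed
  define L where "L = of_real pi * c - of_real (pi / 2 * ln 2 + pi / 4)"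
  have "(\<lambda>k. (moment (\<lambda>n. (h ^^ n) z) (eps k) / of_real (eps k ^ 2) + of_real (pi * ln (real k))) - rem k) \<longlonglongrightarrow> L - 0"
    unfolding L_def by (intro tendsto_diff moment_limit[OF c] \<open>rem \<longlonglongrightarrow> 0\<close>)
  moreover have "\<forall>\<^sub>F k in sequentially. (moment (\<lambda>n. (h ^^ n) z) (eps k) / of_real (eps k ^ 2) + of_real (pi * ln (real k))) - rem k =
      (of_real pi - 2 * q1) * of_real (ln (real k)) + (H z - q1 * of_real (ln 2))"
    using eventually_ge_at_top[of 1]
  proof eventually_elim
    case (elim k)
    have "A (eps k) = moment (\<lambda>n. (h ^^ n) z) (eps k)" unfolding A_def
      by (rule directed_area_eq_moment[OF _ eps_pos[OF elim]]) unfold_locales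
    then show ?case unfolding rem_def ln_eps[OF elim] by (simp add: algebra_simps)
  qed
  ultimately have lim: "(\<lambda>k. (of_real pi - 2 * q1) * of_real (ln (real k)) + (H z - q1 * of_real (ln 2))) \<longlonglongrightarrow> L"
    using Lim_transform_eventually by fastforce
  then have "(\<lambda>k. (of_real pi - 2 * q1) * of_real (ln (real k))) \<longlonglongrightarrow> L - (H z - q1 * of_real (ln 2))"
    using tendsto_diff[OF lim tendsto_const[of "H z - q1 * of_real (ln 2)"]] by simp
  then have q1: "of_real pi - 2 * q1 = 0" by (rule tendsto_const_mult_ln_imp_zero)
  with lim have "L = H z - q1 * of_real (ln 2)" by (simp add: LIMSEQ_const_iff)
  moreover have "q1 = of_real pi / 2" using q1 by (simp add: field_simps)
  ultimately show ?thesis unfolding L_def by (simp add: algebra_simps)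
qed

text \<open>The orbit of \<open>h z\<close> is the orbit of \<open>z\<close> without its first
  point, so the regularised sum c drops by \<open>z\<close>.\<close>

lemma principal_part_cohomological:
  assumes h: "near_translation h" and V: "petal h d V" "z \<in> V" and H: "principal_part h V H"
  shows "H z - H (h z) = of_real pi * z"
proof -
  have hz: "h z \<in> V" using V unfolding petal_def by blast
  obtain C where "parabolic_sequence (\<lambda>n. (h ^^ n) z) C"
    using petal_orbit_parabolic_sequence[OF h V] by blast
  then interpret parabolic_sequence "\<lambda>n. (h ^^ n) z" C .
  obtain c where c: "(\<lambda>k. (\<Sum>n\<le>k. (h ^^ n) z) + of_real (ln (real k))) \<longlonglongrightarrow> c"
    using sum_plus_ln_convergent by blast
  have "(\<lambda>k. ((\<Sum>n\<le>Suc k. (h ^^ n) z) + of_real (ln (real k))) - z) \<longlonglongrightarrow> c - z"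
    by (intro tendsto_diff tendsto_plus_ln_shift[OF c] tendsto_const)
  moreover have "(\<Sum>n\<le>Suc k. (h ^^ n) z) = z + (\<Sum>n\<le>k. (h ^^ n) (h z))" for k
    unfolding sum.atMost_Suc_shift by (simp add: funpow_swap1)
  ultimately have c': "(\<lambda>k. (\<Sum>n\<le>k. (h ^^ n) (h z)) + of_real (ln (real k))) \<longlonglongrightarrow> c - z"
    by (simp del: sum.atMost_Suc)
  show ?thesis
    unfolding principal_part_value[OF h V H c] principal_part_value[OF h V(1) hz H c'] by (simp add: algebra_simps)
qed

text \<open>In the coordinate -1/z an orbit starting with nonpositive real part moves right, and its
  imaginary part drifts by a summable amount. Starting at height at most \<open>B\<close>, it would
  reach the imaginary axis near 0, inside the region |w| < R that corresponds to leaving the small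
  ball. The radius depends on \<open>h\<close> and \<open>B\<close> only, not on
  \<open>V\<close>.\<close>

lemma petal_noncrossing:
  assumes h: "near_translation h" and B: "0 \<le> B"
  obtains r\<^sub>0 where "r\<^sub>0 > 0" "\<And>V r z. r \<le> r\<^sub>0 \<Longrightarrow> h ` V \<subseteq> V \<Longrightarrow> V \<subseteq> ball 0 r - {0} \<Longrightarrow> z \<in> V \<Longrightarrow> 0 \<le> Re z \<Longrightarrow> B < \<bar>Im (- 1 / z)\<bar>"
proof -
  obtain C' where "\<forall>\<^sub>F z in at 0. norm (- 1 / h z - (- 1 / z) - 1) \<le> C' * norm z ^ 2"
    using h unfolding near_translation_def by blast
  then obtain r1 where r1: "r1 > 0" "\<And>z. z \<noteq> 0 \<Longrightarrow> norm z < r1 \<Longrightarrow> norm (- 1 / h z - (- 1 / z) - 1) \<le> C' * norm z ^ 2"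
    unfolding eventually_at by (auto simp: dist_norm)
  define C where "C = \<bar>C'\<bar>"
  have C0: "0 \<le> C" by (simp add: C_def)
  \<comment> \<open>In this order: the translation estimate is valid, the crossing point is too
    close to 0 for the orbit, the total drift is at most 1, and each step is within 1/2 of
    1.\<close>
  define R where "R = Max {1 / r1, B + 4, 8 * C, 2 * C + 1}"
  have R: "1 / r1 \<le> R" "B + 4 \<le> R" "8 * C \<le> R" "2 * C + 1 \<le> R" unfolding R_def by (auto intro!: Max_ge)
  have R1: "1 \<le> R" using R(4) C0 by linarith
  show ?thesis
  proof (rule that[of "1 / R"])
    show "1 / R > 0" using R1 by simp
  next
    fix V r z assume r: "r \<le> 1 / R" and inv: "h ` V \<subseteq> V" and VB: "V \<subseteq> ball 0 r - {0}" and z: "z \<in> V" "0 \<le> Re z"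
    show "B < \<bar>Im (- 1 / z)\<bar>"
    proof (rule ccontr)
      assume "\<not> B < \<bar>Im (- 1 / z)\<bar>"
      define x where "x n = (h ^^ n) z" for n
      define \<omega> where "\<omega> n = - 1 / x n" for n
      have xV: "x n \<in> V" for n using z(1) inv by (induction n) (auto simp: x_def)
      have x: "x n \<noteq> 0" "norm (x n) < 1 / R" for n using xV[of n] VB r by auto
      have x1: "norm (x n) < r1" for n
      proof -
        have "1 / R \<le> r1" using R(1) r1(1) R1 by (simp add: field_simps)
        then show ?thesis using x(2)[of n] by simp
      qed
      have \<omega>: "R \<le> norm (\<omega> n)" "norm (x n) = 1 / norm (\<omega> n)" for n
      proof -
        show n: "norm (x n) = 1 / norm (\<omega> n)" using x(1)[of n] by (simp add: \<omega>_def norm_divide)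
        have "norm (\<omega> n) > 0" using x(1)[of n] by (simp add: \<omega>_def)
        then show "R \<le> norm (\<omega> n)" using x(2)[of n] R1 unfolding n by (simp add: field_simps)
      qed
      have step: "norm (\<omega> (Suc n) - \<omega> n - 1) \<le> C / norm (\<omega> n) ^ 2" for n
      proof -
        have "norm (\<omega> (Suc n) - \<omega> n - 1) \<le> C' * norm (x n) ^ 2"
          using r1(2)[OF x(1) x1, of n] by (simp add: \<omega>_def x_def)
        also have "\<dots> \<le> C * norm (x n) ^ 2" unfolding C_def by (intro mult_right_mono) auto
        finally show ?thesis unfolding \<omega>(2) by (simp add: power_divide)
      qed
      have half: "norm (\<omega> (Suc n) - \<omega> n - 1) \<le> 1/2" for n
      proof -
        have "C / norm (\<omega> n) ^ 2 \<le> C / (R * 1)"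
          using \<omega>(1)[of n] R1 C0 unfolding power2_eq_square by (intro divide_left_mono mult_mono mult_pos_pos) auto
        also have "\<dots> \<le> 1/2" using R(4) R1 by (simp add: field_simps)
        finally show ?thesis using step[of n] by linarith
      qed
      have re: "Re (\<omega> n) + 1/2 \<le> Re (\<omega> (Suc n))" "Re (\<omega> (Suc n)) \<le> Re (\<omega> n) + 3/2" for n
        using abs_Re_le_cmod[of "\<omega> (Suc n) - \<omega> n - 1"] half[of n] by (auto simp: abs_le_iff)
      have "Re (\<omega> 0) + real n / 2 \<le> Re (\<omega> n)" for n
      proof (induction n)
        case (Suc n)
        then show ?case using re(1)[of n] by (simp add: field_simps)
      qed simp
      moreover obtain n :: nat where "- 2 * Re (\<omega> 0) < n" using reals_Archimedean2 by blast
      ultimately have ex: "\<exists>n. 0 < Re (\<omega> n)" by (intro exI[of _ n]) (smt (verit) field_sum_of_halves)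
      have re0: "Re (\<omega> 0) \<le> 0" using z(2) by (simp add: \<omega>_def x_def Re_divide)
      define m where "m = (LEAST n. 0 < Re (\<omega> n)) - 1"
      have m: "0 < Re (\<omega> (Suc m))" "\<And>i. i \<le> m \<Longrightarrow> Re (\<omega> i) \<le> 0"
      proof -
        define l where "l = (LEAST n. 0 < Re (\<omega> n))"
        have l: "0 < Re (\<omega> l)" unfolding l_def using ex by (rule LeastI_ex)
        then have "l \<noteq> 0" using re0 by (metis not_less)
        then have lm: "l = Suc m" by (simp add: m_def l_def)
        then show "0 < Re (\<omega> (Suc m))" using l by simp
        show "Re (\<omega> i) \<le> 0" if "i \<le> m" for i
          using not_less_Least[of i "\<lambda>n. 0 < Re (\<omega> n)"] that lm unfolding l_def[symmetric] by (simp add: not_less)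
      qed
      \<comment> \<open>From |\<omega>| \<ge> (R - Re \<omega>) / 2 a step drifts by at most 4 C /
        (R - Re \<omega>)^2. Since the real part gains at least 1/2, this is at most the increase of
        8 C / (R - Re \<omega>), and the drifts telescope.\<close>
      have im: "\<bar>Im (\<omega> i)\<bar> \<le> B + 8 * C / (R - Re (\<omega> i))" if "i \<le> m" for i
        using that
      proof (induction i)
        case 0
        have "0 \<le> 8 * C / (R - Re (\<omega> 0))" using C0 R1 re0 by (intro divide_nonneg_nonneg) auto
        moreover have "\<bar>Im (\<omega> 0)\<bar> \<le> B" using \<open>\<not> B < \<bar>Im (- 1 / z)\<bar>\<close> by (simp add: \<omega>_def x_def)
        ultimately show ?case by simp
      next
        case (Suc i)
        define a b where "a = Re (\<omega> i)" and "b = Re (\<omega> (Suc i))"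
        have ab: "a \<le> 0" "b \<le> 0" "a + 1/2 \<le> b" using m(2)[of i] m(2)[of "Suc i"] Suc.prems re(1)[of i] by (auto simp: a_def b_def)
        have pos: "R - a > 0" "R - b > 0" "R - b \<le> R - a" using ab R1 by auto
        have "(R - a) / 2 \<le> norm (\<omega> i)" using \<omega>(1)[of i] abs_Re_le_cmod[of "\<omega> i"] ab unfolding a_def by simp
        then have "((R - a) / 2) ^ 2 \<le> norm (\<omega> i) ^ 2" using pos by (intro power_mono) auto
        then have "C / norm (\<omega> i) ^ 2 \<le> C / ((R - a) / 2) ^ 2" using C0 pos \<omega>(1)[of i] R1
          by (intro divide_left_mono mult_pos_pos zero_less_power half_gt_zero) linarith+
        also have "\<dots> = 8 * C * ((1/2) / ((R - a) * (R - a)))" by (simp add: power2_eq_square)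
        also have "\<dots> \<le> 8 * C * ((b - a) / ((R - a) * (R - b)))"
          using C0 pos ab by (intro mult_left_mono frac_le mult_pos_pos) auto
        also have "(b - a) / ((R - a) * (R - b)) = 1 / (R - b) - 1 / (R - a)"
        proof -
          have "1 / x - 1 / y = (y - x) / (y * x)" if "x \<noteq> 0" "y \<noteq> 0" for x y :: real
            using that by (simp add: field_simps)
          from this[of "R - b" "R - a"] pos show ?thesis by simp
        qed
        finally have "norm (\<omega> (Suc i) - \<omega> i - 1) \<le> 8 * C / (R - b) - 8 * C / (R - a)"
          using step[of i] by (simp add: algebra_simps)
        moreover have "\<bar>Im (\<omega> (Suc i))\<bar> \<le> \<bar>Im (\<omega> i)\<bar> + norm (\<omega> (Suc i) - \<omega> i - 1)"
          using abs_Im_le_cmod[of "\<omega> (Suc i) - \<omega> i - 1"] by simp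
        ultimately show ?case using Suc.IH Suc.prems unfolding a_def b_def by simp
      qed
      have "8 * C / (R - Re (\<omega> m)) \<le> 8 * C / R" using C0 R1 m(2)[of m] by (intro divide_left_mono) auto
      also have "\<dots> \<le> 1" using R(3) R1 by (simp add: field_simps)
      finally have "\<bar>Im (\<omega> m)\<bar> \<le> B + 1" using im[of m] by simp
      moreover have "\<bar>Re (\<omega> m)\<bar> \<le> 3/2" using re(2)[of m] m(1) m(2)[of m] by simp
      ultimately have "norm (\<omega> m) \<le> 3/2 + (B + 1)" using cmod_le[of "\<omega> m"] by simp
      then show False using \<omega>(1)[of m] R(2) by simp
    qed
  qed
qed

section \<open>Germs and the functional equation\<close>

lemma pole_lemma_at_0:
  fixes F :: "complex \<Rightarrow> complex"
  assumes F: "F analytic_on {0}" "F 0 = 0"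
  obtains G where "G analytic_on {0}" "G 0 = deriv F 0" "\<And>z. F z = z * G z"
proof -
  obtain e where e: "e > 0" "F holomorphic_on ball 0 e" using F(1) by (auto simp: analytic_at_ball)
  let ?G = "\<lambda>z. if z = 0 then deriv F 0 else (F z - F 0) / (z - 0)"
  have "?G holomorphic_on ball 0 e" by (rule pole_lemma[OF e(2)]) (use e in \<open>simp add: interior_open\<close>)
  then have "?G analytic_on {0}" using e(1) by (auto simp: analytic_at_ball)
  then show ?thesis by (rule that) (use F(2) in auto)
qed

lemma eventually_norm_le_of_isCont:
  fixes F :: "complex \<Rightarrow> complex"
  assumes "isCont F 0"
  shows "\<forall>\<^sub>F z in at 0. norm (F z) \<le> norm (F 0) + 1"
proof -
  have "((\<lambda>z. norm (F z)) \<longlongrightarrow> norm (F 0)) (at 0)" using assms unfolding isCont_def by (rule tendsto_norm)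
  then have "\<forall>\<^sub>F z in at 0. norm (F z) < norm (F 0) + 1" by (rule order_tendstoD) simp
  then show ?thesis by eventually_elim simp
qed

text \<open>Writing f z = z U z with U = 1 + z + z^2 + z^3 G, the error in the coordinate -1/z is (U
  - 1 - z U) / (z U). The coefficient 1 of z^3 in \<open>f\<close> removes the z^2 term of the
  numerator, which leaves z^3 (G - 1 - z G).\<close>

lemma prenormalized_near_translation:
  assumes "prenormalized f"
  shows "near_translation f"
proof -
  define F where "F z = f z - (z + z ^ 2 + z ^ 3)" for z
  have f: "f analytic_on {0}" "f 0 = 0" and o: "F \<in> o[at 0](\<lambda>z. z ^ 3)"
    using assms unfolding prenormalized_def F_def by auto
  have lim3: "((\<lambda>z. F z / z ^ 3) \<longlongrightarrow> 0) (at 0)"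
    using o by (rule smalloD_tendsto)
  have F: "F analytic_on {0}" "F 0 = 0" unfolding F_def using f by (auto intro!: analytic_intros)
  \<comment> \<open>The little-o condition makes the first three quotients of \<open>F\<close> by
    powers of z vanish at 0, so four factors z can be split off.\<close>
  have zero: "G 0 = 0" if "G analytic_on {0}" "\<And>z. z \<noteq> 0 \<Longrightarrow> G z = (F z / z ^ 3) * z ^ k" for G k
  proof -
    have "((\<lambda>z. (F z / z ^ 3) * z ^ k) \<longlongrightarrow> 0 * 0 ^ k) (at 0)"
      by (intro tendsto_intros lim3)
    moreover have "\<forall>\<^sub>F z in at 0. (F z / z ^ 3) * z ^ k = G z"
      using that(2) by (simp add: eventually_at_filter)
    ultimately have "(G \<longlongrightarrow> 0 * 0 ^ k) (at 0)" by (rule Lim_transform_eventually)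
    then have "(G \<longlongrightarrow> 0) (at 0)" by simp
    moreover have "(G \<longlongrightarrow> G 0) (at 0)" using analytic_at_imp_isCont[OF that(1)] by (simp add: isCont_def)
    ultimately show ?thesis using tendsto_unique[OF at_neq_bot] by metis
  qed
  obtain G1 where G1: "G1 analytic_on {0}" "\<And>z. F z = z * G1 z" by (rule pole_lemma_at_0[OF F]) blast
  have "G1 0 = 0" by (rule zero[OF G1(1), of 2]) (simp add: G1(2) power2_eq_square power3_eq_cube)
  with G1 obtain G2 where G2: "G2 analytic_on {0}" "\<And>z. G1 z = z * G2 z" using pole_lemma_at_0 by metis
  have "G2 0 = 0" by (rule zero[OF G2(1), of 1]) (simp add: G1(2) G2(2) power2_eq_square power3_eq_cube)
  with G2 obtain G3 where G3: "G3 analytic_on {0}" "\<And>z. G2 z = z * G3 z" using pole_lemma_at_0 by metis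
  have "G3 0 = 0" by (rule zero[OF G3(1), of 0]) (simp add: G1(2) G2(2) G3(2) power3_eq_cube)
  with G3 obtain G where G: "G analytic_on {0}" "\<And>z. G3 z = z * G z" using pole_lemma_at_0 by metis
  define U where "U z = 1 + z + z ^ 2 + z ^ 3 * G z" for z
  define E where "E z = (G z - 1 - z * G z) / U z" for z
  have fz: "f z = z * U z" for z
  proof -
    have "f z = F z + (z + z ^ 2 + z ^ 3)" by (simp add: F_def)
    then show ?thesis unfolding U_def G1(2) G2(2) G3(2) G(2)
      by (simp add: algebra_simps power2_eq_square power3_eq_cube)
  qed
  have cG: "isCont G 0" by (rule analytic_at_imp_isCont[OF G(1)])
  have cU: "isCont U 0" unfolding U_def by (intro continuous_intros cG)
  have U0: "U 0 = 1" by (simp add: U_def)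
  have cE: "isCont E 0" unfolding E_def by (intro continuous_intros cG cU) (simp add: U0)
  have "(U \<longlongrightarrow> 1) (at 0)" using cU U0 by (simp add: isCont_def)
  then have "\<forall>\<^sub>F z in at 0. U z \<noteq> 0" by (rule tendsto_imp_eventually_ne) simp
  moreover have "\<forall>\<^sub>F z in at 0. z \<noteq> (0 :: complex)" by (simp add: eventually_at_filter)
  ultimately have "\<forall>\<^sub>F z in at 0. norm (- 1 / f z - (- 1 / z) - 1) \<le> (norm (E 0) + 1) * norm z ^ 2"
    using eventually_norm_le_of_isCont[OF cE]
  proof eventually_elim
    case (elim z)
    have "- 1 / (z * u) - (- 1 / z) - 1 = (u - 1 - z * u) / (z * u)" if "u \<noteq> 0" for u
      using that elim(2) by (simp add: field_simps)
    from this[OF elim(1)] have "- 1 / f z - (- 1 / z) - 1 = (U z - 1 - z * U z) / (z * U z)"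
      unfolding fz .
    also have "U z - 1 - z * U z = z * (z ^ 2 * (G z - 1 - z * G z))"
      by (simp add: U_def algebra_simps power2_eq_square power3_eq_cube)
    also have "\<dots> / (z * U z) = z ^ 2 * E z" using elim(2) by (simp add: E_def)
    finally have "norm (- 1 / f z - (- 1 / z) - 1) = norm (E z) * norm z ^ 2"
      by (simp add: norm_mult norm_power mult.commute)
    also have "\<dots> \<le> (norm (E 0) + 1) * norm z ^ 2" using elim(3) by (intro mult_right_mono) auto
    finally show ?case .
  qed
  then show ?thesis unfolding near_translation_def by blast
qed

lemma analytic_norm_le_linear:
  assumes "g analytic_on {0}" "g 0 = 0"
  shows "\<exists>K\<ge>0. \<forall>\<^sub>F z in at 0. norm (g z) \<le> K * norm z"
proof -
  obtain G where G: "G analytic_on {0}" "\<And>z. g z = z * G z" using pole_lemma_at_0[OF assms] by metis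
  have "\<forall>\<^sub>F z in at 0. norm (G z) \<le> norm (G 0) + 1"
    by (rule eventually_norm_le_of_isCont[OF analytic_at_imp_isCont[OF G(1)]])
  then have "\<forall>\<^sub>F z in at 0. norm (g z) \<le> (norm (G 0) + 1) * norm z"
    by eventually_elim (simp add: G(2) norm_mult mult.commute mult_left_mono)
  then show ?thesis by (intro exI[of _ "norm (G 0) + 1"]) simp
qed

lemma filterlim_uminus_at_0: "filterlim (uminus :: complex \<Rightarrow> complex) (at 0) (at 0)"
  using filterlim_at[of uminus 0 "UNIV" "at (0 :: complex)"] tendsto_minus[OF tendsto_ident_at[of "0 :: complex" UNIV]]
  by (simp add: eventually_at_filter)

text \<open>Substituting g z for z in the estimate for \<open>f\<close> gives 1 / g z = 1 / z + 1 +
  O(z^2); the reflection turns 1/z into -1/z and keeps the translation by +1.\<close>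

lemma inverse_germ_near_translation:
  assumes f: "near_translation f" "f 0 = 0" and g: "inverse_germ f g"
  shows "near_translation (\<lambda>z. - g (- z))"
proof -
  obtain C where C: "\<forall>\<^sub>F z in at 0. norm (- 1 / f z - (- 1 / z) - 1) \<le> C * norm z ^ 2"
    using f(1) unfolding near_translation_def by blast
  have ga: "g analytic_on {0}" "g 0 = 0" and fg: "\<forall>\<^sub>F z in at 0. f (g z) = z"
    using g unfolding inverse_germ_def by (auto simp: eventually_at_filter elim: eventually_mono)
  obtain K where K: "K \<ge> 0" "\<forall>\<^sub>F z in at 0. norm (g z) \<le> K * norm z" using analytic_norm_le_linear[OF ga] by blast
  have ne: "\<forall>\<^sub>F z in at 0. g z \<noteq> 0"
  proof -
    have "\<forall>\<^sub>F z in at 0. z \<noteq> (0 :: complex)" by (simp add: eventually_at_filter)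
    with fg show ?thesis by eventually_elim (use f(2) in auto)
  qed
  have "(g \<longlongrightarrow> 0) (at 0)" using analytic_at_imp_isCont[OF ga(1)] ga(2) by (simp add: isCont_def)
  then have "filterlim g (at 0) (at 0)" using ne by (simp add: filterlim_at)
  from eventually_compose_filterlim[OF C this] fg K(2)
  have "\<forall>\<^sub>F z in at 0. norm (1 / g z - 1 / z - 1) \<le> \<bar>C\<bar> * K ^ 2 * norm z ^ 2"
  proof eventually_elim
    case (elim z)
    have "norm (1 / g z - 1 / z - 1) \<le> C * norm (g z) ^ 2" using elim(1,2) by (simp add: algebra_simps)
    also have "\<dots> \<le> \<bar>C\<bar> * (K * norm z) ^ 2"
      using elim(3) by (intro mult_mono power_mono) auto
    finally show ?case by (simp add: power_mult_distrib)
  qed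
  from eventually_compose_filterlim[OF this filterlim_uminus_at_0]
  have "\<forall>\<^sub>F z in at 0. norm (- 1 / (- g (- z)) - (- 1 / z) - 1) \<le> (\<bar>C\<bar> * K ^ 2) * norm z ^ 2"
    by eventually_elim simp
  then show ?thesis unfolding near_translation_def by blast
qed

text \<open>The sum of the logarithms has the right exponential; it can fail to be principal only if
  the argument passes pi or -pi. In the left half-plane this would change the sign of the imaginary
  part, since the argument of q is below pi/2 in absolute value.\<close>

lemma Ln_times_same_side:
  assumes q: "0 < Re q" and u: "u \<noteq> 0"
    and side: "0 < Re u \<or> (0 < Im u \<and> 0 < Im (u * q)) \<or> (Im u < 0 \<and> Im (u * q) < 0)"
  shows "Ln (u * q) = Ln u + Ln q"
proof -
  have q0: "q \<noteq> 0" using q by auto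
  define a b where "a = Im (Ln u)" and "b = Im (Ln q)"
  have b: "\<bar>b\<bar> < pi / 2" using q Re_Ln_pos_lt[OF q0] unfolding b_def by blast
  have a: "- pi < a" "a \<le> pi" using u by (auto simp: a_def mpi_less_Im_Ln Im_Ln_le_pi)
  have "exp (Ln u + Ln q) = u * q" using u q0 by (simp add: exp_add)
  then have im: "Im (u * q) = exp (Re (Ln u + Ln q)) * sin (a + b)"
    unfolding a_def b_def by (metis Im_exp plus_complex.sel(2))
  have "- pi < a + b \<and> a + b \<le> pi"
    using side
  proof (elim disjE conjE)
    assume "0 < Re u"
    then have "\<bar>a\<bar> < pi / 2" using Re_Ln_pos_lt[OF u] unfolding a_def by blast
    then show ?thesis using b by linarith
  next
    assume "0 < Im u" "0 < Im (u * q)"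
    then have "0 < a" "0 < sin (a + b)" using Im_Ln_pos_lt[OF u] im by (auto simp: a_def zero_less_mult_iff)
    moreover have "sin (a + b) \<le> 0" if "pi < a + b"
      using sin_le_zero[of "a + b"] that a b by simp
    ultimately show ?thesis using a b by fastforce
  next
    assume "Im u < 0" "Im (u * q) < 0"
    then have "a < 0" "sin (a + b) < 0" using Im_Ln_pos_le[OF u] im a by (auto simp: a_def mult_less_0_iff)
    moreover have "0 \<le> sin (a + b)" if "a + b \<le> - pi"
      using sin_ge_zero[of "a + b + 2 * pi"] that a b by simp
    ultimately show ?thesis using a b by fastforce
  qed
  then show ?thesis using u q0 unfolding a_def b_def by (intro Ln_times_simple) auto
qed

section \<open>The branch of the logarithm on an attracting petal\<close>

lemma Ln2pi_eq_Ln: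
  assumes "z \<notin> \<real>\<^sub>\<ge>\<^sub>0"
  shows "Ln2pi z = Ln (- z) + \<i> * of_real pi"
proof -
  have "z \<noteq> 0" using assms by auto
  then show ?thesis using Arg2pi_Ln[OF Arg2pi_gt_0[OF assms]]
    by (simp add: Ln2pi_def complex_eq_iff)
qed

lemma petal_not_nonneg_Reals:
  assumes "petal h (-1) V" "z \<in> V"
  shows "z \<notin> \<real>\<^sub>\<ge>\<^sub>0"
  using assms unfolding petal_def by (auto elim!: nonneg_Reals_cases)

lemma petal_contains_ray:
  assumes "petal h d V" "norm d = 1"
  obtains \<rho> where "\<rho> > 0" "\<And>t. 0 < t \<Longrightarrow> t < \<rho> \<Longrightarrow> of_real t * d \<in> V"
proof -
  have "0 < pi / 2 \<and> pi / 2 < pi" by simp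
  then obtain \<rho> where \<rho>: "\<rho> > 0" "\<And>z. 0 < norm z \<Longrightarrow> norm z < \<rho> \<Longrightarrow> \<bar>Arg (z / d)\<bar> < pi / 2 \<Longrightarrow> z \<in> V"
    using assms(1) unfolding petal_def by blast
  have d: "d \<noteq> 0" using assms(2) by auto
  show ?thesis
  proof (rule that[OF \<rho>(1)])
    fix t :: real assume "0 < t" "t < \<rho>"
    then show "of_real t * d \<in> V" using \<rho>(2)[of "of_real t * d"] d assms(2) by (simp add: norm_mult)
  qed
qed

lemma deriv_ident_mult:
  fixes F :: "complex \<Rightarrow> complex"
  assumes "F analytic_on {0}"
  shows "deriv (\<lambda>z. z * F z) 0 = F 0"
proof -
  have "F field_differentiable at 0" using assms by (rule analytic_on_imp_differentiable_at) simp
  then obtain D where "(F has_field_derivative D) (at 0)" unfolding field_differentiable_def by blast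
  then have "((\<lambda>z. z * F z) has_field_derivative (1 * F 0 + D * 0)) (at 0)" by (intro DERIV_mult DERIV_ident)
  then show ?thesis by (simp add: DERIV_imp_deriv)
qed

lemma germ_quotient:
  assumes "\<phi> analytic_on {0}" "\<phi> 0 = 0" "deriv \<phi> 0 = 1"
  obtains Q where "Q analytic_on {0}" "Q 0 = 1" "\<And>z. \<phi> z = z * Q z"
proof -
  obtain Q where "Q analytic_on {0}" "Q 0 = deriv \<phi> 0" "\<And>z. \<phi> z = z * Q z"
    by (rule pole_lemma_at_0[OF assms(1,2)]) blast
  then show ?thesis using that assms(3) by simp
qed

lemma Im_minus_inverse_pos_iff: "0 < Im (- 1 / z) \<longleftrightarrow> 0 < Im z" and Im_minus_inverse_neg_iff: "Im (- 1 / z) < 0 \<longleftrightarrow> Im z < 0"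
proof -
  have "Im (- 1 / z) = Im z / (norm z)^2" by (simp add: Im_divide cmod_power2)
  then show "0 < Im (- 1 / z) \<longleftrightarrow> 0 < Im z" "Im (- 1 / z) < 0 \<longleftrightarrow> Im z < 0"
    by (cases "z = 0"; simp add: zero_less_divide_iff divide_less_0_iff)+
qed

text \<open>In the coordinate -1/z the germ \<open>\<phi>\<close> moves points near 0 by at most a
  constant \<open>B\<close>, whereas points of the petal with nonnegative real part have |Im (-1/z)|
  > \<open>B\<close> by \<open>petal_noncrossing\<close>. So \<open>\<phi>\<close> cannot carry them
  across the positive real axis; points with negative real part are far from this cut.\<close>

lemma Ln2pi_germ:
  assumes h: "near_translation h" and \<phi>: "\<phi> analytic_on {0}" "\<phi> 0 = 0" "deriv \<phi> 0 = 1"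
  obtains r where "r > 0" "\<And>V. petal h (-1) V \<Longrightarrow> V \<subseteq> ball 0 r \<Longrightarrow>
    \<forall>\<^sub>F z in at 0 within V. \<phi> z \<notin> \<real>\<^sub>\<ge>\<^sub>0 \<and> Ln2pi (\<phi> z) = Ln2pi z + Ln (\<phi> z / z)"
proof -
  obtain Q where Q: "Q analytic_on {0}" "Q 0 = 1" "\<And>z. \<phi> z = z * Q z" by (rule germ_quotient[OF \<phi>]) blast
  have "(\<lambda>z. Q z - 1) analytic_on {0}" "Q 0 - 1 = 0" using Q(1,2) by (auto intro!: analytic_intros)
  then obtain G where G: "G analytic_on {0}" "\<And>z. Q z - 1 = z * G z"
    by (rule pole_lemma_at_0) blast
  have c: "isCont Q 0" "isCont G 0" using Q(1) G(1) by (auto intro: analytic_at_imp_isCont)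
  define B where "B = norm (G 0 / Q 0) + 1"
  have "isCont (\<lambda>z. G z / Q z) 0" using c Q(2) by (intro continuous_intros) auto
  then have bd: "\<forall>\<^sub>F z in at 0. norm (G z / Q z) \<le> B" unfolding B_def by (rule eventually_norm_le_of_isCont)
  have "(Q \<longlongrightarrow> 1) (at 0)" using c(1) Q(2) by (simp add: isCont_def)
  then have "\<forall>\<^sub>F z in at 0. dist (Q z) 1 < 1/2" by (rule tendstoD) simp
  moreover have "0 \<le> B" by (simp add: B_def)
  from h this obtain r where r: "r > 0" "\<And>V r' z. r' \<le> r \<Longrightarrow> h ` V \<subseteq> V \<Longrightarrow> V \<subseteq> ball 0 r' - {0} \<Longrightarrow> z \<in> V \<Longrightarrow> 0 \<le> Re z \<Longrightarrow> B < \<bar>Im (- 1 / z)\<bar>"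
    by (rule petal_noncrossing) blast
  ultimately have near: "\<forall>\<^sub>F z in at 0. dist (Q z) 1 < 1/2 \<and> norm (G z / Q z) \<le> B"
    using bd by (intro eventually_conj)
  show ?thesis
  proof (rule that[OF r(1)])
    fix V assume V: "petal h (-1) V" "V \<subseteq> ball 0 r"
    have inv: "h ` V \<subseteq> V" using V(1) by (simp add: petal_def)
    have nn: "z \<notin> \<real>\<^sub>\<ge>\<^sub>0" if "z \<in> V" for z using petal_not_nonneg_Reals[OF V(1) that] .
    have V0: "V \<subseteq> ball 0 r - {0}" using V(2) nn[of 0] by auto
    have "\<forall>\<^sub>F z in at 0 within V. z \<in> V" by (simp add: eventually_at_filter)
    with filter_leD[OF at_le[OF subset_UNIV] near]
    show "\<forall>\<^sub>F z in at 0 within V. \<phi> z \<notin> \<real>\<^sub>\<ge>\<^sub>0 \<and> Ln2pi (\<phi> z) = Ln2pi z + Ln (\<phi> z / z)"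
    proof eventually_elim
      case (elim z)
      have z0: "z \<noteq> 0" using elim(2) V0 by auto
      have "norm (Q z - 1) < 1/2" using elim(1) by (simp add: dist_norm)
      then have q: "0 < Re (Q z)" using abs_Re_le_cmod[of "Q z - 1"] by simp
      then have q0: "Q z \<noteq> 0" by auto
      have uq: "- z * Q z = - \<phi> z" by (simp add: Q(3))
      have \<phi>0: "\<phi> z \<noteq> 0" using z0 q0 by (simp add: Q(3))
      have "- 1 / (z * q) - - 1 / z = (q - 1) / z / q" if "q \<noteq> 0" for q
        using that z0 by (simp add: field_simps)
      from this[OF q0] have "- 1 / \<phi> z - - 1 / z = G z / Q z"
        using z0 unfolding Q(3) G(2) by simp
      then have "norm (- 1 / \<phi> z - - 1 / z) \<le> B" using elim(1) by simp
      then have im: "\<bar>Im (- 1 / \<phi> z) - Im (- 1 / z)\<bar> \<le> B"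
        using abs_Im_le_cmod[of "- 1 / \<phi> z - - 1 / z"] by (simp only: minus_complex.sel)
      have side: "0 < Re (- z) \<or> (0 < Im (- z) \<and> 0 < Im (- z * Q z)) \<or> (Im (- z) < 0 \<and> Im (- z * Q z) < 0)"
      proof (cases "Re z < 0")
        case False
        then have "B < \<bar>Im (- 1 / z)\<bar>" using r(2)[OF order_refl inv V0 elim(2)] by simp
        then have "(0 < Im (- 1 / z) \<and> 0 < Im (- 1 / \<phi> z)) \<or> (Im (- 1 / z) < 0 \<and> Im (- 1 / \<phi> z) < 0)"
          using im by linarith
        then show ?thesis unfolding uq Im_minus_inverse_pos_iff Im_minus_inverse_neg_iff by auto
      qed simp
      have Lq: "Ln (- \<phi> z) = Ln (- z) + Ln (Q z)"
        using Ln_times_same_side[OF q _ side] z0 unfolding uq by simp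
      \<comment> \<open>On the cut the argument of - \<phi> z would be pi, but here it is a sum of
        two arguments smaller than pi/2 in absolute value.\<close>
      have nonneg: "\<phi> z \<notin> \<real>\<^sub>\<ge>\<^sub>0"
      proof
        assume "\<phi> z \<in> \<real>\<^sub>\<ge>\<^sub>0"
        then have re: "Im (\<phi> z) = 0" "0 < Re (\<phi> z)"
          using \<phi>0 by (auto simp: complex_nonneg_Reals_iff complex_eq_iff)
        then have "0 < Re (- z)" using side unfolding uq by auto
        moreover have "- z \<noteq> 0" using z0 by simp
        ultimately have "\<bar>Im (Ln (- z))\<bar> < pi / 2" using Re_Ln_pos_lt by blast
        moreover have "\<bar>Im (Ln (Q z))\<bar> < pi / 2" using Re_Ln_pos_lt[OF q0] q by blast
        moreover have "Im (Ln (- \<phi> z)) = pi" using Im_Ln_eq_pi[of "- \<phi> z"] \<phi>0 re by simp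
        ultimately show False unfolding Lq plus_complex.sel by linarith
      qed
      have "\<phi> z / z = Q z" using z0 by (simp add: Q(3))
      then show ?case using nonneg nn[OF elim(2)] Lq by (simp add: Ln2pi_eq_Ln)
    qed
  qed
qed

text \<open>\<open>k * x k\<close> tends to -1, whose argument in (0, 2 pi) is pi. This limit
  supplies the constant i pi in c.\<close>

lemma Ln2pi_along_orbit:
  assumes "parabolic_sequence x C" "\<And>k. x k \<notin> \<real>\<^sub>\<ge>\<^sub>0"
  shows "(\<lambda>k. Ln2pi (x k) + of_real (ln (real k))) \<longlonglongrightarrow> \<i> * of_real pi"
proof -
  interpret parabolic_sequence x C by fact
  obtain N :: nat where N: "max 1 (8 * B) \<le> N" using real_arch_simple by blast
  have "(\<lambda>k. of_nat k * x k + 1) \<longlonglongrightarrow> 0"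
  proof (rule Lim_null_comparison)
    show "\<forall>\<^sub>F k in sequentially. norm (of_nat k * x k + 1) \<le> 2 * B * (1 / real k)"
      using eventually_ge_at_top[of N]
    proof eventually_elim
      case (elim k)
      then have k: "1 \<le> k" "8 * B \<le> k" using N by auto
      have "of_nat k * x k + 1 = of_nat k * (x k + 1 / of_nat k)" using k by (simp add: distrib_left)
      then have "norm (of_nat k * x k + 1) = real k * norm (x k + 1 / of_nat k)" by (simp add: norm_mult)
      also have "\<dots> \<le> real k * (2 * B / real k ^ 2)" by (intro mult_left_mono z_asymp k) simp
      finally show ?case using k by (simp add: power2_eq_square)
    qed
    have "(\<lambda>k. 2 * B * (1 / real k)) \<longlonglongrightarrow> 2 * B * 0" by (intro tendsto_intros lim_const_over_n)
    then show "(\<lambda>k. 2 * B * (1 / real k)) \<longlonglongrightarrow> 0" by simp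
  qed
  then have "(\<lambda>k. 1 - (of_nat k * x k + 1)) \<longlonglongrightarrow> 1 - 0" by (intro tendsto_intros)
  then have "(\<lambda>k. of_nat k * (- x k)) \<longlonglongrightarrow> 1" by simp
  then have "(\<lambda>k. Ln (of_nat k * (- x k))) \<longlonglongrightarrow> Ln 1" by (rule tendsto_Ln) simp
  then have "(\<lambda>k. Ln (of_nat k * (- x k)) + \<i> * of_real pi) \<longlonglongrightarrow> Ln 1 + \<i> * of_real pi"
    by (intro tendsto_add tendsto_const)
  moreover have "\<forall>\<^sub>F k in sequentially. Ln (of_nat k * (- x k)) + \<i> * of_real pi = Ln2pi (x k) + of_real (ln (real k))"
    using eventually_gt_at_top[of 0]
  proof eventually_elim
    case (elim k)
    have "Ln (of_real (real k) * (- x k)) = of_real (ln (real k)) + Ln (- x k)"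
      using elim nonzero[of k] Ln_times_of_real[of "real k" "- x k"] by simp
    then show ?case using assms(2)[of k] by (simp add: Ln2pi_eq_Ln)
  qed
  ultimately show ?thesis using Lim_transform_eventually by fastforce
qed

text \<open>Taking a logarithm L of \<open>\<phi>\<close> in the functional equation leaves an
  unknown multiple of 2 pi i, the value of \<open>D\<close>. Being continuous with discrete values,
  \<open>D\<close> is constant on the connected petal; it tends to 0 along an orbit and hence is 0
  already at the starting point.\<close>

lemma exp_conjugate_principal_part:
  assumes h: "near_translation h" "h analytic_on {0}" and \<phi>: "\<phi> analytic_on {0}" "\<phi> 0 = 0" "deriv \<phi> 0 = 1"
    and eq: "\<forall>\<^sub>F z in nhds 0. \<phi> (h z) = exp z * \<phi> z"
  obtains r where "r > 0" "\<And>V H z. petal h (-1) V \<Longrightarrow> V \<subseteq> ball 0 r \<Longrightarrow> principal_part h V H \<Longrightarrow> z \<in> V \<Longrightarrow>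
    H z = \<i> * of_real (pi ^ 2) - of_real (pi / 4) - of_real pi * (Ln2pi z + Ln (\<phi> z / z))"
proof -
  obtain Q where Q: "Q analytic_on {0}" "Q 0 = 1" "\<And>z. \<phi> z = z * Q z" by (rule germ_quotient[OF \<phi>]) blast
  have Q1: "isCont Q 0" using Q(1) by (rule analytic_at_imp_isCont)
  have "\<forall>\<^sub>F z in nhds 0. dist (Q z) 1 < 1"
    using Q1 Q(2) unfolding continuous_at tendsto_iff eventually_nhds_conv_at by simp
  moreover obtain e1 where e1: "e1 > 0" "h holomorphic_on ball 0 e1" using h(2) by (auto simp: analytic_at_ball)
  moreover obtain e2 where e2: "e2 > 0" "Q holomorphic_on ball 0 e2" using Q(1) by (auto simp: analytic_at_ball)
  ultimately have "\<forall>\<^sub>F z in nhds 0. dist (Q z) 1 < 1 \<and> \<phi> (h z) = exp z * \<phi> z"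
    using eq by (intro eventually_conj)
  then obtain e3 where e3: "e3 > 0" "\<And>z. norm z < e3 \<Longrightarrow> dist (Q z) 1 < 1 \<and> \<phi> (h z) = exp z * \<phi> z"
    unfolding eventually_nhds_metric by auto
  define r where "r = Min {e1, e2, e3}"
  have r: "r > 0" "r \<le> e1" "r \<le> e2" "r \<le> e3" using e1 e2 e3 by (auto simp: r_def)
  show ?thesis
  proof (rule that[OF r(1)])
    fix V H z assume V: "petal h (-1) V" "V \<subseteq> ball 0 r" and H: "principal_part h V H" and z: "z \<in> V"
    define L where "L z = Ln2pi z + Ln (Q z)" for z
    define D where "D z = L (h z) - L z - z" for z
    have hV: "h y \<in> V" if "y \<in> V" for y using V(1) that unfolding petal_def by blast
    have nn: "y \<notin> \<real>\<^sub>\<ge>\<^sub>0" if "y \<in> V" for y using petal_not_nonneg_Reals[OF V(1) that] .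
    have Qre: "0 < Re (Q y)" if "y \<in> V" for y
    proof -
      have "norm (Q y - 1) < 1" using e3(2)[of y] V(2) r(4) that by (auto simp: dist_norm)
      then show ?thesis using abs_Re_le_cmod[of "Q y - 1"] by simp
    qed
    have Qnp: "Q y \<notin> \<real>\<^sub>\<le>\<^sub>0" if "y \<in> V" for y using Qre[OF that] by (auto simp: complex_nonpos_Reals_iff)
    have mnp: "- y \<notin> \<real>\<^sub>\<le>\<^sub>0" if "y \<in> V" for y
      using nn[OF that] by (simp add: complex_nonpos_Reals_iff complex_nonneg_Reals_iff)
    have L_eq: "L y = Ln (- y) + \<i> * of_real pi + Ln (Q y)" if "y \<in> V" for y
      using nn[OF that] by (simp add: L_def Ln2pi_eq_Ln)
    have exp_L: "exp (L y) = \<phi> y" if "y \<in> V" for y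
    proof -
      have "y \<noteq> 0" "Q y \<noteq> 0" using nn[OF that] Qre[OF that] by auto
      then show ?thesis unfolding L_eq[OF that] Q(3) by (simp add: exp_add)
    qed
    have contQ: "continuous_on V Q"
      using e2(2) V(2) r(3) by (intro holomorphic_on_imp_continuous_on) (auto elim!: holomorphic_on_subset)
    have conth: "continuous_on V h"
      using e1(2) V(2) r(2) by (intro holomorphic_on_imp_continuous_on) (auto elim!: holomorphic_on_subset)
    have contL: "continuous_on V L"
    proof (rule continuous_on_eq)
      show "continuous_on V (\<lambda>y. Ln (- y) + \<i> * of_real pi + Ln (Q y))"
        by (intro continuous_intros contQ Qnp mnp)
    qed (simp add: L_eq)
    have contD: "continuous_on V D"
      unfolding D_def by (intro continuous_intros contL continuous_on_compose2[OF contL conth]) (use hV in auto)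
    have expD: "exp (D y) = 1" if "y \<in> V" for y
    proof -
      have "\<phi> (h y) = exp y * \<phi> y" using e3(2)[of y] V(2) r(4) that by auto
      moreover have "\<phi> y \<noteq> 0" unfolding exp_L[OF that, symmetric] by simp
      ultimately show ?thesis unfolding D_def exp_diff exp_L[OF that] exp_L[OF hV[OF that]] by simp
    qed
    have "D constant_on V"
    proof (rule continuous_discrete_range_constant[OF _ contD])
      show "connected V" using V(1) by (simp add: petal_def)
      fix x assume x: "x \<in> V"
      have "2 * pi \<le> norm (D y - D x)" if y: "y \<in> V" "D y \<noteq> D x" for y
      proof -
        have "exp (D y - D x) = 1" using expD[OF x] expD[OF y(1)] by (simp add: exp_diff)
        then obtain n :: int where n: "Re (D y - D x) = 0" "Im (D y - D x) = of_int (2 * n) * pi" unfolding exp_eq_1 by blast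
        with y(2) have "n \<noteq> 0" by (auto simp: complex_eq_iff)
        then have "1 \<le> \<bar>real_of_int n\<bar>" by linarith
        then have "2 * pi \<le> \<bar>Im (D y - D x)\<bar>" unfolding n(2) by (simp add: abs_mult)
        then show ?thesis using abs_Im_le_cmod[of "D y - D x"] by linarith
      qed
      then show "\<exists>e>0. \<forall>y. y \<in> V \<and> D y \<noteq> D x \<longrightarrow> e \<le> norm (D y - D x)"
        by (intro exI[of _ "2 * pi"]) auto
    qed
    then obtain d where d: "\<And>y. y \<in> V \<Longrightarrow> D y = d" unfolding constant_on_def by blast
    define x where "x n = (h ^^ n) z" for n
    obtain C where "parabolic_sequence (\<lambda>n. (h ^^ n) z) C" using petal_orbit_parabolic_sequence[OF h(1) V(1) z] by blast
    then have ps: "parabolic_sequence x C" by (simp add: x_def[abs_def])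
    have xV: "x n \<in> V" and x_Suc: "x (Suc n) = h (x n)" for n using petal_orbit(1)[OF V(1) z] by (auto simp: x_def)
    have x0: "x \<longlonglongrightarrow> 0" using parabolic_sequence.z_tendsto_0[OF ps] .
    have "(\<lambda>k. Q (x k)) \<longlonglongrightarrow> Q 0" by (rule isCont_tendsto_compose[OF Q1 x0])
    then have "(\<lambda>k. Ln (Q (x k))) \<longlonglongrightarrow> Ln 1" unfolding Q(2) by (rule tendsto_Ln) simp
    then have "(\<lambda>k. (Ln2pi (x k) + of_real (ln (real k))) + Ln (Q (x k))) \<longlonglongrightarrow> \<i> * of_real pi + Ln 1"
      by (intro tendsto_add Ln2pi_along_orbit[OF ps] nn xV)
    then have Lx: "(\<lambda>k. L (x k) + of_real (ln (real k))) \<longlonglongrightarrow> \<i> * of_real pi"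
      by (simp add: L_def algebra_simps)
    have LxS: "(\<lambda>k. L (x (Suc k)) + of_real (ln (real k))) \<longlonglongrightarrow> \<i> * of_real pi"
      by (rule tendsto_plus_ln_shift[OF Lx])
    have "(\<lambda>k. (L (x (Suc k)) + of_real (ln (real k))) - (L (x k) + of_real (ln (real k))) - x k) \<longlonglongrightarrow> \<i> * of_real pi - \<i> * of_real pi - 0"
      by (intro tendsto_diff LxS Lx x0)
    moreover have "(L (x (Suc k)) + of_real (ln (real k))) - (L (x k) + of_real (ln (real k))) - x k = d" for k
      using d[OF xV[of k]] by (simp add: D_def x_Suc)
    ultimately have d0: "d = 0" by (simp add: LIMSEQ_const_iff)
    have xk: "x k = L (x (Suc k)) - L (x k)" for k using d[OF xV[of k]] unfolding d0 D_def x_Suc by (simp add: algebra_simps)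
    have S: "(\<Sum>n\<le>k. x n) = L (x (Suc k)) - L (x 0)" for k
    proof (induction k)
      case 0
      show ?case using xk[of 0] by simp
    next
      case (Suc k)
      have "r - s + p = q - s" if "p = q - r" for p q r s :: complex using that by simp
      from this[OF xk[of "Suc k"]] show ?case unfolding sum.atMost_Suc Suc.IH .
    qed
    have "(\<lambda>k. (\<Sum>n\<le>k. x n) + of_real (ln (real k))) = (\<lambda>k. (L (x (Suc k)) + of_real (ln (real k))) - L (x 0))"
      unfolding S by (intro ext) simp
    then have "(\<lambda>k. (\<Sum>n\<le>k. (h ^^ n) z) + of_real (ln (real k))) \<longlonglongrightarrow> \<i> * of_real pi - L z"
      using tendsto_diff[OF LxS tendsto_const[of "L z"]] by (simp add: x_def)
    from principal_part_value[OF h(1) V(1) z H this]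
    have "H z = of_real pi * (\<i> * of_real pi - L z) - of_real (pi / 4)" .
    moreover have "\<phi> z / z = Q z" using nn[OF z] by (auto simp: Q(3))
    ultimately show "H z = \<i> * of_real (pi ^ 2) - of_real (pi / 4) - of_real pi * (Ln2pi z + Ln (\<phi> z / z))"
      by (simp add: L_def algebra_simps power2_eq_square)
  qed
qed

section \<open>Germs of exponential form\<close>

lemma isCont_imp_filterlim_nhds:
  fixes F :: "complex \<Rightarrow> complex"
  assumes "isCont F 0" "F 0 = 0"
  shows "filterlim F (nhds 0) (nhds 0)"
  using assms tendsto_at_iff_tendsto_nhds[of F 0] by (simp add: isCont_def)

lemma tendsto_petal_map:
  fixes h :: "complex \<Rightarrow> complex"
  assumes h: "h analytic_on {0}" "h 0 = 0" and V: "petal h d V"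
  shows "filterlim h (at 0 within V) (at 0 within V)"
proof -
  have "(h \<longlongrightarrow> 0) (at 0)" using analytic_at_imp_isCont[OF h(1)] h(2) by (simp add: isCont_def)
  then have "(h \<longlongrightarrow> 0) (at 0 within V)" by (rule tendsto_within_subset) simp
  moreover have "h z \<in> V \<and> h z \<noteq> 0" if "z \<in> V" for z
    using petal_orbit(1,2)[OF V that, of 1] by simp
  then have "\<forall>\<^sub>F z in at 0 within V. h z \<in> V \<and> h z \<noteq> 0" by (simp add: eventually_at_filter)
  ultimately show ?thesis by (simp add: filterlim_at)
qed

lemma exp_form_functional_equation:
  assumes f: "f analytic_on {0}" "f 0 = 0" and \<phi>: "exp_form f \<phi>"
  shows "\<forall>\<^sub>F z in nhds 0. \<phi> (f z) = exp z * \<phi> z"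
proof -
  obtain \<psi> where \<phi>a: "\<phi> analytic_on {0}" "\<phi> 0 = 0" and \<psi>: "inverse_germ \<phi> \<psi>"
    and eq: "\<forall>\<^sub>F z in nhds 0. f z = \<psi> (exp z * \<phi> z)" using \<phi> unfolding exp_form_def by blast
  have inv: "\<forall>\<^sub>F w in nhds 0. \<phi> (\<psi> w) = w"
    using \<psi> unfolding inverse_germ_def by (auto elim: eventually_mono)
  have "isCont \<phi> 0" using \<phi>a(1) by (rule analytic_at_imp_isCont)
  then have "isCont (\<lambda>z. exp z * \<phi> z) 0" by (intro continuous_intros)
  then have "filterlim (\<lambda>z. exp z * \<phi> z) (nhds 0) (nhds 0)"
    by (rule isCont_imp_filterlim_nhds) (use \<phi>a(2) in simp)
  from eventually_compose_filterlim[OF inv this] eq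
  show ?thesis by eventually_elim simp
qed

text \<open>The quotient of two solutions is invariant under \<open>f\<close> and tends to 1 along
  an orbit, so it equals 1 on the tail of the orbit. The tail accumulates at 0, and the identity
  theorem applies.\<close>

lemma exp_form_unique:
  assumes f: "f analytic_on {0}" "f 0 = 0" "near_translation f" and V: "petal f d V" "z \<in> V"
    and \<phi>: "exp_form f \<phi>" "exp_form f \<theta>"
  shows "\<forall>\<^sub>F z in nhds 0. \<phi> z = \<theta> z"
proof -
  obtain P where P: "P analytic_on {0}" "P 0 = 1" "\<And>z. \<phi> z = z * P z"
    using germ_quotient[of \<phi>] \<phi>(1) unfolding exp_form_def by metis
  obtain Q where Q: "Q analytic_on {0}" "Q 0 = 1" "\<And>z. \<theta> z = z * Q z"
    using germ_quotient[of \<theta>] \<phi>(2) unfolding exp_form_def by metis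
  define x where "x n = (f ^^ n) z" for n
  obtain C where "parabolic_sequence (\<lambda>n. (f ^^ n) z) C" using petal_orbit_parabolic_sequence[OF f(3) V] by blast
  then have ps: "parabolic_sequence x C" by (simp add: x_def[abs_def])
  have x0: "x \<longlonglongrightarrow> 0" using parabolic_sequence.z_tendsto_0[OF ps] .
  have xn: "x n \<noteq> 0" "x (Suc n) = f (x n)" for n using petal_orbit(2)[OF V] by (auto simp: x_def)
  have "(\<lambda>n. Q (x n)) \<longlonglongrightarrow> 1" "(\<lambda>n. P (x n)) \<longlonglongrightarrow> 1"
    using isCont_tendsto_compose[OF analytic_at_imp_isCont[OF Q(1)] x0]
      isCont_tendsto_compose[OF analytic_at_imp_isCont[OF P(1)] x0] P(2) Q(2) by auto
  then have lim: "(\<lambda>n. P (x n) / Q (x n)) \<longlonglongrightarrow> 1 / 1" by (intro tendsto_divide) auto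
  have "\<forall>\<^sub>F n in sequentially. Q (x n) \<noteq> 0"
    using \<open>(\<lambda>n. Q (x n)) \<longlonglongrightarrow> 1\<close> by (rule tendsto_imp_eventually_ne) simp
  then have "\<forall>\<^sub>F n in sequentially. P (x (Suc n)) / Q (x (Suc n)) = P (x n) / Q (x n) \<and> Q (x n) \<noteq> 0"
    using eventually_compose_filterlim[OF exp_form_functional_equation[OF f(1,2) \<phi>(1)] x0]
      eventually_compose_filterlim[OF exp_form_functional_equation[OF f(1,2) \<phi>(2)] x0]
  proof eventually_elim
    case (elim n)
    have "\<phi> (x (Suc n)) / \<theta> (x (Suc n)) = \<phi> (x n) / \<theta> (x n)" using elim(2,3) by (simp add: xn(2))
    then show ?case using elim(1) xn(1)[of n] xn(1)[of "Suc n"] by (simp add: P(3) Q(3))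
  qed
  then obtain N where N: "\<And>n. N \<le> n \<Longrightarrow> P (x (Suc n)) / Q (x (Suc n)) = P (x n) / Q (x n)" "\<And>n. N \<le> n \<Longrightarrow> Q (x n) \<noteq> 0"
    unfolding eventually_sequentially by blast
  have const: "P (x n) / Q (x n) = P (x N) / Q (x N)" if "N \<le> n" for n
    using that by (induction n rule: dec_induct) (use N(1) in auto)
  have "(\<lambda>n. P (x n) / Q (x n)) \<longlonglongrightarrow> P (x N) / Q (x N)"
  proof (rule tendsto_eventually)
    show "\<forall>\<^sub>F n in sequentially. P (x n) / Q (x n) = P (x N) / Q (x N)"
      unfolding eventually_sequentially using const by blast
  qed
  from LIMSEQ_unique[OF this lim] have one: "P (x N) / Q (x N) = 1" by simp
  have PQ: "P (x n) - Q (x n) = 0" if "N \<le> n" for n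
    using const[OF that] N(2)[OF that] unfolding one by simp
  obtain e where e: "e > 0" "(\<lambda>z. P z - Q z) holomorphic_on ball 0 e"
    using analytic_on_diff[OF P(1) Q(1)] by (auto simp: analytic_at_ball)
  define U where "U = {y \<in> ball 0 e. P y - Q y = 0} "
  have lp: "0 islimpt U"
    unfolding islimpt_approachable
  proof (intro allI impI)
    fix d :: real assume "0 < d"
    then have "\<forall>\<^sub>F n in sequentially. dist (x n) 0 < min d e" using e(1) by (intro tendstoD[OF x0]) simp
    then obtain n where "dist (x n) 0 < min d e" "N \<le> n"
      using eventually_happens'[OF _ eventually_conj[OF _ eventually_ge_at_top[of N]]] by fastforce
    then show "\<exists>y\<in>U. y \<noteq> 0 \<and> dist y 0 < d" using PQ xn(1) by (intro bexI[of _ "x n"]) (auto simp: U_def)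
  qed
  have "P y - Q y = 0" if "y \<in> ball 0 e" for y
    by (rule analytic_continuation[OF e(2) open_ball connected_ball _ _ lp _ that])
      (use e(1) in \<open>auto simp: U_def\<close>)
  then have "\<forall>y\<in>ball 0 e. \<phi> y = \<theta> y" by (simp add: P(3) Q(3))
  then show ?thesis using e(1) by (intro eventually_nhds[THEN iffD2] exI[of _ "ball 0 e"]) auto
qed

lemma inverse_germ_exists:
  assumes "\<phi> analytic_on {0}" "\<phi> 0 = 0" "deriv \<phi> 0 = 1"
  shows "\<exists>\<psi>. inverse_germ \<phi> \<psi>"
proof -
  obtain e where e: "e > 0" "\<phi> holomorphic_on ball 0 e" using assms(1) by (auto simp: analytic_at_ball)
  have 0: "(0::complex) \<in> ball 0 e" "deriv \<phi> 0 \<noteq> 0" using e(1) assms(3) by auto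
  obtain r where r: "r > 0" "ball (0::complex) r \<subseteq> ball 0 e" "open (\<phi> ` ball 0 r)" "inj_on \<phi> (ball 0 r)"
    by (rule has_complex_derivative_locally_invertible[OF e(2) 0(1) open_ball 0(2)]) (rule that)
  have hol: "\<phi> holomorphic_on ball 0 r" using e(2) r(2) by (rule holomorphic_on_subset)
  obtain \<psi> where \<psi>: "\<psi> holomorphic_on \<phi> ` ball 0 r" "\<And>z. z \<in> ball 0 r \<Longrightarrow> \<psi> (\<phi> z) = z"
    by (rule holomorphic_has_inverse[OF hol open_ball r(4)]) (rule that)
  have 0: "0 \<in> \<phi> ` ball 0 r" using assms(2) r(1) by (metis centre_in_ball imageI)
  have "\<psi> analytic_on {0}" using \<psi>(1) r(3) 0 by (auto simp: analytic_at)
  moreover have "\<psi> 0 = 0" using \<psi>(2)[of 0] assms(2) r(1) by simp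
  moreover have "\<forall>\<^sub>F z in nhds 0. \<psi> (\<phi> z) = z"
    using eventually_nhds_in_open[of "ball 0 r" 0] r(1) \<psi>(2) by (auto elim: eventually_mono)
  moreover have "\<forall>\<^sub>F z in nhds 0. \<phi> (\<psi> z) = z"
    using eventually_nhds_in_open[OF r(3) 0] by eventually_elim (auto simp: \<psi>(2))
  ultimately show ?thesis unfolding inverse_germ_def by (intro exI[of _ \<psi>]) (auto intro: eventually_conj)
qed

text \<open>Exponentiating the relation H z - H (f z) = pi z gives the functional equation on the
  petal near 0, free of branch questions because exp undoes \<open>Ln2pi\<close>. The identity
  theorem extends it to a full neighbourhood of 0.\<close>

lemma glue_imp_exp_form:
  assumes f: "f analytic_on {0}" "f 0 = 0" "near_translation f"
    and V: "petal f (-1) V" and H: "principal_part f V H"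
    and G: "G analytic_on {0}" and glue: "\<forall>\<^sub>F z in at 0 within V. H z - c + of_real pi * Ln2pi z = G z"
  shows "\<exists>\<phi>. exp_form f \<phi>"
proof -
  \<comment> \<open>Subtracting \<open>G 0\<close> multiplies \<open>\<phi>\<close> by a constant,
    which leaves the functional equation intact and makes the derivative at 0 equal to 1.\<close>
  define E where "E z = exp (- (G z - G 0) / of_real pi)" for z
  define \<phi> where "\<phi> z = z * E z" for z
  have Ea: "E analytic_on {0}" unfolding E_def using G by (intro analytic_intros) auto
  have \<phi>a: "\<phi> analytic_on {0}" unfolding \<phi>_def using Ea by (intro analytic_intros)
  have \<phi>0: "\<phi> 0 = 0" by (simp add: \<phi>_def)
  have \<phi>1: "deriv \<phi> 0 = 1" unfolding \<phi>_def deriv_ident_mult[OF Ea] by (simp add: E_def)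
  have nn: "z \<noteq> 0" if "z \<in> V" for z using petal_not_nonneg_Reals[OF V that] by auto
  have expLn: "exp (Ln2pi z) = z" if "z \<in> V" for z
    using petal_not_nonneg_Reals[OF V that] nn[OF that] by (simp add: Ln2pi_eq_Ln exp_add)
  have "\<forall>\<^sub>F z in at 0 within V. z \<in> V" by (simp add: eventually_at_filter)
  then have func: "\<forall>\<^sub>F z in at 0 within V. \<phi> (f z) = exp z * \<phi> z"
    using glue eventually_compose_filterlim[OF glue tendsto_petal_map[OF f(1,2) V]]
  proof eventually_elim
    case (elim z)
    have fz: "f z \<in> V" using V elim(1) unfolding petal_def by blast
    have "H z - H (f z) = of_real pi * z" by (rule principal_part_cohomological[OF f(3) V elim(1) H])
    then have "- (G (f z) - G 0) = - (G z - G 0) + of_real pi * (z + Ln2pi z - Ln2pi (f z))"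
      unfolding elim(2,3)[symmetric] by (simp add: algebra_simps)
    then have "- (G (f z) - G 0) / of_real pi = - (G z - G 0) / of_real pi + (z + Ln2pi z - Ln2pi (f z))"
      by (simp only: add_divide_distrib) simp
    then have "E (f z) = E z * (exp z * z / f z)"
      unfolding E_def by (simp only: exp_add exp_diff expLn[OF elim(1)] expLn[OF fz])
    then show ?case using nn[OF fz] by (simp add: \<phi>_def)
  qed
  have "isCont f 0" using f(1) by (rule analytic_at_imp_isCont)
  define F where "F z = \<phi> (f z) - exp z * \<phi> z" for z
  have "(\<phi> \<circ> f) analytic_on {0}" using f \<phi>a by (intro analytic_on_compose) auto
  then have "F analytic_on {0}" unfolding F_def using \<phi>a by (auto simp: o_def intro!: analytic_intros)
  then obtain e where e: "e > 0" "F holomorphic_on ball 0 e" by (auto simp: analytic_at_ball)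
  obtain \<delta> where \<delta>: "\<delta> > 0" "\<And>z. z \<in> V \<Longrightarrow> dist z 0 < \<delta> \<Longrightarrow> \<phi> (f z) = exp z * \<phi> z"
    using func nn unfolding eventually_at by blast
  obtain \<rho> where \<rho>: "\<rho> > 0" "\<And>t. 0 < t \<Longrightarrow> t < \<rho> \<Longrightarrow> of_real t * (-1) \<in> V"
    by (rule petal_contains_ray[OF V]) auto
  \<comment> \<open>The petal contains a segment of the negative real axis ending at 0, which
    supplies the accumulating zeros.\<close>
  have lp: "0 islimpt {y \<in> ball 0 e. F y = 0}"
    unfolding islimpt_approachable
  proof (intro allI impI)
    fix d :: real assume d: "0 < d"
    define t where "t = Min {d, e, \<delta>, \<rho>} / 2"
    have t: "0 < t" "t < d" "t < e" "t < \<delta>" "t < \<rho>" using d e(1) \<delta>(1) \<rho>(1) by (auto simp: t_def)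
    define y where "y = complex_of_real t * (-1)"
    have "y \<in> V" "norm y = t" using \<rho>(2)[OF t(1,5)] t(1) by (auto simp: y_def)
    then show "\<exists>y\<in>{y \<in> ball 0 e. F y = 0}. y \<noteq> 0 \<and> dist y 0 < d"
      using \<delta>(2)[of y] t by (intro bexI[of _ y]) (auto simp: F_def)
  qed
  have "F y = 0" if "y \<in> ball 0 e" for y
    by (rule analytic_continuation[OF e(2) open_ball connected_ball _ _ lp _ that]) (use e(1) in auto)
  then have eqn: "\<forall>\<^sub>F z in nhds 0. \<phi> (f z) = exp z * \<phi> z"
    using eventually_nhds_in_open[of "ball 0 e" 0] e(1) by (auto elim!: eventually_mono simp: F_def)
  obtain \<psi> where \<psi>: "inverse_germ \<phi> \<psi>" using inverse_germ_exists[OF \<phi>a \<phi>0 \<phi>1] by blast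
  have "filterlim f (nhds 0) (nhds 0)" using \<open>isCont f 0\<close> f(2) by (rule isCont_imp_filterlim_nhds)
  moreover have "\<forall>\<^sub>F z in nhds 0. \<psi> (\<phi> z) = z"
    using \<psi> unfolding inverse_germ_def by (auto elim: eventually_mono)
  ultimately have "\<forall>\<^sub>F z in nhds 0. \<psi> (\<phi> (f z)) = f z" by (rule eventually_compose_filterlim[rotated])
  with eqn have "\<forall>\<^sub>F z in nhds 0. f z = \<psi> (exp z * \<phi> z)" by eventually_elim simp
  then show ?thesis unfolding exp_form_def using \<phi>a \<phi>0 \<phi>1 \<psi> by blast
qed

lemma petal_uminus:
  assumes "petal g 1 V"
  shows "petal (\<lambda>z. - g (- z)) (-1) (uminus ` V)"
proof -
  have iter: "((\<lambda>z. - g (- z)) ^^ n) (- z) = - (g ^^ n) z" for n z by (induction n) auto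
  show ?thesis
    unfolding petal_def
  proof (intro conjI allI ballI impI)
    show "open (uminus ` V)" using assms by (simp add: petal_def open_negations)
    show "connected (uminus ` V)" using assms unfolding petal_def
      by (intro connected_continuous_image continuous_intros) auto
    show "(\<lambda>z. - g (- z)) ` uminus ` V \<subseteq> uminus ` V" using assms by (auto simp: petal_def)
    show "(\<lambda>n. ((\<lambda>z. - g (- z)) ^^ n) z) \<longlonglongrightarrow> 0" if "z \<in> uminus ` V" for z
    proof -
      obtain y where y: "y \<in> V" "z = - y" using \<open>z \<in> uminus ` V\<close> by blast
      have "(\<lambda>n. (g ^^ n) y) \<longlonglongrightarrow> 0" using assms y(1) by (simp add: petal_def)
      then show ?thesis unfolding y(2) iter using tendsto_minus by fastforce
    qed
    show "\<exists>\<rho>>0. \<forall>z. 0 < norm z \<and> norm z < \<rho> \<and> \<bar>Arg (z / - 1)\<bar> < \<alpha> \<longrightarrow> z \<in> uminus ` V"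
      if "0 < \<alpha> \<and> \<alpha> < pi" for \<alpha>
    proof -
      obtain \<rho> where \<rho>: "\<rho> > 0" "\<And>z. 0 < norm z \<and> norm z < \<rho> \<and> \<bar>Arg (z / 1)\<bar> < \<alpha> \<Longrightarrow> z \<in> V"
        using assms \<open>0 < \<alpha> \<and> \<alpha> < pi\<close> unfolding petal_def by blast
      have "z \<in> uminus ` V" if "0 < norm z \<and> norm z < \<rho> \<and> \<bar>Arg (z / - 1)\<bar> < \<alpha>" for z
        using \<rho>(2)[of "- z"] that by (intro image_eqI[of _ _ "- z"]) auto
      then show ?thesis using \<rho>(1) by blast
    qed
    show "- complex_of_real t * - 1 \<notin> uminus ` V" if "0 \<le> t" for t
    proof
      assume "- complex_of_real t * - 1 \<in> uminus ` V"
      then have "- complex_of_real t * 1 \<in> V" by force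
      then show False using assms that unfolding petal_def by blast
    qed
  qed
qed

section \<open>The repelling petal\<close>

lemma lborel_distr_uminus_euclidean: "distr lborel borel uminus = (lborel :: 'a :: euclidean_space measure)"
  using lborel_affine[of "- 1" "0 :: 'a"] by (simp add: density_1)

lemma directed_area_uminus:
  "directed_area (\<lambda>z. - g (- z)) (- z) \<epsilon> = - directed_area g z \<epsilon>"
proof -
  have iter: "((\<lambda>z. - g (- z)) ^^ n) (- z) = - (g ^^ n) z" for n by (induction n) auto
  define N where "N = (\<Union>n. ball ((g ^^ n) z) \<epsilon>)"
  have N': "(\<Union>n. ball (((\<lambda>z. - g (- z)) ^^ n) (- z)) \<epsilon>) = uminus -` N"
    unfolding N_def iter by (auto simp: dist_minus[of "- _", symmetric] dist_norm norm_minus_commute add.commute)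
  have meas: "N \<in> sets borel" unfolding N_def by (intro borel_open open_UN) auto
  have meas': "uminus -` N \<in> sets borel"
    using measurable_sets_borel[OF borel_measurable_uminus[OF measurable_ident] meas] by simp
  have "measure lborel (uminus -` N) = measure (distr lborel borel uminus) N"
    using meas by (subst measure_distr) auto
  then have area: "area (uminus -` N) = area N" unfolding area_def lborel_distr_uminus_euclidean .
  have "(LINT w:uminus -` N|lborel. w) = (LINT w|distr lborel borel uminus. indicat_real (uminus -` N) w *\<^sub>R w)"
    unfolding set_lebesgue_integral_def lborel_distr_uminus_euclidean ..
  also have "\<dots> = (LINT w|lborel. indicat_real (uminus -` N) (- w) *\<^sub>R (- w))"
    using meas' by (intro integral_distr) auto
  also have "\<dots> = (LINT w|lborel. - (indicat_real N w *\<^sub>R w))" by (simp add: indicator_def)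
  also have "\<dots> = - (LINT w:N|lborel. w)" unfolding set_lebesgue_integral_def by simp
  finally show ?thesis
    unfolding directed_area_def Let_def eps_neighborhood_orbit center_of_mass_def N' area N_def[symmetric] by simp
qed

lemma principal_part_uminus:
  assumes "principal_part g V H"
  shows "principal_part (\<lambda>z. - g (- z)) (uminus ` V) (\<lambda>z. - H (- z))"
proof -
  obtain q1 q2 where q: "\<And>z. z \<in> V \<Longrightarrow> (\<lambda>\<epsilon>. directed_area g z \<epsilon> -
        (q1 * of_real (\<epsilon> ^ 2 * ln \<epsilon>) + H z * of_real (\<epsilon> ^ 2) + q2 * of_real (\<epsilon> powr (5 / 2) * ln \<epsilon>)))
     \<in> O[at_right 0](\<lambda>\<epsilon>. of_real (\<epsilon> powr (5 / 2)))"
    using assms unfolding principal_part_def by blast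
  show ?thesis
    unfolding principal_part_def
  proof (rule exI[of _ "- q1"], rule exI[of _ "- q2"], rule ballI)
    fix z assume "z \<in> uminus ` V"
    then obtain y where y: "y \<in> V" "z = - y" by blast
    have "(\<lambda>\<epsilon>. directed_area (\<lambda>z. - g (- z)) z \<epsilon> - (- q1 * of_real (\<epsilon> ^ 2 * ln \<epsilon>) + - H (- z) * of_real (\<epsilon> ^ 2) + - q2 * of_real (\<epsilon> powr (5 / 2) * ln \<epsilon>)))
      = (\<lambda>\<epsilon>. - (directed_area g y \<epsilon> - (q1 * of_real (\<epsilon> ^ 2 * ln \<epsilon>) + H y * of_real (\<epsilon> ^ 2) + q2 * of_real (\<epsilon> powr (5 / 2) * ln \<epsilon>))))"
      unfolding y(2) directed_area_uminus by (intro ext) (simp add: algebra_simps)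
    then show "(\<lambda>\<epsilon>. directed_area (\<lambda>z. - g (- z)) z \<epsilon> - (- q1 * of_real (\<epsilon> ^ 2 * ln \<epsilon>) + - H (- z) * of_real (\<epsilon> ^ 2) + - q2 * of_real (\<epsilon> powr (5 / 2) * ln \<epsilon>)))
      \<in> O[at_right 0](\<lambda>\<epsilon>. of_real (\<epsilon> powr (5 / 2)))"
      using q[OF y(1)] by (simp only: landau_o.big.uminus_in_iff)
  qed
qed

lemma filterlim_uminus_within:
  "filterlim (uminus :: complex \<Rightarrow> complex) (at 0 within uminus ` V) (at 0 within V)"
proof -
  have "((uminus :: complex \<Rightarrow> complex) \<longlongrightarrow> - 0) (at 0 within V)" by (intro tendsto_intros)
  then show ?thesis by (simp add: filterlim_at eventually_at_filter)
qed

text \<open>The reflection \<open>z \<mapsto> -z\<close> turns the repelling petal of \<open>f\<close> into an attracting petal of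
  \<open>z \<mapsto> -g(-z)\<close>, for which \<open>exp (- z) * (- \<phi> (- z))\<close> plays the role of \<open>\<phi>\<close>.\<close>
lemma reflected_functional_equation:
  assumes g: "inverse_germ f g" and eq: "\<forall>\<^sub>F z in nhds 0. \<phi> (f z) = exp z * \<phi> z"
  shows "\<forall>\<^sub>F z in nhds 0. exp (- (- g (- z))) * (- \<phi> (- (- g (- z)))) = exp z * (exp (- z) * (- \<phi> (- z)))"
proof -
  have ga: "g analytic_on {0}" "g 0 = 0" and fg: "\<forall>\<^sub>F z in nhds 0. f (g z) = z"
    using g unfolding inverse_germ_def by (auto elim: eventually_mono)
  have "filterlim g (nhds 0) (nhds 0)"
    by (rule isCont_imp_filterlim_nhds[OF analytic_at_imp_isCont[OF ga(1)] ga(2)])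
  from eventually_compose_filterlim[OF eq this] fg
  have *: "\<forall>\<^sub>F z in nhds 0. \<phi> z = exp (g z) * \<phi> (g z)" by eventually_elim simp
  have "filterlim (uminus :: complex \<Rightarrow> complex) (nhds 0) (nhds 0)"
    by (rule isCont_imp_filterlim_nhds) (auto intro!: continuous_intros)
  from eventually_compose_filterlim[OF * this]
  show ?thesis by eventually_elim (simp add: exp_minus)
qed

text \<open>On the reflected repelling petal two germs are needed: \<open>\<phi>2\<close>, with the
  factor exp (-z), satisfies the functional equation and yields the value of H;
  \<open>\<phi>'\<close>, without it, compares the branches of Ln (\<phi> z) and Ln z.\<close>

lemma exp_form_principal_parts:
  assumes f: "prenormalized f" and g: "inverse_germ f g" and \<phi>: "exp_form f \<phi>"
  obtains r where "r > 0"
    "\<And>V H. attracting_petal f V \<Longrightarrow> V \<subseteq> ball 0 r \<Longrightarrow> principal_part f V H \<Longrightarrow>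
       (\<forall>\<^sub>F z in at 0 within V. H z = \<i> * of_real (pi ^ 2) - of_real (pi / 4) - of_real pi * (Ln2pi z + Ln (\<phi> z / z)) \<and>
         Ln2pi (\<phi> z) = Ln2pi z + Ln (\<phi> z / z))"
    "\<And>V H. repelling_petal g V \<Longrightarrow> V \<subseteq> ball 0 r \<Longrightarrow> principal_part g V H \<Longrightarrow>
       (\<forall>\<^sub>F z in at 0 within V. H z = of_real (pi / 4) + of_real pi * (z + Ln z + Ln (\<phi> z / z)) \<and>
         Ln (\<phi> z) = Ln z + Ln (\<phi> z / z))"
proof -
  have fa: "f analytic_on {0}" "f 0 = 0" using f by (auto simp: prenormalized_def)
  have nf: "near_translation f" using f by (rule prenormalized_near_translation)
  have \<phi>a: "\<phi> analytic_on {0}" "\<phi> 0 = 0" "deriv \<phi> 0 = 1" using \<phi> by (auto simp: exp_form_def)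
  have eq: "\<forall>\<^sub>F z in nhds 0. \<phi> (f z) = exp z * \<phi> z" by (rule exp_form_functional_equation[OF fa \<phi>])
  obtain Q where Q: "Q analytic_on {0}" "Q 0 = 1" "\<And>z. \<phi> z = z * Q z" by (rule germ_quotient[OF \<phi>a]) blast
  define G where "G z = - g (- z)" for z
  define \<phi>' where "\<phi>' z = - \<phi> (- z)" for z
  define \<phi>2 where "\<phi>2 z = exp (- z) * (- \<phi> (- z))" for z
  have ga: "g analytic_on {0}" "g 0 = 0" using g by (auto simp: inverse_germ_def)
  have refl: "(\<lambda>z. F (- z)) analytic_on {0}" if "F analytic_on {0}" for F :: "complex \<Rightarrow> complex"
  proof -
    have "(F \<circ> uminus) analytic_on {0}" using that by (intro analytic_on_compose) (auto intro!: analytic_intros)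
    then show ?thesis by (simp add: o_def)
  qed
  have Ga: "G analytic_on {0}" unfolding G_def using refl[OF ga(1)] by (rule analytic_on_neg)
  have nG: "near_translation G" unfolding G_def by (rule inverse_germ_near_translation[OF nf fa(2) g])
  have Q': "(\<lambda>z. Q (- z)) analytic_on {0}" by (rule refl[OF Q(1)])
  have \<phi>'_eq: "\<phi>' = (\<lambda>z. z * Q (- z))" and \<phi>2_eq: "\<phi>2 = (\<lambda>z. z * (exp (- z) * Q (- z)))"
    by (auto simp: \<phi>'_def \<phi>2_def Q(3))
  have \<phi>'a: "\<phi>' analytic_on {0}" "\<phi>' 0 = 0" "deriv \<phi>' 0 = 1"
    unfolding \<phi>'_eq using Q' deriv_ident_mult[OF Q'] Q(2) by (auto intro!: analytic_intros)
  have eQ: "(\<lambda>z. exp (- z) * Q (- z)) analytic_on {0}" using Q' by (intro analytic_intros)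
  have \<phi>2a: "\<phi>2 analytic_on {0}" "\<phi>2 0 = 0" "deriv \<phi>2 0 = 1"
    unfolding \<phi>2_eq using eQ deriv_ident_mult[OF eQ] Q(2) by (auto intro!: analytic_intros)
  have eq2: "\<forall>\<^sub>F z in nhds 0. \<phi>2 (G z) = exp z * \<phi>2 z"
    unfolding \<phi>2_def G_def by (rule reflected_functional_equation[OF g eq])
  obtain r1 where r1: "r1 > 0" "\<And>V H z. petal f (-1) V \<Longrightarrow> V \<subseteq> ball 0 r1 \<Longrightarrow> principal_part f V H \<Longrightarrow> z \<in> V \<Longrightarrow>
    H z = \<i> * of_real (pi ^ 2) - of_real (pi / 4) - of_real pi * (Ln2pi z + Ln (\<phi> z / z))"
    by (rule exp_conjugate_principal_part[OF nf fa(1) \<phi>a eq]) blast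
  obtain r2 where r2: "r2 > 0" "\<And>V. petal f (-1) V \<Longrightarrow> V \<subseteq> ball 0 r2 \<Longrightarrow>
    \<forall>\<^sub>F z in at 0 within V. \<phi> z \<notin> \<real>\<^sub>\<ge>\<^sub>0 \<and> Ln2pi (\<phi> z) = Ln2pi z + Ln (\<phi> z / z)"
    by (rule Ln2pi_germ[OF nf \<phi>a]) blast
  obtain r3 where r3: "r3 > 0" "\<And>V H z. petal G (-1) V \<Longrightarrow> V \<subseteq> ball 0 r3 \<Longrightarrow> principal_part G V H \<Longrightarrow> z \<in> V \<Longrightarrow>
    H z = \<i> * of_real (pi ^ 2) - of_real (pi / 4) - of_real pi * (Ln2pi z + Ln (\<phi>2 z / z))"
    by (rule exp_conjugate_principal_part[OF nG Ga \<phi>2a eq2]) blast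
  obtain r4 where r4: "r4 > 0" "\<And>V. petal G (-1) V \<Longrightarrow> V \<subseteq> ball 0 r4 \<Longrightarrow>
    \<forall>\<^sub>F z in at 0 within V. \<phi>' z \<notin> \<real>\<^sub>\<ge>\<^sub>0 \<and> Ln2pi (\<phi>' z) = Ln2pi z + Ln (\<phi>' z / z)"
    by (rule Ln2pi_germ[OF nG \<phi>'a]) blast
  define r where "r = Min {r1, r2, r3, r4}"
  have r: "r > 0" "r \<le> r1" "r \<le> r2" "r \<le> r3" "r \<le> r4" using r1 r2 r3 r4 by (auto simp: r_def)
  show ?thesis
  proof (rule that[OF r(1)])
    fix V H assume V: "attracting_petal f V" "V \<subseteq> ball 0 r" "principal_part f V H"
    have p: "petal f (-1) V" using V(1) by (simp add: attracting_petal_def)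
    have V1: "V \<subseteq> ball 0 r1" "V \<subseteq> ball 0 r2" using V(2) r by auto
    have "\<forall>\<^sub>F z in at 0 within V. z \<in> V" by (simp add: eventually_at_filter)
    with r2(2)[OF p V1(2)] show "\<forall>\<^sub>F z in at 0 within V. H z = \<i> * of_real (pi ^ 2) - of_real (pi / 4) - of_real pi * (Ln2pi z + Ln (\<phi> z / z)) \<and>
         Ln2pi (\<phi> z) = Ln2pi z + Ln (\<phi> z / z)"
      by eventually_elim (use r1(2)[OF p V1(1) V(3)] in blast)
  next
    fix V H assume V: "repelling_petal g V" "V \<subseteq> ball 0 r" "principal_part g V H"
    have p: "petal G (-1) (uminus ` V)" unfolding G_def using V(1) by (intro petal_uminus) (simp add: repelling_petal_def)
    have V1: "uminus ` V \<subseteq> ball 0 r3" "uminus ` V \<subseteq> ball 0 r4" using V(2) r by auto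
    have pp: "principal_part G (uminus ` V) (\<lambda>z. - H (- z))" unfolding G_def by (rule principal_part_uminus[OF V(3)])
    have "isCont Q 0" by (rule analytic_at_imp_isCont[OF Q(1)])
    \<comment> \<open>Near 0 the number z + Ln (Q z) has imaginary part in (-pi, pi), so it is the
      principal logarithm of exp z * Q z. Its summand z is the source of the term pi z on the
      repelling side.\<close>
    then have lim: "((\<lambda>z. z + Ln (Q z)) \<longlongrightarrow> 0 + Ln 1) (at 0 within V)"
      using Q(2) unfolding isCont_def by (intro tendsto_intros) (auto intro: tendsto_within_subset)
    then have "\<forall>\<^sub>F z in at 0 within V. norm (z + Ln (Q z)) < pi"
      using tendstoD[OF lim pi_gt_zero] by (simp add: dist_norm)
    moreover have "((\<lambda>z. Q z) \<longlongrightarrow> 1) (at 0 within V)"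
      using \<open>isCont Q 0\<close> Q(2) unfolding isCont_def by (auto intro: tendsto_within_subset)
    then have "\<forall>\<^sub>F z in at 0 within V. Q z \<noteq> 0" by (rule tendsto_imp_eventually_ne) simp
    moreover have "\<forall>\<^sub>F z in at 0 within V. z \<in> V" by (simp add: eventually_at_filter)
    moreover note eventually_compose_filterlim[OF r4(2)[OF p V1(2)] filterlim_uminus_within]
    ultimately show "\<forall>\<^sub>F z in at 0 within V. H z = of_real (pi / 4) + of_real pi * (z + Ln z + Ln (\<phi> z / z)) \<and>
         Ln (\<phi> z) = Ln z + Ln (\<phi> z / z)"
    proof eventually_elim
      case (elim z)
      have mz: "- z \<in> uminus ` V" using elim(3) by blast
      have nn: "- z \<notin> \<real>\<^sub>\<ge>\<^sub>0" by (rule petal_not_nonneg_Reals[OF p mz])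
      then have z0: "z \<noteq> 0" by auto
      have \<phi>z: "\<phi> z / z = Q z" using z0 by (simp add: Q(3))
      have "Im (z + Ln (Q z)) < pi" "- pi < Im (z + Ln (Q z))"
        using elim(1) abs_Im_le_cmod[of "z + Ln (Q z)"] by linarith+
      then have LnE: "Ln (exp z * Q z) = z + Ln (Q z)"
        using elim(2) by (intro Ln_unique) (auto simp: exp_add)
      have "\<phi>2 (- z) / (- z) = exp z * Q z" using z0 by (simp add: \<phi>2_eq)
      moreover have "- H (- (- z)) = \<i> * of_real (pi ^ 2) - of_real (pi / 4) - of_real pi * (Ln2pi (- z) + Ln (\<phi>2 (- z) / (- z)))"
        by (rule r3(2)[OF p V1(1) pp mz])
      \<comment> \<open>The i pi in \<open>Ln2pi (- z) = Ln z + \<i> * of_real pi\<close> cancels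
        the constant i pi^2, so no imaginary constant remains for g.\<close>
      ultimately have "- H z = \<i> * of_real (pi ^ 2) - of_real (pi / 4) - of_real pi * ((Ln z + \<i> * of_real pi) + (z + Ln (Q z)))"
        using nn by (simp add: Ln2pi_eq_Ln LnE)
      then have "H z = - (\<i> * of_real (pi ^ 2) - of_real (pi / 4) - of_real pi * ((Ln z + \<i> * of_real pi) + (z + Ln (Q z))))"
        by (metis minus_minus)
      also have "\<dots> = of_real (pi / 4) + of_real pi * (z + Ln z + Ln (\<phi> z / z))"
        unfolding \<phi>z by (simp add: algebra_simps power2_eq_square)
      finally have 1: "H z = of_real (pi / 4) + of_real pi * (z + Ln z + Ln (\<phi> z / z))" .
      have "\<phi>' (- z) / (- z) = Q z" using z0 by (simp add: \<phi>'_eq)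
      moreover have "\<phi>' (- z) = - \<phi> z" by (simp add: \<phi>'_def)
      ultimately have "- \<phi> z \<notin> \<real>\<^sub>\<ge>\<^sub>0" "Ln2pi (- \<phi> z) = Ln2pi (- z) + Ln (Q z)" using elim(4) by simp_all
      then have "Ln (\<phi> z) = Ln z + Ln (\<phi> z / z)" unfolding \<phi>z using nn by (simp add: Ln2pi_eq_Ln)
      with 1 show ?case by blast
    qed
  qed
qed

theorem theorem3:
  fixes f g :: "complex \<Rightarrow> complex"
  assumes "prenormalized f"
    and "formally_conjugate f (\<lambda>z. z / (1 - z))"
    and "inverse_germ f g"
  shows "\<exists>r>0. \<forall>Vp Vm Hp Hm.
    attracting_petal f Vp \<and> Vp \<subseteq> ball 0 r \<and> principal_part f Vp Hp \<and>
    repelling_petal g Vm \<and> Vm \<subseteq> ball 0 r \<and> principal_part g Vm Hm \<longrightarrow>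
    (glue_mod_log Vp (\<lambda>z. Hp z - \<i> * of_real (pi ^ 2)) Vm (\<lambda>z. of_real pi * z - Hm z)
      \<longleftrightarrow> (\<exists>\<phi>. exp_form f \<phi>)) \<and>
    (\<forall>\<phi>. exp_form f \<phi> \<longrightarrow>
      (\<forall>\<^sub>F z in at 0 within Vp.
         Hp z = - of_real pi * Ln2pi (\<phi> z) + \<i> * of_real (pi ^ 2) - of_real (pi / 4)) \<and>
      (\<forall>\<^sub>F z in at 0 within Vm.
         Hm z = of_real pi * z + of_real pi * Ln (\<phi> z) + of_real (pi / 4)))"
proof -
  have fa: "f analytic_on {0}" "f 0 = 0" using assms(1) by (auto simp: prenormalized_def)
  have nf: "near_translation f" using assms(1) by (rule prenormalized_near_translation)
  have glue: "\<exists>\<phi>. exp_form f \<phi>"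
    if "attracting_petal f Vp" "principal_part f Vp Hp"
      "glue_mod_log Vp (\<lambda>z. Hp z - \<i> * of_real (pi ^ 2)) Vm (\<lambda>z. of_real pi * z - Hm z)" for Vp Vm Hp Hm
    using that glue_imp_exp_form[OF fa nf] unfolding attracting_petal_def glue_mod_log_def by metis
  show ?thesis
  proof (cases "\<exists>\<phi>. exp_form f \<phi>")
    case False
    \<comment> \<open>Without any \<open>\<phi>\<close> gluing is impossible and the formulas hold
      vacuously, so the radius is arbitrary.\<close>
    then show ?thesis using glue by (intro exI[of _ 1]) auto
  next
    case True
    then obtain \<phi> where \<phi>: "exp_form f \<phi>" by blast
    obtain r where r: "r > 0"
      "\<And>V H. attracting_petal f V \<Longrightarrow> V \<subseteq> ball 0 r \<Longrightarrow> principal_part f V H \<Longrightarrow>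
         (\<forall>\<^sub>F z in at 0 within V. H z = \<i> * of_real (pi ^ 2) - of_real (pi / 4) - of_real pi * (Ln2pi z + Ln (\<phi> z / z)) \<and>
           Ln2pi (\<phi> z) = Ln2pi z + Ln (\<phi> z / z))"
      "\<And>V H. repelling_petal g V \<Longrightarrow> V \<subseteq> ball 0 r \<Longrightarrow> principal_part g V H \<Longrightarrow>
         (\<forall>\<^sub>F z in at 0 within V. H z = of_real (pi / 4) + of_real pi * (z + Ln z + Ln (\<phi> z / z)) \<and>
           Ln (\<phi> z) = Ln z + Ln (\<phi> z / z))"
      by (rule exp_form_principal_parts[OF assms(1,3) \<phi>]) blast
    have \<phi>a: "\<phi> analytic_on {0}" "\<phi> 0 = 0" "deriv \<phi> 0 = 1" using \<phi> by (auto simp: exp_form_def)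
    obtain Q where Q: "Q analytic_on {0}" "Q 0 = 1" "\<And>z. \<phi> z = z * Q z" by (rule germ_quotient[OF \<phi>a]) blast
    define G where "G z = - of_real pi * Ln (Q z) - of_real (pi / 4)" for z
    have "(\<lambda>z. Ln (Q z)) analytic_on {0}" using Q(1,2) by (intro analytic_on_ln) auto
    then have Ga: "G analytic_on {0}"
      unfolding G_def by (intro analytic_on_diff analytic_on_mult analytic_on_const)
    have quot: "\<forall>\<^sub>F z in at 0 within V. Ln (\<phi> z / z) = Ln (Q z)" for V
      by (auto simp: eventually_at_filter Q(3))
    show ?thesis
    proof (intro exI[of _ r] conjI r(1) allI impI; (elim conjE)?)
      fix Vp Vm Hp Hm
      assume V: "attracting_petal f Vp" "Vp \<subseteq> ball 0 r" "principal_part f Vp Hp"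
        "repelling_petal g Vm" "Vm \<subseteq> ball 0 r" "principal_part g Vm Hm"
      note P = r(2)[OF V(1-3)] and M = r(3)[OF V(4-6)]
      have "\<forall>\<^sub>F z in at 0 within Vp. Hp z - \<i> * of_real (pi ^ 2) + of_real pi * Ln2pi z = G z"
        using P quot by eventually_elim (simp add: G_def algebra_simps)
      moreover have "\<forall>\<^sub>F z in at 0 within Vm. of_real pi * z - Hm z + of_real pi * Ln z = G z"
        using M quot by eventually_elim (simp add: G_def algebra_simps)
      ultimately have "glue_mod_log Vp (\<lambda>z. Hp z - \<i> * of_real (pi ^ 2)) Vm (\<lambda>z. of_real pi * z - Hm z)"
        unfolding glue_mod_log_def using Ga by blast
      then show "glue_mod_log Vp (\<lambda>z. Hp z - \<i> * of_real (pi ^ 2)) Vm (\<lambda>z. of_real pi * z - Hm z)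
          \<longleftrightarrow> (\<exists>\<phi>. exp_form f \<phi>)" using True by blast
      \<comment> \<open>The radius was fixed with one \<open>\<phi>\<close>, before the petals and
        \<open>\<theta>\<close> are given; uniqueness of the germ transfers the formulas to
        \<open>\<theta>\<close>.\<close>
      fix \<theta> assume \<theta>: "exp_form f \<theta>"
      have pf: "petal f (-1) Vp" using V(1) by (simp add: attracting_petal_def)
      obtain \<rho> where \<rho>: "\<rho> > 0" "\<And>t. 0 < t \<Longrightarrow> t < \<rho> \<Longrightarrow> of_real t * (-1) \<in> Vp"
        by (rule petal_contains_ray[OF pf]) auto
      have "of_real (\<rho> / 2) * (-1) \<in> Vp" by (rule \<rho>(2)) (use \<rho>(1) in simp_all)
      then have "\<forall>\<^sub>F z in nhds 0. \<theta> z = \<phi> z" by (rule exp_form_unique[OF fa nf pf _ \<theta> \<phi>])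
      then have uniq: "\<forall>\<^sub>F z in at 0 within V. \<theta> z = \<phi> z" for V
        unfolding eventually_at_filter by (auto elim: eventually_mono)
      show "\<forall>\<^sub>F z in at 0 within Vp. Hp z = - of_real pi * Ln2pi (\<theta> z) + \<i> * of_real (pi ^ 2) - of_real (pi / 4)"
        using P uniq by eventually_elim simp
      show "\<forall>\<^sub>F z in at 0 within Vm. Hm z = of_real pi * z + of_real pi * Ln (\<theta> z) + of_real (pi / 4)"
        using M uniq by eventually_elim (simp add: algebra_simps)
    qed
  qed
qed

end
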